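(* Let $(T,E)$ be the infinite regular tree in which each vertex has degree 3, and let $\mathcal U=(U_e)_{e\in E}$ be i.i.d. uniformly distributed $[0,1]$-valued random variables. It is possible to couple $\mathcal U$ to a random subset $\vec F\subset\vec E$ with the following properties: (i) $(v,w)\in\vec F$ if and only if there exists a ray $(v_n,w_n)_{n\ge 0}$ with $(v_0,w_0)=(v,w)$ and $(v_n,w_n)\in\vec E_{U_{\{v,w\}}}\setminus\vec F$ for all $n\ge 1$. (ii) The law of $(\mathcal U,\vec F)$ is invariant under automorphisms of the tree. (iii) Let $\mathcal U_{(v,w)}:=(U_e)_{e\in E_{(v,w)}}$ and $\vec F_{(v,w)}:=\vec F\cap\vec E_{(v,w)}$. Then, for each finite subtree $S\subset T$, the random variables $(\mathcal U_{(v,w)},\vec F_{(v,w)})_{(v,w)\in\partial S}$ are independent of each other and of $(U_e)_{e\in E_S}$. These properties uniquely determine the joint law of $(\mathcal U,\vec F)$. Moreover, setting $F:=\big\{\{v,w\}\in E:(v,w)\in\vec F\text{ or }(w,v)\in\vec F\big\}$ defines a pair $(\mathcal U,F)$ with the following two properties: (a) for every $e\in E$, $e\notin F$ if and only if no endvertex of $e$ is part of an infinite cluster of $E_{U_e}\setminus(F\cup\{e\})$; (b) the law of $(\mathcal U,F)$ is invariant under automorphisms of the tree.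
   Context: Notation. $\vec E:=\{(v,w),(w,v):\{v,w\}\in E\}$ contains two oriented edges for every unoriented edge. For $t\in[0,1]$, $E_t:=\{e\in E:U_e\le t\}$ and $\vec E_t:=\{(v,w)\in\vec E:U_{\{v,w\}}\le t\}$. A ray is an infinite sequence of oriented edges $(v_n,w_n)_{n\ge0}$ with $v_n=w_{n-1}$ and $w_n\ne v_{n-1}$ for all $n\ge1$. For $(v,w)\in\vec E$, $\vec E_{(v,w)}$ is the set of all $(v',w')\in\vec E$ such that there is a ray $(v_n,w_n)_{n\ge0}$ with $(v_0,w_0)=(v,w)$ and $(v_m,w_m)=(v',w')$ for some $m\ge0$; and $E_{(v,w)}:=\{\{v',w'\}:(v',w')\in\vec E_{(v,w)}\}$. For $S\subset T$ (a set of vertices), $\partial S:=\{(v,w)\in\vec E:v\in S,\ w\in T\setminus S\}$ and $E_S:=\{\{v,w\}\in E:v\in S,\ w\in S\}$; $S$ is called a subtree if the graph $(S,E_S)$ is a tree. Clusters of a set of edges are the connected components of the graph with vertex set $T$ and that edge set. Pathwise properties such as (i) and (a) are understood to hold almost surely (simultaneously for all edges). *)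

theory Defs
  imports "HOL-Probability.Probability"
begin

section \<open>Trees\<close>

text \<open>
  A simple graph is given by a vertex set \<open>T\<close> and a set \<open>E\<close> of unordered pairs of distinct vertices.
\<close>

definition simple_graph :: "'v set \<Rightarrow> 'v set set \<Rightarrow> bool" where
  "simple_graph T E \<longleftrightarrow> (\<forall>e\<in>E. \<exists>v w. v \<in> T \<and> w \<in> T \<and> v \<noteq> w \<and> e = {v, w})"

definition oriented :: "'v set set \<Rightarrow> ('v \<times> 'v) set" where
  "oriented E = {(v, w). {v, w} \<in> E}"

definition cycle :: "'v set set \<Rightarrow> 'v list \<Rightarrow> bool" where
  "cycle E vs \<longleftrightarrow> 3 \<le> length vs \<and> distinct vs \<and>
     (\<forall>i < length vs. {vs ! i, vs ! (Suc i mod length vs)} \<in> E)"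

definition is_tree :: "'v set \<Rightarrow> 'v set set \<Rightarrow> bool" where
  "is_tree T E \<longleftrightarrow> simple_graph T E \<and> T \<noteq> {} \<and>
     (\<forall>v\<in>T. \<forall>w\<in>T. (v, w) \<in> (oriented E)\<^sup>*) \<and> (\<nexists>vs. cycle E vs)"

definition vertex_degree :: "'v set set \<Rightarrow> 'v \<Rightarrow> nat" where
  "vertex_degree E v = card {e \<in> E. v \<in> e}"

definition automorphisms :: "'v set \<Rightarrow> 'v set set \<Rightarrow> ('v \<Rightarrow> 'v) set" where
  "automorphisms T E =
     {\<phi>. bij_betw \<phi> T T \<and> (\<forall>v\<in>T. \<forall>w\<in>T. {\<phi> v, \<phi> w} \<in> E \<longleftrightarrow> {v, w} \<in> E)}"

definition clusters :: "'v set \<Rightarrow> 'v set set \<Rightarrow> 'v set set" where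
  "clusters T D = (\<lambda>v. {w \<in> T. (v, w) \<in> (oriented D)\<^sup>*}) ` T"

definition ray :: "'v set set \<Rightarrow> (nat \<Rightarrow> 'v \<times> 'v) \<Rightarrow> bool" where
  "ray E p \<longleftrightarrow> (\<forall>n. p n \<in> oriented E) \<and>
     (\<forall>n. fst (p (Suc n)) = snd (p n) \<and> snd (p (Suc n)) \<noteq> fst (p n))"

definition descendants :: "'v set set \<Rightarrow> 'v \<times> 'v \<Rightarrow> ('v \<times> 'v) set" where
  "descendants E a = {b \<in> oriented E. \<exists>p m. ray E p \<and> p 0 = a \<and> p m = b}"

definition unoriented :: "('v \<times> 'v) set \<Rightarrow> 'v set set" where
  "unoriented D = (\<lambda>(v, w). {v, w}) ` D"

definition boundary :: "'v set \<Rightarrow> 'v set set \<Rightarrow> 'v set \<Rightarrow> ('v \<times> 'v) set" where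
  "boundary T E S = {(v, w) \<in> oriented E. v \<in> S \<and> w \<in> T - S}"

definition induced_edges :: "'v set set \<Rightarrow> 'v set \<Rightarrow> 'v set set" where
  "induced_edges E S = {e \<in> E. e \<subseteq> S}"

definition finite_subtree :: "'v set \<Rightarrow> 'v set set \<Rightarrow> 'v set \<Rightarrow> bool" where
  "finite_subtree T E S \<longleftrightarrow> S \<subseteq> T \<and> finite S \<and> is_tree S (induced_edges E S)"

definition edges_upto :: "'v set set \<Rightarrow> ('v set \<Rightarrow> real) \<Rightarrow> real \<Rightarrow> 'v set set" where
  "edges_upto E u t = {e \<in> E. u e \<le> t}"


section \<open>Random labels and random edge sets\<close>

text \<open>
  The product \<open>\<sigma>\<close>-algebra on the power set of \<open>D\<close>: it is generated by the maps \<open>X \<mapsto> (d \<in> X)\<close>, for \<open>d\<close> in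
  \<open>D\<close>. A random subset of \<open>D\<close> is a measurable map into this space.
\<close>

definition subset_space :: "'d set \<Rightarrow> 'd set measure" where
  "subset_space D = sigma (Pow D) ((\<lambda>d. {X \<in> Pow D. d \<in> X}) ` D)"

definition pair_space :: "'e set \<Rightarrow> 'd set \<Rightarrow> (('e \<Rightarrow> real) \<times> 'd set) measure" where
  "pair_space A D = (\<Pi>\<^sub>M e\<in>A. borel) \<Otimes>\<^sub>M subset_space D"

definition joint_law ::
  "'e set \<Rightarrow> 'd set \<Rightarrow> 'm measure \<Rightarrow> ('e \<Rightarrow> 'm \<Rightarrow> real) \<Rightarrow> ('m \<Rightarrow> 'd set)
     \<Rightarrow> (('e \<Rightarrow> real) \<times> 'd set) measure" where
  "joint_law A D M U F = distr M (pair_space A D) (\<lambda>\<omega>. (\<lambda>e\<in>A. U e \<omega>, F \<omega>))"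

text \<open>
  \<open>F\<close> is a random subset of \<open>D\<close>, where \<open>D\<close> is either the set of oriented or the set of unoriented edges
  and \<open>act \<phi>\<close> is the action of the automorphism \<open>\<phi>\<close> on \<open>D\<close>. The configuration is pulled back along \<open>\<phi>\<close>;
  as automorphisms form a group, pushing it forward gives the same condition.
\<close>

definition invariant_law ::
  "'v set \<Rightarrow> 'v set set \<Rightarrow> 'd set \<Rightarrow> (('v \<Rightarrow> 'v) \<Rightarrow> 'd \<Rightarrow> 'd)
     \<Rightarrow> 'm measure \<Rightarrow> ('v set \<Rightarrow> 'm \<Rightarrow> real) \<Rightarrow> ('m \<Rightarrow> 'd set) \<Rightarrow> bool" where
  "invariant_law T E D act M U F \<longleftrightarrow>
     (\<forall>\<phi>\<in>automorphisms T E.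
        joint_law E D M (\<lambda>e. U (\<phi> ` e)) (\<lambda>\<omega>. {d \<in> D. act \<phi> d \<in> F \<omega>}) = joint_law E D M U F)"

definition iid_uniform :: "'e set \<Rightarrow> 'm measure \<Rightarrow> ('e \<Rightarrow> 'm \<Rightarrow> real) \<Rightarrow> bool" where
  "iid_uniform A M U \<longleftrightarrow>
     (\<forall>e\<in>A. U e \<in> space M \<rightarrow> {0..1} \<and> distr M borel (U e) = uniform_measure lborel {0..1}) \<and>
     prob_space.indep_vars M (\<lambda>_. borel) U A"


section \<open>The coupling\<close>

definition ray_condition :: "'v set set \<Rightarrow> ('v set \<Rightarrow> real) \<Rightarrow> ('v \<times> 'v) set \<Rightarrow> bool" where
  "ray_condition E u F \<longleftrightarrow>
     (\<forall>(v, w) \<in> oriented E.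
        (v, w) \<in> F \<longleftrightarrow>
        (\<exists>p. ray E p \<and> p 0 = (v, w) \<and>
             (\<forall>n\<ge>1. p n \<in> oriented (edges_upto E u (u {v, w})) - F)))"

text \<open>
  For each boundary edge \<open>a\<close>, the labels and the part of \<open>F\<close> in the branch starting with \<open>a\<close> form one
  random variable. These variables and the labels of the inner edges of \<open>S\<close> take values in spaces of
  different types, so joint independence is expressed through the generated \<open>\<sigma>\<close>-algebras, with index
  \<open>None\<close> for the inner edges and \<open>Some a\<close> for the branch of \<open>a\<close>.
\<close>

definition branch_independence ::
  "'v set \<Rightarrow> 'v set set \<Rightarrow> 'm measure \<Rightarrow> ('v set \<Rightarrow> 'm \<Rightarrow> real) \<Rightarrow> ('m \<Rightarrow> ('v \<times> 'v) set) \<Rightarrow> bool" where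
  "branch_independence T E M U F \<longleftrightarrow>
     (\<forall>S. finite_subtree T E S \<longrightarrow>
        prob_space.indep_sets M
          (\<lambda>i. case i of
             None \<Rightarrow>
               sets (vimage_algebra (space M)
                 (\<lambda>\<omega>. \<lambda>e\<in>induced_edges E S. U e \<omega>)
                 (\<Pi>\<^sub>M e\<in>induced_edges E S. borel))
           | Some a \<Rightarrow>
               sets (vimage_algebra (space M)
                 (\<lambda>\<omega>. (\<lambda>e\<in>unoriented (descendants E a). U e \<omega>, F \<omega> \<inter> descendants E a))
                 (pair_space (unoriented (descendants E a)) (descendants E a))))
          (insert None (Some ` boundary T E S)))"

definition frozen_coupling ::
  "'v set \<Rightarrow> 'v set set \<Rightarrow> 'm measure \<Rightarrow> ('v set \<Rightarrow> 'm \<Rightarrow> real) \<Rightarrow> ('m \<Rightarrow> ('v \<times> 'v) set) \<Rightarrow> bool" where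
  "frozen_coupling T E M U F \<longleftrightarrow>
     prob_space M \<and> iid_uniform E M U \<and> F \<in> M \<rightarrow>\<^sub>M subset_space (oriented E) \<and>
     (AE \<omega> in M. ray_condition E (\<lambda>e. U e \<omega>) (F \<omega>)) \<and>
     invariant_law T E (oriented E) (\<lambda>\<phi>. map_prod \<phi> \<phi>) M U F \<and>
     branch_independence T E M U F"

definition freezing_rule :: "'v set \<Rightarrow> 'v set set \<Rightarrow> ('v set \<Rightarrow> real) \<Rightarrow> 'v set set \<Rightarrow> bool" where
  "freezing_rule T E u F \<longleftrightarrow>
     (\<forall>e\<in>E. e \<notin> F \<longleftrightarrow>
        \<not> (\<exists>v\<in>e. \<exists>C\<in>clusters T (edges_upto E u (u e) - (F \<union> {e})). infinite C \<and> v \<in> C))"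

end

theory Submission
  imports Defs
begin

text \<open>
  Let \<open>X\<^sub>a\<close> be the first time at which a ray starting with the oriented edge \<open>a\<close> percolates through open edges outside
  \<open>F\<close>. Condition (i) says that \<open>a\<close> is in \<open>F\<close> iff \<open>min X\<^sub>b X\<^sub>c \<le> U\<^sub>a\<close> for the two children \<open>b, c\<close> of \<open>a\<close>, and then
  \<open>X\<^sub>a = \<infinity>\<close>, while otherwise \<open>X\<^sub>a = min X\<^sub>b X\<^sub>c\<close>. By (ii) and (iii) the law of \<open>X\<^sub>a\<close> solves a recursive distributional
  equation. With \<open>S t = P (X\<^sub>a > t)\<close>, the open edges below \<open>a\<close> on the event \<open>X\<^sub>a > t\<close> form a branching process with mean
  offspring \<open>2 t S t\<close> that must die out, so \<open>2 t S t \<le> 1\<close>; this selects the solution \<open>S t = min 1 (1 / (2 t))\<close>. The values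
  of \<open>X\<close> inside a finite subtree are determined by the independent labels inside and times at its boundary, which
  gives uniqueness. Conversely these finite laws are consistent, and in their Kolmogorov limit the critical
  branching processes die out, so that the solution of the recursion is the true percolation time.

  For (a), among the rays witnessing that \<open>a\<close> is frozen, follow one of minimal level: the reversal of none of
  its edges can be frozen, provided that all labels are distinct.
\<close>

section \<open>Cubic trees\<close>

text \<open>The recursion alone does not determine the law of a time. It reads
  \<open>dS = t d(S^2)\<close>, so where \<open>S\<close> is continuous it can only move while
  \<open>2 t S = 1\<close>; but \<open>S\<close> may also stay flat and then jump, and a jump at
  \<open>t\<close> satisfies \<open>t (S(t-) + S(t)) = 1\<close>. Just before a jump
  \<open>2 t S\<close> exceeds 1, which is why a one-sided bound is enough to exclude every solution
  but one. Nor must a solution of the recursion consist of percolation times: a solution that is at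
  most \<open>t\<close> always comes with a percolating ray, but it may be later than the
  percolation time, and only extinction rules this out. Hence the same branching process is used
  twice, with unknown \<open>S\<close> for a given coupling and with known \<open>S\<close> for the
  limit law. Extinction is needed exactly at criticality, as \<open>2 t S t = 1\<close> for all
  \<open>t\<close> between 1/2 and 1. Invariance is not built into the limit: permuted coordinates
  satisfy the same recursion and the same independence, so it follows from uniqueness.\<close>

locale cubic_tree =
  fixes T :: "'v set" and E :: "'v set set"
  assumes tree: "is_tree T E"
    and degree_3: "\<And>v. v \<in> T \<Longrightarrow> vertex_degree E v = 3"
begin

definition children :: "'v \<times> 'v \<Rightarrow> ('v \<times> 'v) set" where
  "children a = {(snd a, x) | x. {snd a, x} \<in> E \<and> x \<noteq> fst a}"

abbreviation edge :: "'v \<times> 'v \<Rightarrow> 'v set" where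
  "edge a \<equiv> {fst a, snd a}"

definition child_rel :: "(('v \<times> 'v) \<times> ('v \<times> 'v)) set" where
  "child_rel = {(a, b). a \<in> oriented E \<and> b \<in> children a}"

definition branch_vertices :: "'v \<times> 'v \<Rightarrow> 'v set" where
  "branch_vertices a = snd ` descendants E a"

abbreviation branch_edges :: "'v \<times> 'v \<Rightarrow> 'v set set" where
  "branch_edges a \<equiv> unoriented (descendants E a)"

fun nonbacktracking :: "'v list \<Rightarrow> bool" where
  "nonbacktracking [] = True"
| "nonbacktracking [x] = True"
| "nonbacktracking [x, y] = ({x, y} \<in> E)"
| "nonbacktracking (x # y # z # zs) = ({x, y} \<in> E \<and> x \<noteq> z \<and> nonbacktracking (y # z # zs))"

lemma edgeD: assumes "{v, w} \<in> E" shows "v \<in> T" "w \<in> T" "v \<noteq> w"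
proof -
  have "simple_graph T E" using tree by (simp add: is_tree_def)
  then obtain x y where "x \<in> T" "y \<in> T" "x \<noteq> y" "{v, w} = {x, y}"
    using assms unfolding simple_graph_def by blast
  then show "v \<in> T" "w \<in> T" "v \<noteq> w" by (auto simp: doubleton_eq_iff)
qed

lemma no_loop [simp]: "{v} \<notin> E"
  using edgeD(3)[of v v] by auto

lemma oriented_iff: "a \<in> oriented E \<longleftrightarrow> edge a \<in> E"
  by (cases a) (simp add: oriented_def)

lemma oriented_swap: "prod.swap a \<in> oriented E \<longleftrightarrow> a \<in> oriented E"
  by (simp add: oriented_iff insert_commute)

lemma edge_cases: assumes "e \<in> E" obtains a where "a \<in> oriented E" "e = edge a"
proof -
  have "simple_graph T E" using tree by (simp add: is_tree_def)
  then obtain v w where "e = {v, w}" using assms unfolding simple_graph_def by blast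
  with assms that[of "(v, w)"] show ?thesis by (simp add: oriented_iff)
qed

lemma childrenD:
  assumes "c \<in> children a"
  shows "c \<in> oriented E" "fst c = snd a" "snd c \<noteq> fst a" "edge c \<in> E"
  using assms by (auto simp: children_def oriented_iff)

lemma children_iff: "c \<in> children a \<longleftrightarrow> c \<in> oriented E \<and> fst c = snd a \<and> snd c \<noteq> fst a"
  by (cases c) (auto simp: children_def oriented_iff)

lemma neighbours_card: assumes "v \<in> T" shows "card {x. {v, x} \<in> E} = 3"
proof -
  have "bij_betw (\<lambda>x. {v, x}) {x. {v, x} \<in> E} {e \<in> E. v \<in> e}"
  proof (rule bij_betwI')
    fix e assume "e \<in> {e \<in> E. v \<in> e}"
    then have e: "e \<in> E" "v \<in> e" by auto
    from e(1) obtain a where "e = edge a" by (rule edge_cases)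
    with e have "e = {v, fst a} \<or> e = {v, snd a}" by auto
    with e show "\<exists>x\<in>{x. {v, x} \<in> E}. e = {v, x}" by auto
  qed (auto simp: doubleton_eq_iff)
  then show ?thesis
    using degree_3[OF assms] bij_betw_same_card by (fastforce simp: vertex_degree_def)
qed

lemma finite_neighbours: "finite {x. {v, x} \<in> E}"
proof (cases "v \<in> T")
  case True then show ?thesis using neighbours_card by (metis card.infinite zero_neq_numeral)
next
  case False then have "{x. {v, x} \<in> E} = {}" using edgeD by auto
  then show ?thesis by simp
qed

lemma children_card: assumes "a \<in> oriented E" shows "card (children a) = 2"
proof -
  have e: "{snd a, fst a} \<in> E" using assms by (simp add: oriented_iff insert_commute)
  have "children a = Pair (snd a) ` ({x. {snd a, x} \<in> E} - {fst a})"
    by (auto simp: children_def)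
  then have "card (children a) = card ({x. {snd a, x} \<in> E} - {fst a})"
    by (simp add: card_image inj_on_def)
  also have "\<dots> = 2"
    using neighbours_card[of "snd a"] edgeD[OF e] e finite_neighbours by (subst card_Diff_singleton) auto
  finally show ?thesis .
qed

lemma children_finite [simp]: "finite (children a)"
proof -
  have "children a \<subseteq> Pair (snd a) ` {x. {snd a, x} \<in> E}" by (auto simp: children_def)
  then show ?thesis using finite_neighbours finite_subset by blast
qed

lemma children_nonempty: "a \<in> oriented E \<Longrightarrow> children a \<noteq> {}"
  using children_card[of a] by auto

lemma children_pair:
  assumes "a \<in> oriented E" obtains c d where "children a = {c, d}" "c \<noteq> d"
  using children_card[OF assms] card_2_iff by metis

lemma nonbacktracking_tl: "nonbacktracking (x # xs) \<Longrightarrow> nonbacktracking xs"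
  by (cases "x # xs" rule: nonbacktracking.cases) auto

text \<open>The condition involves only three consecutive vertices, so two walks can be glued along
  an overlap of two.\<close>

lemma nonbacktracking_join:
  "nonbacktracking (xs @ [x, y]) \<Longrightarrow> nonbacktracking (x # y # zs) \<Longrightarrow> nonbacktracking (xs @ x # y # zs)"
proof (induction xs)
  case (Cons a xs)
  then have "nonbacktracking (xs @ x # y # zs)"
    using nonbacktracking_tl by (metis append_Cons)
  with Cons.prems show ?case
    by (cases xs rule: nonbacktracking.cases) auto
qed auto

lemma nonbacktracking_rev: "nonbacktracking xs \<Longrightarrow> nonbacktracking (rev xs)"
proof (induction xs rule: nonbacktracking.induct)
  case (4 x y z zs)
  then have "nonbacktracking (rev zs @ [z, y])" "nonbacktracking [z, y, x]"
    by (auto simp: insert_commute) (cases zs; auto)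
  from nonbacktracking_join[OF this] show ?case by simp
qed (auto simp: insert_commute)

lemma nonbacktracking_prefix: "nonbacktracking (xs @ ys) \<Longrightarrow> nonbacktracking xs"
proof (induction xs rule: nonbacktracking.induct)
  case (3 x y) then show ?case by (cases ys) auto
qed auto

lemma nonbacktracking_suffix: "nonbacktracking (xs @ ys) \<Longrightarrow> nonbacktracking ys"
  by (induction xs) (auto dest: nonbacktracking_tl)

lemma nonbacktracking_nth:
  "nonbacktracking xs \<Longrightarrow> Suc i < length xs \<Longrightarrow> {xs ! i, xs ! Suc i} \<in> E"
proof (induction xs arbitrary: i rule: nonbacktracking.induct)
  case (4 x y z zs) then show ?case by (cases i) auto
qed auto

text \<open>Absence of cycles enters here. By induction the tail of the walk is distinct, so a
  return to its first vertex would close a cycle.\<close>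

lemma nonbacktracking_distinct: "nonbacktracking xs \<Longrightarrow> distinct xs"
proof (induction xs)
  case (Cons x ys)
  then have ys: "distinct ys" using nonbacktracking_tl by blast
  have "x \<notin> set ys"
  proof
    assume "x \<in> set ys"
    then obtain ps qs where eq: "ys = ps @ x # qs" by (meson split_list)
    let ?c = "x # ps"
    have nb: "nonbacktracking (?c @ [x])"
      using Cons.prems nonbacktracking_prefix[of "x # ps @ [x]" qs] unfolding eq by simp
    have "distinct ?c" using ys eq by auto
    moreover have "3 \<le> length ?c"
    proof -
      \<comment> \<open>A closed walk of length 1 would use a loop, one of length 2 would
        backtrack.\<close>
      have "ps \<noteq> []" using nb by auto
      moreover have "ps \<noteq> [p]" for p using nb by auto
      ultimately show ?thesis by (cases ps; cases "tl ps") auto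
    qed
    moreover have "\<forall>i < length ?c. {?c ! i, ?c ! (Suc i mod length ?c)} \<in> E"
    proof (intro allI impI)
      fix i assume i: "i < length ?c"
      have e: "{(?c @ [x]) ! i, (?c @ [x]) ! Suc i} \<in> E"
        by (rule nonbacktracking_nth[OF nb]) (use i in simp)
      show "{?c ! i, ?c ! (Suc i mod length ?c)} \<in> E"
      proof (cases "Suc i = length ?c")
        case True
        then have "(?c @ [x]) ! Suc i = x" "(?c @ [x]) ! i = ?c ! i"
          by (metis nth_append_length, metis i nth_append)
        then show ?thesis using e True by simp
      next
        case False
        then have s: "Suc i < length ?c" using i by simp
        then have "(?c @ [x]) ! Suc i = ?c ! Suc i" "(?c @ [x]) ! i = ?c ! i"
          by (metis nth_append, metis i nth_append)
        then show ?thesis using e s by simp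
      qed
    qed
    ultimately have "cycle E ?c" unfolding cycle_def by blast
    then show False using tree by (auto simp: is_tree_def)
  qed
  with ys show ?case by simp
qed simp

section \<open>Rays and descendants\<close>

lemma ray_iff: "ray E p \<longleftrightarrow> p 0 \<in> oriented E \<and> (\<forall>n. p (Suc n) \<in> children (p n))"
proof
  assume R: "p 0 \<in> oriented E \<and> (\<forall>n. p (Suc n) \<in> children (p n))"
  then have "p n \<in> oriented E" for n by (cases n) (auto dest: childrenD)
  with R show "ray E p" by (auto simp: ray_def children_iff)
qed (auto simp: ray_def children_iff)

lemma choose_ray:
  assumes "a \<in> oriented E" "Q a"
    and "\<And>b. b \<in> oriented E \<Longrightarrow> Q b \<Longrightarrow> \<exists>c\<in>children b. Q c"
  obtains p where "ray E p" "p 0 = a" "\<And>n. Q (p n)"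
proof -
  \<comment> \<open>The clause for \<open>n = 0\<close> in the invariant pins the start of the
    chosen sequence, which dependent choice leaves free.\<close>
  obtain p where p: "p 0 = a" "\<And>n. (p n \<in> oriented E \<and> Q (p n)) \<and> p (Suc n) \<in> children (p n)"
    using dependent_nat_choice[of "\<lambda>n b. (b \<in> oriented E \<and> Q b) \<and> (n = 0 \<longrightarrow> b = a)" "\<lambda>n b c. c \<in> children b"]
      assms childrenD(1) by (metis Zero_not_Suc)
  with assms(1) that[of p] show ?thesis by (auto simp: ray_iff)
qed

lemma ray_shift: "ray E p \<Longrightarrow> ray E (\<lambda>n. p (n + k))"
  by (auto simp: ray_def)

lemma ray_Cons: "ray E p \<Longrightarrow> a \<in> oriented E \<Longrightarrow> p 0 \<in> children a \<Longrightarrow> ray E (case_nat a p)"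
  unfolding ray_iff by (auto split: nat.split)

lemma ray_crel: "ray E p \<Longrightarrow> (p 0, p n) \<in> child_rel\<^sup>*"
proof (induction n)
  case (Suc n)
  then have "(p n, p (Suc n)) \<in> child_rel" by (auto simp: ray_def child_rel_def children_iff)
  with Suc show ?case by auto
qed simp

lemma ray_exists: assumes "a \<in> oriented E" obtains p where "ray E p" "p 0 = a"
  using choose_ray[of a "\<lambda>_. True"] assms children_nonempty by (metis ex_in_conv)

text \<open>A finite chain of child steps lies on a ray because every oriented edge has a child, so
  that the chain can be prolonged forever.\<close>

lemma descendants_eq: assumes "a \<in> oriented E" shows "descendants E a = {b. (a, b) \<in> child_rel\<^sup>*}"
proof (intro set_eqI iffI)
  fix b assume "b \<in> descendants E a"
  then obtain p m where "ray E p" "p 0 = a" "p m = b" by (auto simp: descendants_def)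
  then show "b \<in> {b. (a, b) \<in> child_rel\<^sup>*}" using ray_crel by auto
next
  fix b assume "b \<in> {b. (a, b) \<in> child_rel\<^sup>*}"
  then have "(a, b) \<in> child_rel\<^sup>*" by simp
  moreover have "b \<in> oriented E" using calculation assms
    by (induction) (auto simp: child_rel_def dest: childrenD)
  moreover have "\<exists>p m. ray E p \<and> p 0 = a \<and> p m = b"
    using calculation(1) assms
  proof (induction rule: converse_rtrancl_induct)
    case base then show ?case using calculation(2) ray_exists by metis
  next
    case (step y z)
    then have z: "z \<in> children y" "z \<in> oriented E" by (auto simp: child_rel_def dest: childrenD)
    then obtain p m where "ray E p" "p 0 = z" "p m = b" using step by auto
    then have "ray E (case_nat y p)" "case_nat y p 0 = y" "case_nat y p (Suc m) = b"
      using ray_Cons step z by auto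
    then show ?case by blast
  qed
  ultimately show "b \<in> descendants E a" by (auto simp: descendants_def)
qed

lemma descendants_self: "a \<in> oriented E \<Longrightarrow> a \<in> descendants E a"
  by (simp add: descendants_eq)

lemma descendants_oriented: "descendants E a \<subseteq> oriented E"
  by (auto simp: descendants_def)

lemma descendants_unfold:
  assumes "a \<in> oriented E"
  shows "descendants E a = insert a (\<Union>c\<in>children a. descendants E c)"
proof -
  have "descendants E a = insert a {b. \<exists>c\<in>children a. (c, b) \<in> child_rel\<^sup>*}"
    using assms unfolding descendants_eq[OF assms]
    by (auto simp: child_rel_def elim: converse_rtranclE intro: converse_rtrancl_into_rtrancl)
  then show ?thesis using childrenD(1) by (auto simp: descendants_eq)
qed

lemma descendants_child:
  assumes "a \<in> oriented E" "b \<in> descendants E a" shows "children b \<subseteq> descendants E a"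
proof
  fix c assume "c \<in> children b"
  moreover have "b \<in> oriented E" using assms(2) descendants_oriented by blast
  ultimately have "(b, c) \<in> child_rel" by (auto simp: child_rel_def)
  then show "c \<in> descendants E a" using assms by (auto simp: descendants_eq intro: rtrancl_into_rtrancl)
qed

section \<open>Branches and their disjointness\<close>

lemma branch_edges_iff: "branch_edges a = edge ` descendants E a"
  unfolding unoriented_def by (rule image_cong) (auto split: prod.split)

text \<open>Turns descendants into nonbacktracking walks, so that distinctness of vertices becomes
  applicable.\<close>

lemma descendants_walk:
  assumes "a \<in> oriented E" "b \<in> descendants E a"
  shows "\<exists>xs ys. nonbacktracking (fst a # snd a # xs) \<and> fst a # snd a # xs = ys @ [fst b, snd b]"
proof -
  have "(a, b) \<in> child_rel\<^sup>*" using assms by (simp add: descendants_eq)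
  then show ?thesis
  proof induction
    case base show ?case using assms by (intro exI[of _ "[]"]) (auto simp: oriented_iff)
  next
    case (step b c)
    then obtain xs ys where *: "nonbacktracking (fst a # snd a # xs)" "fst a # snd a # xs = ys @ [fst b, snd b]"
      by auto
    have c: "c \<in> children b" "b \<in> oriented E" using step by (auto simp: child_rel_def)
    then have "nonbacktracking ([fst b, snd b, snd c])"
      using childrenD[OF c(1)] by (auto simp: oriented_iff)
    then have "nonbacktracking (ys @ fst b # snd b # [snd c])"
      using nonbacktracking_join * by auto
    moreover have "ys @ fst b # snd b # [snd c] = fst a # snd a # (xs @ [snd c])"
      using *(2) by (metis append.assoc append_Cons append_Nil)
    ultimately show ?case using childrenD(2)[OF c(1)]
      by (metis append.assoc append_Cons append_Nil)
  qed
qed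

lemma branch_walk:
  assumes "a \<in> oriented E" "x \<in> branch_vertices a"
  obtains xs where "nonbacktracking (fst a # snd a # xs)" "last (snd a # xs) = x"
proof -
  obtain b where b: "b \<in> descendants E a" "x = snd b" using assms by (auto simp: branch_vertices_def)
  obtain xs ys where *: "nonbacktracking (fst a # snd a # xs)" "fst a # snd a # xs = ys @ [fst b, snd b]"
    using descendants_walk[OF assms(1) b(1)] by auto
  then have "last (snd a # xs) = last (ys @ [fst b, snd b])" by (metis last_ConsR list.distinct(1))
  then show ?thesis using that[OF *(1)] b by simp
qed

lemma branch_root: "a \<in> oriented E \<Longrightarrow> fst a \<notin> branch_vertices a"
proof
  assume a: "a \<in> oriented E" "fst a \<in> branch_vertices a"
  then obtain xs where xs: "nonbacktracking (fst a # snd a # xs)" "last (snd a # xs) = fst a"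
    by (rule branch_walk)
  then have "distinct (fst a # snd a # xs)" using nonbacktracking_distinct by blast
  then show False using xs(2) by (metis distinct.simps(2) last_in_set list.distinct(1))
qed

text \<open>Walking out of one branch, through the common root and into the other never backtracks;
  a shared vertex would occur twice on this walk.\<close>

lemma branch_disjoint:
  assumes "a \<in> oriented E" "b \<in> oriented E" "fst a = fst b" "a \<noteq> b"
  shows "branch_vertices a \<inter> branch_vertices b = {}"
proof (rule ccontr)
  assume "\<not> ?thesis"
  then obtain x where x: "x \<in> branch_vertices a" "x \<in> branch_vertices b" by auto
  obtain xs where xs: "nonbacktracking (fst a # snd a # xs)" "last (snd a # xs) = x"
    using assms x branch_walk by metis
  obtain ys where ys: "nonbacktracking (fst b # snd b # ys)" "last (snd b # ys) = x"
    using assms x branch_walk by metis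
  have "nonbacktracking (rev xs @ [snd a, fst a])" using nonbacktracking_rev[OF xs(1)] by simp
  moreover have "nonbacktracking (snd a # fst a # (snd b # ys))"
    using assms ys by (auto simp: oriented_iff insert_commute prod_eq_iff)
  ultimately have "nonbacktracking (rev xs @ snd a # fst a # (snd b # ys))"
    using nonbacktracking_join by blast
  then have "distinct (rev (snd a # xs) @ fst a # (snd b # ys))" using nonbacktracking_distinct by force
  moreover have "x \<in> set (rev (snd a # xs))" using xs(2) by (metis last_in_set list.distinct(1) set_rev)
  moreover have "x \<in> set (snd b # ys)" using ys(2) by (metis last_in_set list.distinct(1))
  ultimately show False by auto
qed

lemma branch_vertices_unfold:
  "a \<in> oriented E \<Longrightarrow> branch_vertices a = insert (snd a) (\<Union>c\<in>children a. branch_vertices c)"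
  unfolding branch_vertices_def by (subst descendants_unfold) auto

text \<open>Deleting an edge separates its two sides. The side of \<open>prod.swap a\<close>
  consists of \<open>fst a\<close> and of branches that start, like \<open>a\<close>, at
  \<open>fst a\<close>.\<close>

lemma branch_swap_disjoint:
  assumes "a \<in> oriented E" shows "branch_vertices a \<inter> branch_vertices (prod.swap a) = {}"
proof -
  have "branch_vertices a \<inter> branch_vertices c = {}" if "c \<in> children (prod.swap a)" for c
    by (rule branch_disjoint) (use assms childrenD[OF that] in auto)
  moreover have "fst a \<notin> branch_vertices a" using assms branch_root by blast
  ultimately show ?thesis
    by (subst (2) branch_vertices_unfold) (use assms in \<open>auto simp: oriented_swap\<close>)
qed

lemma branch_edge_fst:
  assumes "a \<in> oriented E" "b \<in> descendants E a" shows "fst b \<in> insert (fst a) (branch_vertices a)"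
proof -
  have "(a, b) \<in> child_rel\<^sup>*" using assms by (simp add: descendants_eq)
  then show ?thesis
  proof cases
    case base then show ?thesis by simp
  next
    case (step y)
    then have "y \<in> descendants E a" "fst b = snd y" using assms by (auto simp: descendants_eq child_rel_def children_iff)
    then show ?thesis by (auto simp: branch_vertices_def)
  qed
qed

text \<open>Both ends of an edge of a branch are branch vertices or the root, so the head of a
  common edge would lie in both branches.\<close>

lemma branch_edges_disjoint:
  assumes "a \<in> oriented E" "b \<in> oriented E" "fst a = fst b" "a \<noteq> b"
  shows "branch_edges a \<inter> branch_edges b = {}"
proof (rule ccontr)
  assume "\<not> ?thesis"
  then obtain x y where x: "x \<in> descendants E a" "y \<in> descendants E b" "edge x = edge y"
    by (auto simp: branch_edges_iff)
  have "snd x \<in> branch_vertices a" using x by (auto simp: branch_vertices_def)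
  moreover have "edge y \<subseteq> insert (fst b) (branch_vertices b)"
    using x branch_edge_fst[of b y] assms by (auto simp: branch_vertices_def)
  moreover have "snd x \<in> edge y" using x(3) by blast
  ultimately show False using branch_disjoint[OF assms] branch_root[OF assms(1)] assms(3) by auto
qed

text \<open>Makes recursion along children well-founded inside a finite subtree. A descendant of a
  child \<open>c\<close> never ends in \<open>fst c\<close>, where the parent ends.\<close>

lemma child_rel_acyclic: "acyclic child_rel"
proof (rule acyclicI, intro allI notI)
  fix a assume "(a, a) \<in> child_rel\<^sup>+"
  then obtain c where c: "(a, c) \<in> child_rel" "(c, a) \<in> child_rel\<^sup>*" by (meson tranclD)
  then have o: "a \<in> oriented E" "c \<in> children a" "c \<in> oriented E" by (auto simp: child_rel_def dest: childrenD)
  then have "a \<in> descendants E c" using c by (simp add: descendants_eq)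
  then have "snd a \<in> branch_vertices c" by (auto simp: branch_vertices_def)
  then show False using branch_root[OF o(3)] childrenD(2)[OF o(2)] by auto
qed

section \<open>Finite subtrees\<close>

lemma reachable_sym: "(v, w) \<in> (oriented D)\<^sup>* \<Longrightarrow> (w, v) \<in> (oriented D)\<^sup>*"
  for D :: "'v set set"
proof -
  have "sym (oriented D)" by (auto simp: sym_def oriented_def insert_commute)
  then have "sym ((oriented D)\<^sup>*)" by (rule sym_rtrancl)
  then show "(v, w) \<in> (oriented D)\<^sup>* \<Longrightarrow> (w, v) \<in> (oriented D)\<^sup>*" by (rule symD)
qed

text \<open>Cycles of a subgraph are cycles of the tree, so only connectedness is left to
  check.\<close>

lemma finite_subtree_iff:
  "finite_subtree T E S \<longleftrightarrow> S \<subseteq> T \<and> finite S \<and> S \<noteq> {} \<and>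
     (\<forall>v\<in>S. \<forall>w\<in>S. (v, w) \<in> (oriented (induced_edges E S))\<^sup>*)"
proof -
  have "simple_graph S (induced_edges E S)"
    unfolding simple_graph_def
  proof
    fix e assume e: "e \<in> induced_edges E S"
    then obtain a where "a \<in> oriented E" "e = edge a" unfolding induced_edges_def using edge_cases by blast
    then show "\<exists>v w. v \<in> S \<and> w \<in> S \<and> v \<noteq> w \<and> e = {v, w}"
      using e edgeD(3)[of "fst a" "snd a"] by (auto simp: induced_edges_def oriented_iff)
  qed
  moreover have "cycle (induced_edges E S) vs \<Longrightarrow> cycle E vs" for vs
    by (auto simp: cycle_def induced_edges_def)
  ultimately show ?thesis using tree by (auto simp: finite_subtree_def is_tree_def)
qed

lemma finite_subtree_singleton: "v \<in> T \<Longrightarrow> finite_subtree T E {v}"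
  by (auto simp: finite_subtree_iff)

lemma induced_edges_singleton [simp]: "induced_edges E {v} = {}"
proof -
  have False if e: "e \<in> E" "e \<subseteq> {v}" for e
  proof -
    obtain a where a: "a \<in> oriented E" "e = edge a" using e(1) by (rule edge_cases)
    then have "edge a \<in> E" "fst a = v" "snd a = v" using e by (auto simp: oriented_iff)
    then show False by simp
  qed
  then show ?thesis by (auto simp: induced_edges_def)
qed

lemma boundary_iff: "a \<in> boundary T E S \<longleftrightarrow> a \<in> oriented E \<and> fst a \<in> S \<and> snd a \<notin> S"
  by (cases a) (auto simp: boundary_def oriented_iff dest: edgeD)

lemma boundary_singleton: "boundary T E {v} = {a \<in> oriented E. fst a = v}"
  by (auto simp: boundary_iff oriented_iff)

text \<open>The last clause keeps the walk inside the subgraph \<open>D\<close>, which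
  \<open>boundary_unique\<close> needs to know that the walk avoids an outer vertex.\<close>

lemma walk_exists:
  assumes "(v, w) \<in> (oriented D)\<^sup>*" "D \<subseteq> E"
  shows "\<exists>xs. nonbacktracking (xs @ [w]) \<and> hd (xs @ [w]) = v \<and> set xs \<subseteq> insert v (\<Union>D)"
  using assms(1)
proof induction
  case base then show ?case by (intro exI[of _ "[]"]) auto
next
  case (step y z)
  then obtain xs where xs: "nonbacktracking (xs @ [y])" "hd (xs @ [y]) = v" "set xs \<subseteq> insert v (\<Union>D)" by auto
  have yz: "{y, z} \<in> D" "{y, z} \<in> E" using step assms by (auto simp: oriented_def)
  show ?case
  proof (cases xs rule: rev_cases)
    case Nil
    then show ?thesis using xs yz by (intro exI[of _ "[y]"]) auto
  next
    case (snoc ys x)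
    show ?thesis
    proof (cases "x = z")
      \<comment> \<open>The path returns to the vertex before the last one, so the walk is shortened
        instead of extended.\<close>
      case True
      then show ?thesis using snoc xs nonbacktracking_prefix[of "ys @ [x]" "[y]"]
        by (intro exI[of _ ys]) (auto simp: hd_append split: if_splits)
    next
      case False
      then have "nonbacktracking [x, y, z]"
        using yz snoc xs(1) nonbacktracking_suffix[of ys "[x, y]"] by auto
      then have "nonbacktracking (ys @ x # y # [z])"
        using xs(1) snoc nonbacktracking_join[of ys x y "[z]"] by auto
      then show ?thesis using snoc xs yz by (intro exI[of _ "ys @ [x, y]"]) (auto simp: hd_append)
    qed
  qed
qed

text \<open>An outer vertex with two neighbours in \<open>S\<close> could be joined to both ends of
  a walk inside \<open>S\<close>; the resulting nonbacktracking walk would visit it twice.\<close>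

lemma boundary_unique:
  assumes S: "finite_subtree T E S" and a: "a \<in> boundary T E S" and b: "b \<in> boundary T E S"
    and eq: "snd a = snd b"
  shows "a = b"
proof (rule ccontr)
  assume "a \<noteq> b"
  then have ne: "fst a \<noteq> fst b" using eq by (auto simp: prod_eq_iff)
  have "(fst a, fst b) \<in> (oriented (induced_edges E S))\<^sup>*"
    using S a b by (auto simp: finite_subtree_iff boundary_iff)
  then obtain xs where xs: "nonbacktracking (xs @ [fst b])" "hd (xs @ [fst b]) = fst a"
      "set xs \<subseteq> insert (fst a) (\<Union>(induced_edges E S))"
    using walk_exists[of "fst a" "fst b" "induced_edges E S"] unfolding induced_edges_def by blast
  then have S': "set xs \<subseteq> S" using a by (auto simp: induced_edges_def boundary_iff)
  from ne xs(2) obtain ys where ys: "xs = fst a # ys" by (cases xs) auto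
  have w: "snd a \<notin> S" "edge a \<in> E" "edge b \<in> E" "fst b \<in> S" using a b by (auto simp: boundary_iff oriented_iff)
  have 1: "nonbacktracking (snd a # xs @ [fst b])"
  proof (cases ys)
    case Nil then show ?thesis using xs(1) w eq ys by (auto simp: insert_commute)
  next
    case (Cons y zs)
    then have "y \<noteq> snd a" using S' ys w by auto
    then show ?thesis using xs(1) w eq ys Cons by (auto simp: insert_commute)
  qed
  obtain zs z where zs: "xs = zs @ [z]" using ys by (metis rev_exhaust list.distinct(1))
  then have "{z, fst b} \<in> E" using xs(1) nonbacktracking_suffix[of zs "[z, fst b]"] by auto
  moreover have "z \<noteq> snd a" using zs S' w by auto
  ultimately have "nonbacktracking [z, fst b, snd a]" using w eq by auto
  moreover have "nonbacktracking ((snd a # zs) @ [z, fst b])" using 1 zs by simp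
  ultimately have "nonbacktracking ((snd a # zs) @ z # fst b # [snd a])"
    using nonbacktracking_join by blast
  then have "distinct ((snd a # zs) @ z # fst b # [snd a])" by (rule nonbacktracking_distinct)
  then show False by simp
qed

text \<open>The step of every induction over subtrees. By \<open>boundary_unique\<close> the new
  vertex brings a single inner edge, and \<open>a\<close> is exchanged for its children in the
  boundary.\<close>

lemma subtree_insert:
  assumes S: "finite_subtree T E S" and a: "a \<in> boundary T E S"
  defines "S' \<equiv> insert (snd a) S"
  shows "finite_subtree T E S'"
    and "induced_edges E S' = insert (edge a) (induced_edges E S)"
    and "edge a \<notin> induced_edges E S"
    and "boundary T E S' = boundary T E S - {a} \<union> children a"
    and "children a \<inter> boundary T E S = {}"
proof -
  have a': "a \<in> oriented E" "fst a \<in> S" "snd a \<notin> S" "edge a \<in> E" using a by (auto simp: boundary_iff oriented_iff)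
  show e: "edge a \<notin> induced_edges E S" using a' by (auto simp: induced_edges_def)
  have uniq: "b = a" if "b \<in> oriented E" "fst b \<in> S" "snd b = snd a" for b
    using boundary_unique[OF S _ a] that a' by (auto simp: boundary_iff)
  show I: "induced_edges E S' = insert (edge a) (induced_edges E S)"
  proof (intro equalityI subsetI)
    fix f assume f: "f \<in> induced_edges E S'"
    then have "f \<in> E" by (simp add: induced_edges_def)
    then obtain b where b: "b \<in> oriented E" "f = edge b" by (rule edge_cases)
    then have "edge b \<in> E" by (simp add: oriented_iff)
    then have ne: "fst b \<noteq> snd b" using edgeD by blast
    show "f \<in> insert (edge a) (induced_edges E S)"
    proof (cases "snd a \<in> f")
      case False then show ?thesis using f by (auto simp: induced_edges_def S'_def)
    next
      case True
      have "f \<subseteq> insert (snd a) S" using f by (simp add: induced_edges_def S'_def)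
      then have "fst b \<in> insert (snd a) S" "snd b \<in> insert (snd a) S" unfolding b(2) by simp_all
      moreover have "snd a = fst b \<or> snd a = snd b" using True unfolding b(2) by simp
      ultimately consider "snd b = snd a" "fst b \<in> S" | "fst b = snd a" "snd b \<in> S"
        using ne by (metis insert_iff)
      then show ?thesis
      proof cases
        case 1
        then have "b = a" using uniq b(1) by blast
        then show ?thesis using b(2) by simp
      next
        case 2
        then have "prod.swap b = a" using uniq[of "prod.swap b"] b oriented_swap by simp
        then have "a = prod.swap b" by simp
        then show ?thesis using b(2) by (simp add: insert_commute)
      qed
    qed
  qed (use a' in \<open>auto simp: induced_edges_def S'_def\<close>)
  have SS: "(v, w) \<in> (oriented (induced_edges E S'))\<^sup>*" if "v \<in> S" "w \<in> S" for v w
  proof -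
    have "(v, w) \<in> (oriented (induced_edges E S))\<^sup>*" using S that by (auto simp: finite_subtree_iff)
    moreover have "oriented (induced_edges E S) \<subseteq> oriented (induced_edges E S')"
      by (auto simp: I oriented_def)
    ultimately show ?thesis using rtrancl_mono by blast
  qed
  have "(fst a, snd a) \<in> oriented (induced_edges E S')" by (simp add: I oriented_def split: prod.split)
  then have *: "(v, snd a) \<in> (oriented (induced_edges E S'))\<^sup>*" if "v \<in> S" for v
    using SS[OF that a'(2)] by (simp add: rtrancl.rtrancl_into_rtrancl)
  show "finite_subtree T E S'"
    unfolding finite_subtree_iff
  proof (intro conjI ballI)
    show "S' \<subseteq> T" "finite S'" "S' \<noteq> {}"
      using S a' edgeD(2)[OF a'(4)] by (auto simp: finite_subtree_iff S'_def)
    fix v w assume "v \<in> S'" "w \<in> S'"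
    then show "(v, w) \<in> (oriented (induced_edges E S'))\<^sup>*"
      using *[of v] reachable_sym[OF *[of w]] SS[of v w] unfolding S'_def by auto
  qed
  show "boundary T E S' = boundary T E S - {a} \<union> children a"
  proof (intro equalityI subsetI)
    fix b assume b: "b \<in> boundary T E S'"
    show "b \<in> boundary T E S - {a} \<union> children a"
    proof (cases "fst b = snd a")
      case True then show ?thesis using b a' by (auto simp: boundary_iff S'_def children_iff)
    next
      case False then show ?thesis using b a' by (auto simp: boundary_iff S'_def)
    qed
  next
    fix b assume "b \<in> boundary T E S - {a} \<union> children a"
    then consider "b \<in> boundary T E S" "b \<noteq> a" | "b \<in> children a" by auto
    then show "b \<in> boundary T E S'"
    proof cases
      case 1 then show ?thesis using uniq[of b] by (auto simp: boundary_iff S'_def)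
    next
      case 2
      note c = childrenD[OF 2]
      have "snd b \<noteq> snd a" using c edgeD(3) by metis
      moreover have "snd b \<notin> S"
      proof
        assume "snd b \<in> S"
        then have "prod.swap b = a" using uniq[of "prod.swap b"] c oriented_swap by auto
        then show False using c by auto
      qed
      ultimately show ?thesis using c by (auto simp: boundary_iff S'_def)
    qed
  qed
  show "children a \<inter> boundary T E S = {}" using a' by (auto simp: boundary_iff children_iff)
qed

lemma boundary_step:
  assumes "finite_subtree T E S" "finite_subtree T E S'" "S \<subset> S'"
  obtains a where "a \<in> boundary T E S" "snd a \<in> S'"
proof -
  obtain v w where v: "v \<in> S" and w: "w \<in> S'" "w \<notin> S" using assms by (auto simp: finite_subtree_iff)
  then have "(v, w) \<in> (oriented (induced_edges E S'))\<^sup>*" using assms by (auto simp: finite_subtree_iff)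
  then have "w \<notin> S \<Longrightarrow> \<exists>a. a \<in> boundary T E S \<and> snd a \<in> S'"
  proof induction
    case (step y z)
    then have "(y, z) \<in> oriented E" "z \<in> S'" by (auto simp: oriented_def induced_edges_def)
    then show ?case using step by (cases "y \<in> S") (auto simp: boundary_iff)
  qed (use v in auto)
  then show ?thesis using that w by auto
qed

text \<open>The intermediate subtrees all stay inside \<open>S'\<close>, so \<open>P\<close> may
  refer to the fixed larger subtree.\<close>

lemma subtree_grow [consumes 3, case_names base step]:
  assumes "finite_subtree T E S" "finite_subtree T E S'" "S \<subseteq> S'" and "P S"
    and "\<And>R a. finite_subtree T E R \<Longrightarrow> a \<in> boundary T E R \<Longrightarrow> R \<subseteq> S' \<Longrightarrow> snd a \<in> S' \<Longrightarrow> P R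
          \<Longrightarrow> P (insert (snd a) R)"
  shows "P S'"
  using assms(1,3,4)
proof (induction "card (S' - S)" arbitrary: S rule: less_induct)
  case less
  show ?case
  proof (cases "S = S'")
    case False
    then obtain a where a: "a \<in> boundary T E S" "snd a \<in> S'"
      using boundary_step[of S S'] less.prems(1,2) assms(2) by (metis psubsetI)
    have "snd a \<in> S' - S" using a by (auto simp: boundary_iff)
    then have "card (S' - insert (snd a) S) < card (S' - S)"
      using assms(2) by (intro psubset_card_mono) (auto simp: finite_subtree_iff)
    then show ?thesis
      by (rule less.hyps) (use less.prems a subtree_insert(1) assms(5) in auto)
  qed (use less.prems in auto)
qed

lemma subtree_induct [consumes 1, case_names singleton insert]:
  assumes "finite_subtree T E S" and "\<And>v. v \<in> T \<Longrightarrow> P {v}"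
    and "\<And>R a. finite_subtree T E R \<Longrightarrow> a \<in> boundary T E R \<Longrightarrow> P R \<Longrightarrow> P (insert (snd a) R)"
  shows "P S"
proof -
  obtain v where v: "v \<in> S" "v \<in> T" using assms(1) unfolding finite_subtree_iff by blast
  show ?thesis
    by (rule subtree_grow[OF finite_subtree_singleton[OF v(2)] assms(1)]) (use v assms(2,3) in auto)
qed

lemma subtree_cover_point:
  assumes "finite_subtree T E S" "x \<in> T" shows "\<exists>S'. finite_subtree T E S' \<and> S \<subseteq> S' \<and> x \<in> S'"
proof -
  obtain s where s: "s \<in> S" using assms by (auto simp: finite_subtree_iff)
  then have "(s, x) \<in> (oriented E)\<^sup>*" using tree assms by (auto simp: is_tree_def finite_subtree_iff)
  then show ?thesis
  proof induction
    case base then show ?case using assms s by auto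
  next
    case (step y z)
    then obtain S' where S': "finite_subtree T E S'" "S \<subseteq> S'" "y \<in> S'" by auto
    show ?case
    proof (cases "z \<in> S'")
      case False
      then have "(y, z) \<in> boundary T E S'" using S' step by (auto simp: boundary_iff)
      then show ?thesis using subtree_insert(1)[OF S'(1)] S' by (intro exI[of _ "insert z S'"]) auto
    qed (use S' in auto)
  qed
qed

lemma subtree_cover:
  assumes "finite_subtree T E S" "finite J" "J \<subseteq> T"
  shows "\<exists>S'. finite_subtree T E S' \<and> S \<subseteq> S' \<and> J \<subseteq> S'"
  using assms(2,3)
proof (induction J)
  case empty then show ?case using assms by auto
next
  case (insert x J)
  then obtain S' where 1: "finite_subtree T E S'" "S \<subseteq> S'" "J \<subseteq> S'" by auto
  obtain S'' where 2: "finite_subtree T E S''" "S' \<subseteq> S''" "x \<in> S''"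
    using subtree_cover_point[OF 1(1), of x] insert(4) by auto
  show ?case using 1 2 by (intro exI[of _ S'']) auto
qed

text \<open>The smallest subtree in which the recursion at \<open>a\<close> is visible: its only
  inner edge is that of \<open>a\<close>, and both children of \<open>a\<close> are boundary
  edges.\<close>

lemma subtree_edge:
  assumes "a \<in> oriented E"
  shows "finite_subtree T E (edge a)" "induced_edges E (edge a) = {edge a}"
    "boundary T E (edge a) = children a \<union> children (prod.swap a)"
proof -
  have e: "edge a \<in> E" using assms by (simp add: oriented_iff)
  note D = edgeD[OF e]
  have a: "a \<in> boundary T E {fst a}" using assms D by (auto simp: boundary_iff)
  note R = subtree_insert[OF finite_subtree_singleton[OF D(1)] a]
  have i: "insert (snd a) {fst a} = edge a" by auto
  show "finite_subtree T E (edge a)" using R(1) unfolding i .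
  show "induced_edges E (edge a) = {edge a}" using R(2) unfolding i by simp
  have "{b \<in> oriented E. fst b = fst a} - {a} = children (prod.swap a)"
    by (auto simp: children_iff prod_eq_iff)
  then show "boundary T E (edge a) = children a \<union> children (prod.swap a)"
    using R(4) unfolding i boundary_singleton by auto
qed

lemma finite_induced_edges: "finite S \<Longrightarrow> finite (induced_edges E S)"
  by (rule finite_subset[of _ "Pow S"]) (auto simp: induced_edges_def)

lemma induced_edge_iff: "edge a \<in> induced_edges E S \<longleftrightarrow> a \<in> oriented E \<and> fst a \<in> S \<and> snd a \<in> S"
  by (auto simp: induced_edges_def oriented_iff)

lemma oriented_induced_iff: "a \<in> oriented (induced_edges E S) \<longleftrightarrow> a \<in> oriented E \<and> fst a \<in> S \<and> snd a \<in> S"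
  by (cases a) (auto simp: oriented_def induced_edges_def)

lemma finite_boundary: "finite S \<Longrightarrow> finite (boundary T E S)"
proof -
  assume "finite S"
  then have "finite (\<Union>v\<in>S. Pair v ` {x. {v, x} \<in> E})" using finite_neighbours by auto
  moreover have "boundary T E S \<subseteq> (\<Union>v\<in>S. Pair v ` {x. {v, x} \<in> E})"
    by (auto simp: boundary_iff oriented_iff)
  ultimately show ?thesis by (rule finite_subset[rotated])
qed

lemma children_induced:
  "b \<in> oriented (induced_edges E S) \<Longrightarrow> children b \<subseteq> oriented (induced_edges E S) \<union> boundary T E S"
  using childrenD(1,2) unfolding oriented_induced_iff boundary_iff Un_iff subset_iff by metis

section \<open>Induction inside a finite subtree, and the branches around it\<close>

lemma wf_child_rel:
  assumes "finite S" shows "wf ((child_rel \<inter> UNIV \<times> oriented (induced_edges E S))\<inverse>)"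
proof -
  let ?r = "child_rel \<inter> UNIV \<times> oriented (induced_edges E S)"
  let ?D = "oriented (induced_edges E S)"
  have f: "finite ?D"
    by (rule finite_subset[of _ "S \<times> S"]) (use assms in \<open>auto simp: oriented_induced_iff\<close>)
  have W: "wf ((child_rel \<inter> ?D \<times> ?D)\<inverse>)"
  proof (rule finite_acyclic_wf_converse)
    show "finite (child_rel \<inter> ?D \<times> ?D)" using f by auto
    show "acyclic (child_rel \<inter> ?D \<times> ?D)" by (rule acyclic_subset[OF child_rel_acyclic]) auto
  qed
  show ?thesis
  proof (rule wfI_min)
    fix x and Q :: "('v \<times> 'v) set" assume x: "x \<in> Q"
    show "\<exists>z\<in>Q. \<forall>y. (y, z) \<in> ?r\<inverse> \<longrightarrow> y \<notin> Q"
    proof (cases "Q \<inter> ?D = {}")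
      case True then show ?thesis using x by auto
    next
      case False
      obtain z where "z \<in> Q \<inter> ?D" "\<And>y. (y, z) \<in> (child_rel \<inter> ?D \<times> ?D)\<inverse> \<Longrightarrow> y \<notin> Q \<inter> ?D"
        using wfE_min'[OF W False] by blast
      then show ?thesis by (intro bexI[of _ z]) auto
    qed
  qed
qed

text \<open>Induction from the boundary inwards. The hypothesis covers the children inside
  \<open>S\<close>; by \<open>children_induced\<close> the others are boundary edges, where values
  are given.\<close>

lemma induced_induct [consumes 2, case_names less]:
  assumes "finite S" "b \<in> oriented (induced_edges E S)"
    and "\<And>b. b \<in> oriented (induced_edges E S) \<Longrightarrow>
          (\<And>c. c \<in> children b \<Longrightarrow> c \<in> oriented (induced_edges E S) \<Longrightarrow> P c) \<Longrightarrow> P b"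
  shows "P b"
  using wf_child_rel[OF assms(1)] assms(2)
proof (induction b rule: wf_induct_rule)
  case (less b)
  show ?case
  proof (rule assms(3)[OF less.prems])
    fix c assume c: "c \<in> children b" "c \<in> oriented (induced_edges E S)"
    then have "(c, b) \<in> (child_rel \<inter> UNIV \<times> oriented (induced_edges E S))\<inverse>"
      using less.prems by (auto simp: child_rel_def oriented_induced_iff)
    then show "P c" using less.IH c by blast
  qed
qed

text \<open>The reversal of \<open>a\<close> and the child \<open>c\<close> start at the same
  vertex, so their branches share no edge.\<close>

lemma edge_not_in_child_branch:
  assumes "a \<in> oriented E" "c \<in> children a" shows "edge a \<notin> branch_edges c"
proof -
  have "branch_edges (prod.swap a) \<inter> branch_edges c = {}"
    by (rule branch_edges_disjoint) (use childrenD[OF assms(2)] assms in \<open>auto simp: oriented_swap\<close>)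
  moreover have "edge a \<in> branch_edges (prod.swap a)"
    using descendants_self[of "prod.swap a"] assms oriented_swap
    unfolding branch_edges_iff by (intro image_eqI[of _ _ "prod.swap a"]) auto
  ultimately show ?thesis by auto
qed

text \<open>The groups of edges in (iii) must be disjoint. When \<open>snd a\<close> is added, the
  branch of \<open>a\<close> breaks up into its first edge, now an inner one, and the branches of
  the children of \<open>a\<close>.\<close>

lemma branches_partition:
  assumes "finite_subtree T E S"
  shows "(\<forall>a\<in>boundary T E S. branch_edges a \<inter> induced_edges E S = {} \<and>
     (\<forall>b\<in>boundary T E S. a \<noteq> b \<longrightarrow> branch_edges a \<inter> branch_edges b = {}))"
  using assms
proof (induction S rule: subtree_induct)
  case (singleton v)
  then show ?case using branch_edges_disjoint by (auto simp: boundary_singleton)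
next
  case (insert R a)
  note N = subtree_insert[OF insert(1,2)]
  have a: "a \<in> oriented E" using insert(2) by (auto simp: boundary_iff)
  have sub: "branch_edges c \<subseteq> branch_edges a" if "c \<in> children a" for c
    unfolding branch_edges_iff by (rule image_mono) (use that descendants_unfold[OF a] in blast)
  have ea: "edge a \<in> branch_edges a" using descendants_self[OF a] by (auto simp: branch_edges_iff)
  note n = edge_not_in_child_branch[OF a]
  have cc: "branch_edges c \<inter> branch_edges d = {}" if "c \<in> children a" "d \<in> children a" "c \<noteq> d" for c d
    by (rule branch_edges_disjoint) (use childrenD[OF that(1)] childrenD[OF that(2)] that in auto)
  have A: "branch_edges b \<inter> induced_edges E (insert (snd a) R) = {}"
    if "b \<in> boundary T E (insert (snd a) R)" for b
  proof (cases "b \<in> children a")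
    case True then show ?thesis unfolding N(2) using insert(2,3) sub n by fastforce
  next
    case False
    then have "b \<in> boundary T E R" "b \<noteq> a" using that unfolding N(4) by auto
    then show ?thesis unfolding N(2) using insert(2,3) ea by fastforce
  qed
  have B: "branch_edges b \<inter> branch_edges c = {}"
    if bc: "b \<in> boundary T E (insert (snd a) R)" "c \<in> boundary T E (insert (snd a) R)" "b \<noteq> c" for b c
  proof -
    have R: "branch_edges x \<inter> branch_edges y = {}" if "x \<in> boundary T E R" "y \<in> boundary T E R" "x \<noteq> y" for x y
      using insert(3) that by blast
    consider "b \<in> children a" "c \<in> children a" | "b \<in> children a" "c \<in> boundary T E R" "c \<noteq> a"
      | "c \<in> children a" "b \<in> boundary T E R" "b \<noteq> a" | "b \<in> boundary T E R" "c \<in> boundary T E R"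
      using bc unfolding N(4) by blast
    then show ?thesis
    proof cases
      case 1 then show ?thesis using cc bc(3) by blast
    next
      case 2 then show ?thesis using sub[of b] R[of a c] insert(2) by blast
    next
      case 3 then show ?thesis using sub[of c] R[of b a] insert(2) by blast
    next
      case 4 then show ?thesis using R bc(3) by blast
    qed
  qed
  show ?case using A B by blast
qed

text \<open>Balls around a vertex are finite. Countability allows almost sure statements about
  single edges to be combined into one about all edges.\<close>

lemma countable_vertices: "countable T"
proof (cases "T = {}")
  case False
  then obtain r where r: "r \<in> T" by auto
  have "finite ((oriented E ^^ n) `` {r})" for n
  proof (induction n)
    case (Suc n)
    have "(oriented E ^^ Suc n) `` {r} \<subseteq> (\<Union>v\<in>(oriented E ^^ n) `` {r}. {x. {v, x} \<in> E})"
      by (auto simp: oriented_iff)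
    then show ?case by (rule finite_subset) (use Suc finite_neighbours in auto)
  qed auto
  then have "countable (\<Union>n. (oriented E ^^ n) `` {r})" by (intro countable_UN) (auto intro: countable_finite)
  moreover have "T \<subseteq> (\<Union>n. (oriented E ^^ n) `` {r})"
    using tree r unfolding is_tree_def by (auto simp: rtrancl_power) 
  ultimately show ?thesis by (rule countable_subset[rotated])
qed simp

lemma countable_oriented: "countable (oriented E)"
  by (rule countable_subset[of _ "T \<times> T"])
    (use countable_vertices edgeD in \<open>auto simp: oriented_def\<close>)

lemma countable_edges: "countable E"
proof (rule countable_subset)
  show "E \<subseteq> edge ` oriented E"
  proof
    fix e assume "e \<in> E"
    then obtain a where "a \<in> oriented E" "e = edge a" by (rule edge_cases)
    then show "e \<in> edge ` oriented E" by blast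
  qed
  show "countable (edge ` oriented E)" using countable_oriented by simp
qed

lemma subtree_exists: "\<exists>S. finite_subtree T E S"
proof -
  obtain v where "v \<in> T" using tree unfolding is_tree_def by blast
  then show ?thesis using finite_subtree_singleton by blast
qed

section \<open>Automorphisms\<close>

lemma orientedD: "a \<in> oriented E \<Longrightarrow> fst a \<in> T \<and> snd a \<in> T"
  using edgeD by (simp add: oriented_iff)

text \<open>Adjacency in a model of the cubic tree: a vertex is coded by a side of a distinguished
  edge and the word of turns that leads to it. The rule refers neither to the tree nor to the
  edge.\<close>

definition word_neighbours :: "bool \<times> bool list \<Rightarrow> (bool \<times> bool list) set" where
  "word_neighbours p =
     {if snd p = [] then (\<not> fst p, []) else (fst p, butlast (snd p)),
      (fst p, snd p @ [False]), (fst p, snd p @ [True])}"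

lemma neighbours_eq:
  assumes "b \<in> oriented E" shows "{snd b, x} \<in> E \<longleftrightarrow> x = fst b \<or> x \<in> snd ` children b"
proof
  assume "{snd b, x} \<in> E"
  then show "x = fst b \<or> x \<in> snd ` children b" by (force simp: children_def)
next
  assume "x = fst b \<or> x \<in> snd ` children b"
  then show "{snd b, x} \<in> E"
    using assms by (auto simp: children_def oriented_iff insert_commute)
qed

text \<open>Codes are unique because the two sides of \<open>a\<close>, and the branches of distinct
  children, are disjoint.\<close>

lemma coding_exists:
  assumes "a \<in> oriented E"
  obtains code :: "bool \<times> bool list \<Rightarrow> 'v" where "inj code" "range code = T"
    "\<And>p q. {code p, code q} \<in> E \<longleftrightarrow> q \<in> word_neighbours p"
    "code (True, []) = fst a" "code (False, []) = snd a"
proof -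
  have "\<forall>b\<in>oriented E. \<exists>g :: bool \<Rightarrow> 'v \<times> 'v. children b = {g False, g True} \<and> g False \<noteq> g True"
  proof
    fix b assume "b \<in> oriented E"
    then obtain c d where "children b = {c, d}" "c \<noteq> d" by (rule children_pair)
    then show "\<exists>g :: bool \<Rightarrow> 'v \<times> 'v. children b = {g False, g True} \<and> g False \<noteq> g True"
      by (intro exI[of _ "\<lambda>i. if i then d else c"]) auto
  qed
  then obtain f :: "'v \<times> 'v \<Rightarrow> bool \<Rightarrow> 'v \<times> 'v" where
    f: "\<And>b. b \<in> oriented E \<Longrightarrow> children b = {f b False, f b True}"
    and f': "\<And>b. b \<in> oriented E \<Longrightarrow> f b False \<noteq> f b True"
    by metis
  have fc: "f b i \<in> children b" if "b \<in> oriented E" for b i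
    using f[OF that] by (cases i) auto
  have fO: "f b i \<in> oriented E" "fst (f b i) = snd b" if "b \<in> oriented E" for b i
    using childrenD(1,2)[OF fc[OF that]] by auto
  have N1: "foldl f b l \<in> oriented E" if "b \<in> oriented E" for b l
    using that by (induction l arbitrary: b) (auto simp: fO)
  have N2: "foldl f b l \<in> descendants E b" if "b \<in> oriented E" for b l
    using that
  proof (induction l rule: rev_induct)
    case (snoc i l)
    then have "foldl f b l \<in> descendants E b" by simp
    then have "children (foldl f b l) \<subseteq> descendants E b" by (rule descendants_child[OF snoc.prems])
    then show ?case using fc[OF N1[OF snoc.prems], of l i] by auto
  qed (simp add: descendants_self)
  then have N2: "snd (foldl f b l) \<in> branch_vertices b" if "b \<in> oriented E" for b l
    using that by (auto simp: branch_vertices_def)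
  have ne: "snd b \<noteq> snd (foldl f (f b i) m)" if "b \<in> oriented E" for b i m
    using branch_root[OF fO(1)[OF that, of i]] N2[OF fO(1)[OF that, of i], of m] fO(2)[OF that, of i] by auto
  have inj1: "l = l'" if "b \<in> oriented E" "snd (foldl f b l) = snd (foldl f b l')" for b l l'
    using that
  proof (induction l arbitrary: b l')
    case Nil
    then show ?case using ne by (cases l') auto
  next
    case (Cons i l)
    show ?case
    proof (cases l')
      case Nil then show ?thesis using Cons ne by (metis foldl_Cons foldl_Nil)
    next
      case (Cons j m)
      have "i = j"
      proof (rule ccontr)
        assume "i \<noteq> j"
        then have "f b i \<noteq> f b j" using f'[OF Cons.prems(1)] by (cases i; cases j) auto
        then have "branch_vertices (f b i) \<inter> branch_vertices (f b j) = {}"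
          by (intro branch_disjoint) (use fO[OF Cons.prems(1)] in auto)
        then show False
          using N2[OF fO(1)[OF Cons.prems(1)], of i l] N2[OF fO(1)[OF Cons.prems(1)], of j m] Cons.prems(2) Cons
          by auto
      qed
      then show ?thesis using Cons.IH[OF fO(1)[OF Cons.prems(1), of i], of m] Cons.prems(2) Cons by auto
    qed
  qed
  \<comment> \<open>A vertex is coded as the head of an edge pointing away from \<open>a\<close>;
    thus the empty word on the side \<open>True\<close> must give the head of the reversed edge,
    \<open>fst a\<close>.\<close>
  define root where "root s = (if s then prod.swap a else a)" for s
  define e where "e p = foldl f (root (fst p)) (snd p)" for p :: "bool \<times> bool list"
  define code where "code p = snd (e p)" for p
  have r: "root s \<in> oriented E" for s using assms by (simp add: root_def oriented_swap)
  have eO: "e p \<in> oriented E" for p using N1 r by (simp add: e_def)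
  have V: "code p \<in> branch_vertices (root (fst p))" for p using N2 r by (simp add: code_def e_def)
  have "inj code"
  proof (rule injI)
    fix p q assume eq: "code p = code q"
    have "fst p = fst q"
      using V[of p] V[of q] eq branch_swap_disjoint[OF assms]
      by (cases "fst p"; cases "fst q") (auto simp: root_def)
    then show "p = q" using inj1[OF r, of "fst p" "snd p" "snd q"] eq by (auto simp: code_def e_def prod_eq_iff)
  qed
  have nb: "{code p, x} \<in> E \<longleftrightarrow> x \<in> code ` word_neighbours p" for p x
  proof -
    have 1: "fst (e p) = code (if snd p = [] then (\<not> fst p, []) else (fst p, butlast (snd p)))"
    proof (cases "snd p" rule: rev_cases)
      case Nil then show ?thesis by (cases "fst p") (auto simp: code_def e_def root_def)
    next
      case (snoc l i)
      have "fst (f (foldl f (root (fst p)) l) i) = snd (foldl f (root (fst p)) l)"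
        by (rule fO(2)[OF N1[OF r]])
      then show ?thesis using snoc by (simp add: code_def e_def)
    qed
    have 2: "children (e p) = {e (fst p, snd p @ [False]), e (fst p, snd p @ [True])}"
      using f[OF eO] by (simp add: e_def)
    show ?thesis unfolding code_def[of p] neighbours_eq[OF eO] word_neighbours_def 1 2
      by (simp add: code_def)
  qed
  have "code p \<in> T" for p
    using eO[of p] edgeD(2) unfolding oriented_iff code_def by blast
  \<comment> \<open>The range is closed under adjacency and the tree is connected.\<close>
  moreover have "x \<in> range code" if "x \<in> T" for x
  proof -
    have "code (False, []) \<in> T" by fact
    then have "(code (False, []), x) \<in> (oriented E)\<^sup>*" using that tree by (auto simp: is_tree_def)
    then show ?thesis
    proof induction
      case (step y z)
      then obtain p where "y = code p" by auto
      then show ?case using step nb[of p z] by (auto simp: oriented_def)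
    qed auto
  qed
  ultimately have "range code = T" by auto
  moreover have "{code p, code q} \<in> E \<longleftrightarrow> q \<in> word_neighbours p" for p q
    using nb \<open>inj code\<close> by (simp add: inj_image_mem_iff)
  moreover have "code (True, []) = fst a" "code (False, []) = snd a"
    by (auto simp: code_def e_def root_def)
  ultimately show ?thesis using that \<open>inj code\<close> by blast
qed

text \<open>Codings based at \<open>a\<close> and at \<open>b\<close> obey the same adjacency rule,
  so the inverse of the one followed by the other is an automorphism.\<close>

lemma automorphism_transitive:
  assumes "a \<in> oriented E" "b \<in> oriented E"
  obtains \<phi> where "\<phi> \<in> automorphisms T E" "map_prod \<phi> \<phi> a = b"
proof -
  obtain f where f: "inj f" "range f = T" "\<And>p q. {f p, f q} \<in> E \<longleftrightarrow> q \<in> word_neighbours p"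
    "f (True, []) = fst a" "f (False, []) = snd a" using coding_exists[OF assms(1)] by metis
  obtain g where g: "inj g" "range g = T" "\<And>p q. {g p, g q} \<in> E \<longleftrightarrow> q \<in> word_neighbours p"
    "g (True, []) = fst b" "g (False, []) = snd b" using coding_exists[OF assms(2)] by metis
  define \<phi> where "\<phi> = g \<circ> inv f"
  have \<phi>: "\<phi> (f p) = g p" for p using f(1) by (simp add: \<phi>_def)
  have "bij_betw (inv f) T UNIV" using bij_betw_inv_into[of f UNIV T] f by (simp add: bij_betw_def)
  moreover have "bij_betw g UNIV T" using g by (simp add: bij_betw_def)
  ultimately have "bij_betw \<phi> T T" unfolding \<phi>_def by (rule bij_betw_trans)
  moreover have "{\<phi> v, \<phi> w} \<in> E \<longleftrightarrow> {v, w} \<in> E" if vw: "v \<in> T" "w \<in> T" for v w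
  proof -
    obtain p q where "v = f p" "w = f q" using vw f(2) by blast
    then show ?thesis using f(3) g(3) \<phi> by simp
  qed
  ultimately have "\<phi> \<in> automorphisms T E" by (simp add: automorphisms_def)
  moreover have "map_prod \<phi> \<phi> a = b"
    using \<phi>[of "(True, [])"] \<phi>[of "(False, [])"] f(4,5) g(4,5) by (simp add: prod_eq_iff)
  ultimately show ?thesis using that by blast
qed

section \<open>Action of one automorphism on edges and finite subtrees\<close>

context
  fixes \<phi> assumes aut: "\<phi> \<in> automorphisms T E"
begin

lemma aut_inj: "inj_on \<phi> T" and aut_image: "\<phi> ` T = T"
  using aut by (auto simp: automorphisms_def bij_betw_def)

lemma aut_edge: "v \<in> T \<Longrightarrow> w \<in> T \<Longrightarrow> {\<phi> v, \<phi> w} \<in> E \<longleftrightarrow> {v, w} \<in> E"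
  using aut by (auto simp: automorphisms_def)

lemma aut_eq: "v \<in> T \<Longrightarrow> w \<in> T \<Longrightarrow> \<phi> v = \<phi> w \<longleftrightarrow> v = w"
  using aut_inj by (auto simp: inj_on_def)

abbreviation "aut_edges \<equiv> map_prod \<phi> \<phi>"

lemma aut_oriented: "a \<in> oriented E \<Longrightarrow> aut_edges a \<in> oriented E"
  using aut_edge orientedD by (auto simp: oriented_iff)

lemma aut_image_edge: "\<phi> ` edge a = edge (aut_edges a)"
  by (cases a) auto

lemma aut_E: assumes "e \<in> E" shows "\<phi> ` e \<in> E"
proof -
  obtain a where a: "a \<in> oriented E" "e = edge a" using assms by (rule edge_cases)
  show ?thesis using aut_oriented[OF a(1)] unfolding a(2) aut_image_edge oriented_iff .
qed

lemma aut_inj_edges: "inj_on ((`) \<phi>) E"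
proof (rule inj_onI)
  fix e f assume *: "e \<in> E" "f \<in> E" "\<phi> ` e = \<phi> ` f"
  have "e \<subseteq> T" if "e \<in> E" for e
    using that edge_cases[OF that] edgeD by (metis empty_subsetI insert_subset)
  then show "e = f" using * aut_inj by (metis inj_on_image_eq_iff)
qed

lemma aut_inj_oriented: "inj_on aut_edges (oriented E)"
  using aut_eq orientedD by (auto simp: inj_on_def)

lemma aut_oriented_surj: assumes "b \<in> oriented E" obtains a where "a \<in> oriented E" "aut_edges a = b"
proof -
  obtain v w where vw: "v \<in> T" "w \<in> T" "\<phi> v = fst b" "\<phi> w = snd b"
    using orientedD[OF assms] aut_image by (metis imageE)
  then have "(v, w) \<in> oriented E" using assms aut_edge[of v w] by (simp add: oriented_iff)
  with vw that[of "(v, w)"] show ?thesis by simp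
qed

lemma aut_children: assumes "a \<in> oriented E" shows "children (aut_edges a) = aut_edges ` children a"
proof (intro equalityI subsetI)
  fix c assume c: "c \<in> children (aut_edges a)"
  then obtain d where d: "d \<in> oriented E" "aut_edges d = c" using aut_oriented_surj childrenD(1) by metis
  have "d \<in> children a"
    using childrenD[OF c] d(2) aut_eq orientedD[OF d(1)] orientedD[OF assms] d(1)
    by (auto simp: children_iff)
  then show "c \<in> aut_edges ` children a" using d by auto
next
  fix c assume "c \<in> aut_edges ` children a"
  then obtain d where d: "d \<in> children a" "c = aut_edges d" by auto
  note D = childrenD[OF d(1)]
  show "c \<in> children (aut_edges a)"
    unfolding children_iff d(2)
    using D aut_oriented[OF D(1)] aut_eq orientedD[OF D(1)] orientedD[OF assms] by auto
qed

lemma aut_induced: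
  assumes "S \<subseteq> T" shows "induced_edges E (\<phi> ` S) = (`) \<phi> ` induced_edges E S"
    and "boundary T E (\<phi> ` S) = aut_edges ` boundary T E S"
proof -
  have in_S: "\<phi> v \<in> \<phi> ` S \<longleftrightarrow> v \<in> S" if "v \<in> T" for v
    using that assms aut_inj by (auto simp: inj_on_def)
  show "induced_edges E (\<phi> ` S) = (`) \<phi> ` induced_edges E S"
  proof (intro equalityI subsetI)
    fix e assume e: "e \<in> induced_edges E (\<phi> ` S)"
    then have "e \<in> E" by (simp add: induced_edges_def)
    then obtain b where b: "b \<in> oriented E" "e = edge b" by (rule edge_cases)
    then obtain a where a: "a \<in> oriented E" "aut_edges a = b" using aut_oriented_surj by metis
    have "edge b \<in> induced_edges E (\<phi> ` S)" using e b by simp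
    then have "edge a \<in> induced_edges E S"
      unfolding induced_edge_iff using a in_S orientedD[OF a(1)] by (metis fst_map_prod snd_map_prod)
    moreover have "e = \<phi> ` edge a" unfolding b(2) aut_image_edge a(2) ..
    ultimately show "e \<in> (`) \<phi> ` induced_edges E S" by blast
  next
    fix e assume "e \<in> (`) \<phi> ` induced_edges E S"
    then obtain f where "f \<in> E" "f \<subseteq> S" "e = \<phi> ` f" unfolding induced_edges_def by auto
    then show "e \<in> induced_edges E (\<phi> ` S)" unfolding induced_edges_def using aut_E[of f] by (simp add: image_mono)
  qed
  show "boundary T E (\<phi> ` S) = aut_edges ` boundary T E S"
  proof (intro equalityI subsetI)
    fix b assume b: "b \<in> boundary T E (\<phi> ` S)"
    then obtain a where a: "a \<in> oriented E" "aut_edges a = b" using aut_oriented_surj unfolding boundary_iff by metis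
    then have "a \<in> boundary T E S" using b in_S orientedD[OF a(1)] unfolding boundary_iff by (metis fst_map_prod snd_map_prod)
    then show "b \<in> aut_edges ` boundary T E S" using a(2) by (intro image_eqI[of b aut_edges a]) simp_all
  next
    fix b assume "b \<in> aut_edges ` boundary T E S"
    then obtain a where a: "a \<in> boundary T E S" "b = aut_edges a" by (rule imageE)
    then have "a \<in> oriented E" by (simp add: boundary_iff)
    then show "b \<in> boundary T E (\<phi> ` S)"
      using a in_S orientedD[of a] aut_oriented[of a] unfolding boundary_iff by (metis fst_map_prod snd_map_prod)
  qed
qed

lemma aut_subtree: assumes "finite_subtree T E S" shows "finite_subtree T E (\<phi> ` S)"
proof -
  have S: "S \<subseteq> T" "finite S" "S \<noteq> {}" using assms by (auto simp: finite_subtree_iff)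
  have "(\<phi> v, \<phi> w) \<in> (oriented (induced_edges E (\<phi> ` S)))\<^sup>*" if "v \<in> S" "w \<in> S" for v w
  proof -
    have "(v, w) \<in> (oriented (induced_edges E S))\<^sup>*" using assms that by (auto simp: finite_subtree_iff)
    then show ?thesis
    proof induction
      case (step y z)
      then have "{y, z} \<in> induced_edges E S" by (simp add: oriented_def)
      then have "\<phi> ` {y, z} \<in> induced_edges E (\<phi> ` S)" unfolding aut_induced(1)[OF S(1)] by (rule imageI)
      then have "(\<phi> y, \<phi> z) \<in> oriented (induced_edges E (\<phi> ` S))" by (simp add: oriented_def)
      then show ?case using step by (meson rtrancl.rtrancl_into_rtrancl)
    qed simp
  qed
  moreover have "\<phi> ` S \<subseteq> T" using S(1) aut_image by auto
  ultimately show ?thesis using S unfolding finite_subtree_iff by auto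
qed

end

end

section \<open>The law of a percolation time\<close>

text \<open>For \<open>s > 0\<close> the quotient \<open>survival s t n / s\<close> is the
  probability that a branching process with two offspring with probability \<open>t * s\<close>, and
  none otherwise, is alive in generation \<open>n\<close>.\<close>

primrec survival :: "real \<Rightarrow> real \<Rightarrow> nat \<Rightarrow> real" where
  "survival s t 0 = s"
| "survival s t (Suc n) = t * (s\<^sup>2 - (s - survival s t n)\<^sup>2)"

lemma survival_bounds:
  assumes "0 \<le> s" "s \<le> 1" "0 \<le> t" "t \<le> 1" shows "0 \<le> survival s t n \<and> survival s t n \<le> s"
proof (induction n)
  case (Suc n)
  have "(s - survival s t n)\<^sup>2 \<le> s\<^sup>2" using Suc by (intro power_mono) auto
  moreover have "t * (s\<^sup>2 - (s - survival s t n)\<^sup>2) \<le> 1 * s\<^sup>2"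
    using assms calculation by (intro mult_mono) auto
  moreover have "s\<^sup>2 \<le> s" using assms by (simp add: power2_eq_square mult_left_le)
  ultimately show ?case using assms by auto
qed (use assms in simp)

text \<open>The bound \<open>2 * s - 1 / t\<close> is a fixed point of the recursion, which is
  monotone below \<open>s\<close>; the iteration starts above it.\<close>

lemma survival_supercritical:
  assumes "0 \<le> s" "s \<le> 1" "0 < t" "t \<le> 1" shows "2 * s - 1 / t \<le> survival s t n"
proof (induction n)
  case 0
  have "s \<le> 1 / t" using assms by (simp add: field_simps mult_le_one)
  then show ?case by simp
next
  case (Suc n)
  let ?p = "survival s t n" and ?q = "2 * s - 1 / t"
  have "(s - ?p)\<^sup>2 \<le> (s - ?q)\<^sup>2" using Suc survival_bounds[of s t n] assms by (intro power_mono) auto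
  then have "t * (s\<^sup>2 - (s - ?q)\<^sup>2) \<le> t * (s\<^sup>2 - (s - ?p)\<^sup>2)" using assms by (intro mult_left_mono) auto
  moreover have "t * (s\<^sup>2 - (s - ?q)\<^sup>2) = ?q" using assms by (simp add: power2_eq_square field_simps)
  ultimately show ?case by simp
qed

text \<open>The sequence decreases, and its limit \<open>L\<close> satisfies
  \<open>t * L^2 = (2 * t * s - 1) * L\<close>, which is at most 0. This includes the critical case,
  where there is no geometric decay.\<close>

lemma survival_subcritical:
  assumes "0 \<le> s" "s \<le> 1" "0 \<le> t" "t \<le> 1" "2 * t * s \<le> 1" shows "survival s t \<longlonglongrightarrow> 0"
proof -
  let ?p = "survival s t"
  note b = survival_bounds[OF assms(1-4)]
  have eq: "?p (Suc n) = 2 * t * s * ?p n - t * (?p n)\<^sup>2" for n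
    by (simp add: power2_eq_square algebra_simps)
  have dec: "?p (Suc n) \<le> ?p n" for n
  proof -
    have "2 * t * s * ?p n \<le> 1 * ?p n" using b assms by (intro mult_right_mono) auto
    moreover have "0 \<le> t * (?p n)\<^sup>2" using assms by simp
    ultimately show ?thesis unfolding eq by simp
  qed
  then have "decseq ?p" by (rule decseq_SucI)
  then obtain L where L: "?p \<longlonglongrightarrow> L" "\<And>n. L \<le> ?p n"
    by (rule decseq_convergent[where B = 0]) (use b in auto)
  have L0: "0 \<le> L" using L(1) b by (intro LIMSEQ_le_const) auto
  have "(\<lambda>n. ?p (Suc n)) \<longlonglongrightarrow> 2 * t * s * L - t * L\<^sup>2"
    unfolding eq by (intro tendsto_intros L)
  moreover have "(\<lambda>n. ?p (Suc n)) \<longlonglongrightarrow> L" using L(1) by (rule LIMSEQ_Suc)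
  ultimately have Leq: "L = 2 * t * s * L - t * L\<^sup>2" using LIMSEQ_unique by blast
  have "2 * t * s * L \<le> 1 * L" using L0 assms by (intro mult_right_mono) auto
  then have "t * L\<^sup>2 = 0" using Leq assms by (smt (verit) mult_nonneg_nonneg zero_le_power2)
  \<comment> \<open>For \<open>t = 0\<close> the fixed point equation itself reads
    \<open>L = 0\<close>.\<close>
  then have "t = 0 \<or> L = 0" by simp
  then have "L = 0" using Leq by auto
  with L show ?thesis by simp
qed

text \<open>The derivative vanishes. This replaces an integral when \<open>tail\<close> is shown to
  be a fixed point of the recursion.\<close>

lemma quadratic_modulus_constant:
  fixes f :: "real \<Rightarrow> real"
  assumes "a \<le> b" "\<And>x y. a \<le> x \<Longrightarrow> x \<le> y \<Longrightarrow> y \<le> b \<Longrightarrow> \<bar>f y - f x\<bar> \<le> C * (y - x)\<^sup>2"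
  shows "f b = f a"
proof -
  have sym: "\<bar>f y - f x\<bar> \<le> C * (y - x)\<^sup>2" if "x \<in> {a..b}" "y \<in> {a..b}" for x y
  proof (cases "x \<le> y")
    case True then show ?thesis using assms(2) that by auto
  next
    case False then show ?thesis using assms(2)[of y x] that by (simp add: abs_minus_commute power2_commute)
  qed
  have "(f has_field_derivative 0) (at x within {a..b})" if x: "x \<in> {a..b}" for x
    unfolding has_field_derivative_iff
  proof (rule Lim_null_comparison)
    show "\<forall>\<^sub>F y in at x within {a..b}. norm ((f y - f x) / (y - x)) \<le> C * \<bar>y - x\<bar>"
      unfolding eventually_at
    proof (intro exI[of _ 1] conjI ballI impI)
      fix y assume "y \<in> {a..b}" "y \<noteq> x \<and> dist y x < 1"
      then show "norm ((f y - f x) / (y - x)) \<le> C * \<bar>y - x\<bar>"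
        using sym[OF x, of y] by (simp add: abs_divide divide_le_eq power2_eq_square mult.assoc flip: abs_mult)
    qed simp
    have "((\<lambda>y. C * \<bar>y - x\<bar>) \<longlongrightarrow> C * \<bar>x - x\<bar>) (at x within {a..b})" by (intro tendsto_intros)
    then show "((\<lambda>y. C * \<bar>y - x\<bar>) \<longlongrightarrow> 0) (at x within {a..b})" by simp
  qed
  then have "\<exists>c. \<forall>x\<in>{a..b}. f x = c" by (intro has_field_derivative_zero_constant) auto
  then show ?thesis using assms(1) by auto
qed

text \<open>Defined by cases because division by zero gives 0, so that the formula with a minimum
  would be wrong at \<open>t = 0\<close>.\<close>

definition tail :: "real \<Rightarrow> real" where
  "tail t = (if t \<le> 1 / 2 then 1 else 1 / (2 * t))"

text \<open>The bound \<open>1 / (2 * t)\<close> expresses that a branching process with two children with probability \<open>t * S t\<close>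
  is not supercritical. It rules out the other solutions of the recursive distributional equation.\<close>

lemma tail_unique:
  fixes S :: "real \<Rightarrow> real"
  assumes mono: "\<And>s t. 0 \<le> s \<Longrightarrow> s \<le> t \<Longrightarrow> t \<le> 1 \<Longrightarrow> S t \<le> S s"
    and cont: "\<And>t. 0 \<le> t \<Longrightarrow> t < 1 \<Longrightarrow> continuous (at_right t) S"
    and S0: "S 0 = 1" and crit: "\<And>t. 0 \<le> t \<Longrightarrow> t \<le> 1 \<Longrightarrow> 2 * t * S t \<le> 1"
    and window: "\<And>s t. 0 \<le> s \<Longrightarrow> s \<le> t \<Longrightarrow> t \<le> 1 \<Longrightarrow> S s - S t \<le> t * ((S s)\<^sup>2 - (S t)\<^sup>2)"
    and t: "0 \<le> t" "t \<le> 1"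
  shows "S t = tail t"
proof (cases "t = 0")
  case True then show ?thesis using S0 by (simp add: tail_def)
next
  case False
  with t have t0: "0 < t" by simp
  have "S t \<le> 1" using mono[of 0 t] t S0 by simp
  moreover have "S t \<le> 1 / (2 * t)" using crit[OF t] t0 by (simp add: field_simps)
  moreover have False if lt: "S t < 1" "S t < 1 / (2 * t)"
  proof -
    \<comment> \<open>\<open>S\<close> reaches its value at \<open>t\<close> at the point
      \<open>r = Sup A\<close>; right continuity gives \<open>S r = S t\<close> even if
      \<open>S\<close> jumps there.\<close>
    define A where "A = {s \<in> {0..t}. S s > S t}"
    have A0: "0 \<in> A" using lt t S0 by (simp add: A_def)
    have bdd: "bdd_above A" by (rule bdd_aboveI[of _ t]) (simp add: A_def)
    define r where "r = Sup A"
    have r: "0 \<le> r" "r \<le> t"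
      using A0 bdd by (auto simp: r_def A_def intro: cSup_upper cSup_least)
    have Sr: "S r = S t"
    proof (cases "r = t")
      case False
      then have "r < t" using r by simp
      have "S s = S t" if "r < s" "s < t" for s
      proof -
        have "s \<notin> A" using that bdd cSup_upper[of s A] unfolding r_def by auto
        then show ?thesis using that r mono[of s t] t by (auto simp: A_def)
      qed
      then have "\<forall>\<^sub>F s in at_right r. S s = S t"
        unfolding eventually_at_right_field using \<open>r < t\<close> by blast
      then have "(S \<longlongrightarrow> S t) (at_right r)" by (simp add: tendsto_eventually)
      moreover have "(S \<longlongrightarrow> S r) (at_right r)"
        using cont[of r] r \<open>r < t\<close> t by (simp add: continuous_within)
      ultimately show ?thesis using tendsto_unique trivial_limit_at_right_real by metis
    qed simp
    have "r \<noteq> 0" using Sr S0 lt by auto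
    then have r0: "0 < r" using r by simp
    \<comment> \<open>For \<open>s\<close> in \<open>A\<close>, \<open>window\<close> gives
      \<open>1 <= r * (S s + S r)\<close>, that is \<open>c <= S s\<close>. As \<open>c\<close>
      exceeds \<open>1 / (2 * r)\<close>, this violates \<open>crit\<close> once \<open>s\<close> is
      close to \<open>r\<close>.\<close>
    define c where "c = 1 / r - S t"
    have "1 / (2 * t) \<le> 1 / (2 * r)" using r r0 by (intro divide_left_mono) auto
    then have c: "1 / (2 * r) < c" using lt by (simp add: c_def)
    then have c0: "0 < c" using r0 by (smt (verit) divide_pos_pos)
    have "1 / (2 * c) < r" using c c0 r0 by (simp add: field_simps)
    then obtain s where s: "s \<in> A" "1 / (2 * c) < s"
      using A0 bdd less_cSup_iff[of A "1 / (2 * c)"] unfolding r_def by auto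
    have sr: "s \<le> r" using s bdd by (auto simp: r_def intro: cSup_upper)
    have s0: "0 < s" using s c0 by (smt (verit) divide_pos_pos)
    have Ss: "S s > S r" using s Sr by (simp add: A_def)
    have "S s - S r \<le> r * ((S s)\<^sup>2 - (S r)\<^sup>2)" using window[of s r] s0 sr r t by simp
    also have "\<dots> = (S s - S r) * (r * (S s + S r))" by (simp add: power2_eq_square algebra_simps)
    finally have "1 \<le> r * (S s + S r)" using Ss by (simp add: mult_le_cancel_left1)
    then have "c \<le> S s" using r0 Sr by (simp add: c_def field_simps)
    also have "\<dots> \<le> 1 / (2 * s)" using crit[of s] s0 sr r t by (simp add: field_simps)
    finally have "2 * c * s \<le> 1" using s0 by (simp add: field_simps)
    moreover have "1 < 2 * c * s" using s(2) c0 by (simp add: field_simps)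
    ultimately show False by simp
  qed
  moreover have "1 \<le> 1 / (2 * t) \<longleftrightarrow> t \<le> 1 / 2" using t0 by (simp add: field_simps)
  moreover have "t = 1 / 2 \<Longrightarrow> 1 / (2 * t) = 1" by simp
  ultimately show ?thesis unfolding tail_def by (smt (verit))
qed

section \<open>The law of a time and its invariance under the recursion\<close>

abbreviation uniform_01 :: "real measure" where
  "uniform_01 \<equiv> uniform_measure lborel {0..1}"

lemma prob_space_uniform_01: "prob_space uniform_01"
  by (rule prob_space_uniform_measure) auto

text \<open>The law with tail \<open>tail\<close>, obtained by inverting \<open>tail\<close> on a
  uniform variable. The value 2 represents infinity and has mass 1/2; finite times lie between 1/2
  and 1.\<close>

definition time_law :: "real measure" where
  "time_law = distr uniform_01 borel (\<lambda>v. if 1 / 2 \<le> v then 1 / (2 * v) else 2)"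

lemma sets_time_law [simp, measurable_cong]: "sets time_law = sets borel"
  by (simp add: time_law_def)

lemma prob_space_time_law: "prob_space time_law"
  unfolding time_law_def by (rule prob_space.prob_space_distr[OF prob_space_uniform_01]) measurable

lemma AE_uniform_01: "AE v in uniform_01. v \<in> {0..1}"
  by (rule AE_uniform_measureI) auto

lemma AE_time_law: "AE x in time_law. x \<in> {0..1} \<union> {2}"
  unfolding time_law_def
  by (subst AE_distr_iff) (use AE_uniform_01 in \<open>auto elim!: eventually_mono simp: divide_le_eq\<close>)

lemma measure_uniform_01: "A \<in> sets borel \<Longrightarrow> measure uniform_01 A = measure lborel ({0..1} \<inter> A)"
  by (subst measure_uniform_measure) auto

lemma uniform_01_atMost: "0 \<le> t \<Longrightarrow> t \<le> 1 \<Longrightarrow> measure uniform_01 {..t} = t"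
proof -
  assume "0 \<le> t" "t \<le> 1"
  then have "{0..1} \<inter> {..t} = {0..t}" by auto
  then show ?thesis using \<open>0 \<le> t\<close> by (simp add: measure_uniform_01)
qed

lemma time_law_tail:
  assumes "0 \<le> t" "t \<le> 1" shows "measure time_law {t<..} = tail t"
proof -
  let ?f = "\<lambda>v::real. if 1 / 2 \<le> v then 1 / (2 * v) else 2"
  have "measure time_law {t<..} = measure uniform_01 (?f -` {t<..})"
    unfolding time_law_def by (subst measure_distr) auto
  also have "\<dots> = measure lborel ({0..1} \<inter> ?f -` {t<..})"
  proof (rule measure_uniform_01)
    have "?f \<in> borel_measurable borel" by measurable
    from measurable_sets[OF this, of "{t<..}"] show "?f -` {t<..} \<in> sets borel" by simp
  qed
  also have "\<dots> = tail t"
  proof (cases "t < 1 / 2")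
    case True
    have "t < ?f v" if "v \<in> {0..1}" for v
    proof (cases "1 / 2 \<le> v")
      case half: True
      then have "1 / (2 * 1) \<le> 1 / (2 * v)" using that by (intro divide_left_mono) auto
      then have "t < 1 / (2 * v)" using True by linarith
      then show ?thesis using half by simp
    qed (use assms in simp)
    then have "{0..1} \<inter> ?f -` {t<..} = {0..1}" by auto
    then show ?thesis using True by (simp add: tail_def)
  next
    case False
    have t: "1 / 2 \<le> 1 / (2 * t)" "1 / (2 * t) \<le> 1" using False assms by (auto simp: field_simps)
    have "t < ?f v \<longleftrightarrow> v < 1 / (2 * t)" if "v \<in> {0..1}" for v
    proof (cases "1 / 2 \<le> v")
      case True then show ?thesis using False assms by (simp add: field_simps)
    next
      case False then show ?thesis using t assms by simp
    qed
    then have "{0..1} \<inter> ?f -` {t<..} = {0..<1 / (2 * t)}" using t by auto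
    then show ?thesis using False by (auto simp: tail_def)
  qed
  finally show ?thesis .
qed

text \<open>With mass only on the unit interval and at 2, a distribution function is constant
  between 1 and 2, so its values on the unit interval determine it.\<close>

lemma real_law_eqI:
  fixes P Q :: "real measure"
  assumes "prob_space P" "prob_space Q" "sets P = sets borel" "sets Q = sets borel"
    and "AE x in P. x \<in> {0..1} \<union> {2}" "AE x in Q. x \<in> {0..1} \<union> {2}"
    and eq: "\<And>t. 0 \<le> t \<Longrightarrow> t \<le> 1 \<Longrightarrow> measure P {t<..} = measure Q {t<..}"
  shows "P = Q"
proof -
  interpret P: real_distribution P using assms by (simp add: real_distribution_def real_distribution_axioms_def)
  interpret Q: real_distribution Q using assms by (simp add: real_distribution_def real_distribution_axioms_def)
  have cdf: "cdf R t = (if t < 0 then 0 else if t \<le> 1 then 1 - measure R {t<..}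
      else if t < 2 then 1 - measure R {1<..} else 1)"
    if "real_distribution R" "AE x in R. x \<in> {0..1} \<union> {2}" for R t
  proof -
    interpret R: real_distribution R by fact
    have c: "measure R {..s} = 1 - measure R {s<..}" for s
      using R.prob_compl[of "{s<..}"] by (simp add: Compl_eq_Diff_UNIV[symmetric])
    consider "t < 0" | "0 \<le> t" "t \<le> 1" | "1 < t" "t < 2" | "2 \<le> t" by linarith
    then show ?thesis
    proof cases
      case 1
      have "AE x in R. x \<notin> {..t}" using that(2) by eventually_elim (use 1 in auto)
      then have "measure R {..t} = 0" using R.prob_eq_0[of "{..t}"] by simp
      then show ?thesis using 1 by (simp add: cdf_def)
    next
      case 2 then show ?thesis using c by (simp add: cdf_def)
    next
      case 3
      have "measure R {..t} = measure R {..1}"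
        by (rule R.finite_measure_eq_AE) (use that(2) 3 in \<open>auto elim!: eventually_mono\<close>)
      then show ?thesis using c[of 1] 3 by (simp add: cdf_def)
    next
      case 4
      have "AE x in R. x \<in> {..t}" using that(2) by eventually_elim (use 4 in auto)
      then have "measure R {..t} = 1" using R.prob_eq_1[of "{..t}"] by simp
      then show ?thesis using 4 by (simp add: cdf_def)
    qed
  qed
  have "cdf P = cdf Q"
    unfolding fun_eq_iff cdf[OF P.real_distribution_axioms assms(5)] cdf[OF Q.real_distribution_axioms assms(6)]
    using eq by simp
  then show ?thesis using cdf_unique P.real_distribution_axioms Q.real_distribution_axioms by blast
qed

definition freeze :: "real \<Rightarrow> real \<Rightarrow> real" where
  "freeze u x = (if x \<le> u then 2 else x)"

context prob_space
begin

text \<open>\<open>W\<close> lands in the window exactly if the minimum does and the label is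
  smaller than it. The event is thus squeezed between those with label at most \<open>s\<close> and
  at most \<open>t\<close>, and no integration against the law of the minimum is needed.\<close>

lemma freeze_window:
  fixes U X Y :: "'a \<Rightarrow> real" and S :: "real \<Rightarrow> real"
  assumes [measurable]: "U \<in> borel_measurable M" "X \<in> borel_measurable M" "Y \<in> borel_measurable M"
    and joint: "\<And>r x. 0 \<le> r \<Longrightarrow> r \<le> 1 \<Longrightarrow> 0 \<le> x \<Longrightarrow> x \<le> 1 \<Longrightarrow>
       prob {\<omega> \<in> space M. U \<omega> \<le> r \<and> x < X \<omega> \<and> x < Y \<omega>} = r * (S x)\<^sup>2"
    and st: "0 \<le> s" "s \<le> t" "t \<le> 1"
  defines "W \<equiv> \<lambda>\<omega>. freeze (U \<omega>) (min (X \<omega>) (Y \<omega>))"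
  shows "s * ((S s)\<^sup>2 - (S t)\<^sup>2) \<le> prob {\<omega> \<in> space M. s < W \<omega> \<and> W \<omega> \<le> t}"
    and "prob {\<omega> \<in> space M. s < W \<omega> \<and> W \<omega> \<le> t} \<le> t * ((S s)\<^sup>2 - (S t)\<^sup>2)"
proof -
  have [measurable]: "W \<in> borel_measurable M" unfolding W_def freeze_def by measurable
  have box: "prob {\<omega> \<in> space M. U \<omega> \<le> r \<and> s < min (X \<omega>) (Y \<omega>) \<and> min (X \<omega>) (Y \<omega>) \<le> t} =
      r * ((S s)\<^sup>2 - (S t)\<^sup>2)" (is "prob ?A = _") if r: "0 \<le> r" "r \<le> 1" for r
  proof -
    let ?B = "\<lambda>x. {\<omega> \<in> space M. U \<omega> \<le> r \<and> x < X \<omega> \<and> x < Y \<omega>}"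
    have B: "?B x \<in> events" for x by measurable
    have eq: "?A = ?B s - ?B t" using st by auto
    have "prob (?B s - ?B t) = prob (?B s) - prob (?B t)"
      by (rule finite_measure_Diff[OF B B]) (use st in auto)
    moreover have "prob (?B s) = r * (S s)\<^sup>2" by (rule joint) (use r st in auto)
    moreover have "prob (?B t) = r * (S t)\<^sup>2" by (rule joint) (use r st in auto)
    ultimately show ?thesis unfolding eq by (simp only: right_diff_distrib)
  qed
  have "s * ((S s)\<^sup>2 - (S t)\<^sup>2) = prob {\<omega> \<in> space M. U \<omega> \<le> s \<and> s < min (X \<omega>) (Y \<omega>) \<and> min (X \<omega>) (Y \<omega>) \<le> t}"
    using box[of s] st by simp
  also have "\<dots> \<le> prob {\<omega> \<in> space M. s < W \<omega> \<and> W \<omega> \<le> t}"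
    by (rule finite_measure_mono) (auto simp: W_def freeze_def)
  finally show "s * ((S s)\<^sup>2 - (S t)\<^sup>2) \<le> prob {\<omega> \<in> space M. s < W \<omega> \<and> W \<omega> \<le> t}" .
  have "prob {\<omega> \<in> space M. s < W \<omega> \<and> W \<omega> \<le> t} \<le>
      prob {\<omega> \<in> space M. U \<omega> \<le> t \<and> s < min (X \<omega>) (Y \<omega>) \<and> min (X \<omega>) (Y \<omega>) \<le> t}"
    by (rule finite_measure_mono) (use st in \<open>auto simp: W_def freeze_def split: if_splits\<close>)
  then show "prob {\<omega> \<in> space M. s < W \<omega> \<and> W \<omega> \<le> t} \<le> t * ((S s)\<^sup>2 - (S t)\<^sup>2)"
    using box[of t] st by simp
qed

text \<open>On \<open>[0, 1/2]\<close> the upper window bound vanishes. Beyond 1/2 both window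
  bounds equal \<open>1 / (2 * x) - 1 / (2 * y)\<close> up to an error quadratic in
  \<open>y - x\<close>, so the new tail differs from \<open>1 / (2 * t)\<close> by a
  constant.\<close>

lemma freeze_time_law:
  fixes U X Y :: "'a \<Rightarrow> real"
  assumes [measurable]: "U \<in> borel_measurable M" "X \<in> borel_measurable M" "Y \<in> borel_measurable M"
    and U: "AE \<omega> in M. U \<omega> \<in> {0..1}" and X: "AE \<omega> in M. X \<omega> \<in> {0..1} \<union> {2}" and Y: "AE \<omega> in M. Y \<omega> \<in> {0..1} \<union> {2}"
    and joint: "\<And>r x. 0 \<le> r \<Longrightarrow> r \<le> 1 \<Longrightarrow> 0 \<le> x \<Longrightarrow> x \<le> 1 \<Longrightarrow>
       prob {\<omega> \<in> space M. U \<omega> \<le> r \<and> x < X \<omega> \<and> x < Y \<omega>} = r * (tail x)\<^sup>2"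
  shows "distr M borel (\<lambda>\<omega>. freeze (U \<omega>) (min (X \<omega>) (Y \<omega>))) = time_law"
proof (rule real_law_eqI)
  let ?W = "\<lambda>\<omega>. freeze (U \<omega>) (min (X \<omega>) (Y \<omega>))"
  have [measurable]: "?W \<in> borel_measurable M" unfolding freeze_def by measurable
  show "prob_space (distr M borel ?W)" by (rule prob_space_distr) measurable
  show "AE x in distr M borel ?W. x \<in> {0..1} \<union> {2}"
    by (subst AE_distr_iff) (use X Y in \<open>auto elim!: eventually_elim2 simp: freeze_def min_def\<close>)
  fix t :: real assume t: "0 \<le> t" "t \<le> 1"
  define H where "H t = prob {\<omega> \<in> space M. t < ?W \<omega>}" for t
  have diff: "H x - H y = prob {\<omega> \<in> space M. x < ?W \<omega> \<and> ?W \<omega> \<le> y}" if "x \<le> y" for x y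
  proof -
    have eq: "{\<omega> \<in> space M. x < ?W \<omega> \<and> ?W \<omega> \<le> y} = {\<omega> \<in> space M. x < ?W \<omega>} - {\<omega> \<in> space M. y < ?W \<omega>}"
      by auto
    show ?thesis unfolding eq H_def
    proof (rule finite_measure_Diff[symmetric])
      show "{\<omega> \<in> space M. x < ?W \<omega>} \<in> events" "{\<omega> \<in> space M. y < ?W \<omega>} \<in> events" by measurable
    qed (use that in auto)
  qed
  note window = freeze_window[OF assms(1-3) joint]
  have H0: "H 0 = 1"
    unfolding H_def by (subst prob_Collect_eq_1)
      (use U X Y in \<open>auto elim!: eventually_elim2 simp: freeze_def min_def\<close>)
  have Hhalf: "H x = 1" if "0 \<le> x" "x \<le> 1 / 2" for x
  proof -
    have "H 0 - H x \<le> 0" using window(2)[of 0 x] diff[of 0 x] that by (simp add: tail_def)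
    moreover have "H x \<le> 1" by (simp add: H_def)
    ultimately show ?thesis using H0 by simp
  qed
  have "H t = tail t"
  proof (cases "t \<le> 1 / 2")
    case True then show ?thesis using Hhalf t by (simp add: tail_def)
  next
    case False
    have "H t - 1 / (2 * t) = H (1 / 2) - 1 / (2 * (1 / 2))"
    proof (rule quadratic_modulus_constant[where C = 2 and f = "\<lambda>x. H x - 1 / (2 * x)"])
      fix x y :: real assume xy: "1 / 2 \<le> x" "x \<le> y" "y \<le> t"
      then have y: "x \<le> 1" "y \<le> 1" "0 < x" "0 < y" using t by auto
      have T: "tail x = 1 / (2 * x)" "tail y = 1 / (2 * y)" using xy by (auto simp: tail_def)
      have lo: "x * ((tail x)\<^sup>2 - (tail y)\<^sup>2) = (1 / (2 * x) - 1 / (2 * y)) - (y - x)\<^sup>2 * (1 / (4 * x * y\<^sup>2))"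
        unfolding T using y by (simp add: field_simps power2_eq_square)
      have hi: "y * ((tail x)\<^sup>2 - (tail y)\<^sup>2) = (1 / (2 * x) - 1 / (2 * y)) + (y - x)\<^sup>2 * (1 / (4 * x\<^sup>2 * y))"
        unfolding T using y by (simp add: field_simps power2_eq_square)
      \<comment> \<open>The largest value, attained at \<open>p = q = r = 1/2\<close>; this is the
        origin of the constant \<open>C = 2\<close>.\<close>
      have b: "1 / (4 * p * q * r) \<le> 2" if "1 / 2 \<le> p" "1 / 2 \<le> q" "1 / 2 \<le> r" for p q r :: real
      proof -
        have "(1 / 2) * (1 / 2) \<le> p * q" using that by (intro mult_mono) auto
        then have "(1 / 2) * (1 / 2) * (1 / 2) \<le> p * q * r" using that by (intro mult_mono) auto
        then show ?thesis using that by (simp add: divide_le_eq mult.assoc)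
      qed
      have "1 / (4 * x * y\<^sup>2) \<le> 2" "1 / (4 * x\<^sup>2 * y) \<le> 2"
        using b[of x y y] b[of x x y] xy by (simp_all add: power2_eq_square mult.assoc)
      note q = this[THEN mult_left_mono, OF zero_le_power2[of "y - x"]]
      show "\<bar>(H y - 1 / (2 * y)) - (H x - 1 / (2 * x))\<bar> \<le> 2 * (y - x)\<^sup>2"
        using window(1)[of x y, unfolded lo] window(2)[of x y, unfolded hi] diff[of x y] xy y q by linarith
    qed (use False in auto)
    then show ?thesis using Hhalf[of "1 / 2"] False by (simp add: tail_def)
  qed
  moreover have "measure (distr M borel ?W) {t<..} = H t"
    unfolding H_def by (subst measure_distr) (auto intro!: arg_cong[where f = prob])
  ultimately show "measure (distr M borel ?W) {t<..} = measure time_law {t<..}"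
    using time_law_tail[OF t] by simp
qed (use prob_space_time_law AE_time_law in auto)

end

section \<open>Percolation along rays\<close>

context cubic_tree
begin

lemma ray_descendants: "ray E p \<Longrightarrow> p n \<in> descendants E (p 0)"
  using ray_crel by (simp add: descendants_eq ray_iff)

lemma ray_oriented: "ray E p \<Longrightarrow> p n \<in> oriented E"
  by (simp add: ray_def)

lemma ray_children: "ray E p \<Longrightarrow> p (Suc n) \<in> children (p n)"
  by (simp add: ray_iff)

lemma ray_edge_ne:
  assumes "ray E p" "m < n" shows "edge (p m) \<noteq> edge (p n)"
proof -
  have "ray E (\<lambda>k. p (k + Suc m))" using assms by (intro ray_shift)
  from ray_descendants[OF this, of "n - Suc m"] have "p n \<in> descendants E (p (Suc m))" using assms by simp
  then have "edge (p n) \<in> branch_edges (p (Suc m))" unfolding branch_edges_iff by (rule imageI)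
  then show ?thesis using edge_not_in_child_branch[of "p m" "p (Suc m)"] assms ray_oriented ray_children by metis
qed

lemma ray_snd_ne:
  assumes "ray E p" "m < n" shows "snd (p m) \<noteq> snd (p n)"
proof -
  have "ray E (\<lambda>k. p (k + Suc m))" using assms by (intro ray_shift)
  from ray_descendants[OF this, of "n - Suc m"] have "p n \<in> descendants E (p (Suc m))" using assms by simp
  then have "snd (p n) \<in> branch_vertices (p (Suc m))" unfolding branch_vertices_def by (rule imageI)
  moreover have "fst (p (Suc m)) = snd (p m)" using assms by (simp add: ray_def)
  ultimately show ?thesis using branch_root[OF ray_oriented[OF assms(1)], of "Suc m"] by metis
qed

text \<open>The condition \<open>B\<close> at the end of the path differs between the two uses: it
  is trivial for percolation, and demands a late time for the branching process.\<close>

primrec reach :: "('v \<times> 'v \<Rightarrow> bool) \<Rightarrow> ('v \<times> 'v \<Rightarrow> bool) \<Rightarrow> nat \<Rightarrow> 'v \<times> 'v \<Rightarrow> bool" where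
  "reach B G 0 a = B a"
| "reach B G (Suc n) a = (G a \<and> (\<exists>c\<in>children a. reach B G n c))"

lemma reach_antimono:
  assumes "\<And>b. b \<in> oriented E \<Longrightarrow> reach B G 1 b \<Longrightarrow> B b" "a \<in> oriented E" "m \<le> n" "reach B G n a"
  shows "reach B G m a"
proof -
  have S: "a \<in> oriented E \<Longrightarrow> reach B G (Suc n) a \<Longrightarrow> reach B G n a" for n a
  proof (induction n arbitrary: a)
    case 0 then show ?case using assms(1)[of a] by simp
  next
    case (Suc n)
    then show ?case using childrenD(1) by (metis reach.simps(2))
  qed
  from assms(3,4) show ?thesis
    by (induction n rule: dec_induct) (use S assms(2) in auto)
qed

text \<open>Reaching depth \<open>n\<close> becomes harder with \<open>n\<close> and each edge has
  finitely many children, so one child is good to every depth; iterating gives the ray.\<close>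

lemma koenig:
  assumes B: "\<And>b. b \<in> oriented E \<Longrightarrow> reach B G 1 b \<Longrightarrow> B b"
    and a: "a \<in> oriented E" "\<And>n. reach B G n a"
  obtains p where "ray E p" "p 0 = a" "\<And>n. G (p n)"
proof -
  have step: "\<exists>c\<in>children b. \<forall>n. reach B G n c" if b: "b \<in> oriented E" "\<forall>n. reach B G n b" for b
  proof (rule ccontr)
    assume "\<not> ?thesis"
    then have "\<forall>c\<in>children b. \<exists>n. \<not> reach B G n c" by blast
    then obtain N where N: "\<And>c. c \<in> children b \<Longrightarrow> \<not> reach B G (N c) c" by metis
    \<comment> \<open>At depth \<open>m\<close> every child has already failed.\<close>
    define m where "m = Max (N ` children b)"
    have "reach B G (Suc m) b" using b by blast
    then obtain c where c: "c \<in> children b" "reach B G m c" by auto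
    have "N c \<le> m" unfolding m_def using c by (intro Max_ge) auto
    then have "reach B G (N c) c"
      by (rule reach_antimono[where B = B and G = G, rotated 2])
        (use B childrenD(1)[OF c(1)] c(2) in auto)
    then show False using N c by blast
  qed
  obtain p where p: "ray E p" "p 0 = a" "\<And>n. \<forall>m. reach B G m (p n)"
    using choose_ray[of a "\<lambda>b. \<forall>n. reach B G n b"] a step by blast
  have "G (p n)" for n using p(3)[of n, rule_format, of 1] by simp
  with p(1,2) show ?thesis by (rule that)
qed

text \<open>Truncation at finite depth makes measurability immediate; by Koenig's lemma it amounts to the existence
  of a ray.\<close>

definition percolates :: "('v set \<Rightarrow> real) \<Rightarrow> ('v \<times> 'v) set \<Rightarrow> real \<Rightarrow> 'v \<times> 'v \<Rightarrow> bool" where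
  "percolates u F t a \<longleftrightarrow> (\<forall>n. reach (\<lambda>_. True) (\<lambda>b. u (edge b) \<le> t \<and> b \<notin> F) n a)"

lemma percolates_ray:
  assumes "a \<in> oriented E"
  shows "percolates u F t a \<longleftrightarrow> (\<exists>p. ray E p \<and> p 0 = a \<and> (\<forall>n. u (edge (p n)) \<le> t \<and> p n \<notin> F))"
proof
  assume *: "percolates u F t a"
  obtain p where "ray E p" "p 0 = a" "\<And>n. u (edge (p n)) \<le> t \<and> p n \<notin> F"
    by (rule koenig[of "\<lambda>_. True" "\<lambda>b. u (edge b) \<le> t \<and> b \<notin> F" a])
      (use * assms in \<open>auto simp: percolates_def\<close>)
  then show "\<exists>p. ray E p \<and> p 0 = a \<and> (\<forall>n. u (edge (p n)) \<le> t \<and> p n \<notin> F)" by blast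
next
  assume "\<exists>p. ray E p \<and> p 0 = a \<and> (\<forall>n. u (edge (p n)) \<le> t \<and> p n \<notin> F)"
  then obtain p where p: "ray E p" "p 0 = a" "\<And>n. u (edge (p n)) \<le> t \<and> p n \<notin> F" by blast
  have "reach (\<lambda>_. True) (\<lambda>b. u (edge b) \<le> t \<and> b \<notin> F) n (p k)" for n k
  proof (induction n arbitrary: k)
    case (Suc n) then show ?case using p(3)[of k] ray_children[OF p(1), of k] by auto
  qed simp
  then show "percolates u F t a" unfolding percolates_def p(2)[symmetric] by blast
qed

lemma percolates_unfold:
  assumes "a \<in> oriented E"
  shows "percolates u F t a \<longleftrightarrow> u (edge a) \<le> t \<and> a \<notin> F \<and> (\<exists>c\<in>children a. percolates u F t c)"
proof
  assume "percolates u F t a"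
  then obtain p where p: "ray E p" "p 0 = a" "\<And>n. u (edge (p n)) \<le> t \<and> p n \<notin> F"
    using percolates_ray[OF assms] by blast
  have c: "p 1 \<in> children a" using ray_children[OF p(1), of 0] p(2) by simp
  have "percolates u F t (p 1)"
    using ray_shift[OF p(1), of 1] p(3) unfolding percolates_ray[OF childrenD(1)[OF c]]
    by (intro exI[of _ "\<lambda>n. p (n + 1)"]) auto
  then show "u (edge a) \<le> t \<and> a \<notin> F \<and> (\<exists>c\<in>children a. percolates u F t c)" using p(2) p(3)[of 0] c by auto
next
  assume *: "u (edge a) \<le> t \<and> a \<notin> F \<and> (\<exists>c\<in>children a. percolates u F t c)"
  then obtain c where c: "c \<in> children a" "percolates u F t c" by blast
  have "reach (\<lambda>_. True) (\<lambda>b. u (edge b) \<le> t \<and> b \<notin> F) n a" for n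
  proof (cases n)
    case (Suc m)
    have "reach (\<lambda>_. True) (\<lambda>b. u (edge b) \<le> t \<and> b \<notin> F) m c" using c(2) by (simp add: percolates_def)
    then show ?thesis unfolding Suc reach.simps using * c(1) by blast
  qed simp
  then show "percolates u F t a" by (simp add: percolates_def)
qed

lemma percolates_label: "percolates u F t a \<Longrightarrow> u (edge a) \<le> t"
  unfolding percolates_def by (drule spec[of _ 1]) simp

lemma percolates_mono:
  assumes "s \<le> t" "percolates u F s a" shows "percolates u F t a"
proof -
  have "reach (\<lambda>_. True) (\<lambda>b. u (edge b) \<le> s \<and> b \<notin> F) n b \<Longrightarrow>
        reach (\<lambda>_. True) (\<lambda>b. u (edge b) \<le> t \<and> b \<notin> F) n b" for n b
    using assms(1) by (induction n arbitrary: b) (auto intro: order_trans)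
  with assms(2) show ?thesis by (simp add: percolates_def)
qed

text \<open>To a finite depth only finitely many labels are compared, by weak inequalities, with the
  level. It follows that the infimum in \<open>percolation_time\<close> is attained.\<close>

lemma percolates_right_closed:
  assumes "\<And>s. s > t \<Longrightarrow> percolates u F s a" shows "percolates u F t a"
proof -
  let ?r = "\<lambda>t. reach (\<lambda>_. True) (\<lambda>b. u (edge b) \<le> t \<and> b \<notin> F)"
  have mono: "s \<le> t \<Longrightarrow> ?r s n b \<Longrightarrow> ?r t n b" for s t n b
    by (induction n arbitrary: b) (auto intro: order_trans)
  have "(\<And>s. s > t \<Longrightarrow> ?r s n b) \<Longrightarrow> ?r t n b" for n b
  proof (induction n arbitrary: b)
    case (Suc n)
    have "u (edge b) \<le> t" by (rule dense_ge) (use Suc.prems in auto)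
    moreover have "b \<notin> F" using Suc.prems[of "t + 1"] by simp
    moreover have "\<exists>c\<in>children b. \<forall>s>t. ?r s n c"
    proof (rule ccontr)
      assume "\<not> ?thesis"
      then have "\<forall>c\<in>children b. \<exists>s. s > t \<and> \<not> ?r s n c" by blast
      then obtain N where N: "\<And>c. c \<in> children b \<Longrightarrow> N c > t \<and> \<not> ?r (N c) n c" by (rule bchoice[THEN exE]) blast
      \<comment> \<open>\<open>b\<close> need not be an edge here, so \<open>children b\<close> may
        be empty; \<open>t + 1\<close> keeps the minimum defined.\<close>
      define m where "m = Min (insert (t + 1) (N ` children b))"
      have m: "m > t" unfolding m_def using N by (subst Min_gr_iff) auto
      then obtain c where c: "c \<in> children b" "?r m n c" using Suc.prems[OF m] by auto
      have "m \<le> N c" unfolding m_def using c by (intro Min_le) auto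
      then show False using mono[OF _ c(2)] N[OF c(1)] by blast
    qed
    ultimately show ?case using Suc.IH by auto
  qed simp
  with assms show ?thesis by (simp add: percolates_def)
qed

section \<open>Condition (i) and the recursion for percolation times\<close>

lemma ray_condition_iff:
  "ray_condition E u F \<longleftrightarrow>
     (\<forall>a\<in>oriented E. a \<in> F \<longleftrightarrow> (\<exists>c\<in>children a. percolates u F (u (edge a)) c))"
proof -
  have "(\<exists>p. ray E p \<and> p 0 = a \<and> (\<forall>n\<ge>1. p n \<in> oriented (edges_upto E u (u (edge a))) - F)) \<longleftrightarrow>
        (\<exists>c\<in>children a. percolates u F (u (edge a)) c)" (is "?L \<longleftrightarrow> ?R") if a: "a \<in> oriented E" for a
  proof
    assume ?L
    then obtain p where p: "ray E p" "p 0 = a" "\<And>n. n \<ge> 1 \<Longrightarrow> p n \<in> oriented (edges_upto E u (u (edge a))) - F"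
      by blast
    have c: "p 1 \<in> children a" using ray_children[OF p(1), of 0] p(2) by simp
    have "u (edge (p (n + 1))) \<le> u (edge a) \<and> p (n + 1) \<notin> F" for n
      using p(3)[of "n + 1"] by (cases "p (n + 1)") (auto simp: oriented_def edges_upto_def)
    then have "percolates u F (u (edge a)) (p 1)"
      using ray_shift[OF p(1), of 1] unfolding percolates_ray[OF childrenD(1)[OF c]]
      by (intro exI[of _ "\<lambda>n. p (n + 1)"]) simp
    with c show ?R by blast
  next
    assume ?R
    then obtain c where c: "c \<in> children a" "percolates u F (u (edge a)) c" by blast
    then obtain p where p: "ray E p" "p 0 = c" "\<And>n. u (edge (p n)) \<le> u (edge a) \<and> p n \<notin> F"
      using percolates_ray[OF childrenD(1)[OF c(1)]] by blast
    have "p n \<in> oriented (edges_upto E u (u (edge a))) - F" for n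
      using p(3)[of n] ray_oriented[OF p(1), of n]
      by (cases "p n") (auto simp: oriented_def edges_upto_def)
    moreover have "ray E (case_nat a p)" using ray_Cons[OF p(1) a] c p by simp
    ultimately show ?L by (intro exI[of _ "case_nat a p"]) (auto split: nat.split)
  qed
  then show ?thesis unfolding ray_condition_def by (auto simp: split_def)
qed

text \<open>The value 2 stands for infinity.\<close>

definition percolation_time :: "('v set \<Rightarrow> real) \<Rightarrow> ('v \<times> 'v) set \<Rightarrow> 'v \<times> 'v \<Rightarrow> real" where
  "percolation_time u F a = (if percolates u F 1 a then Inf {t. percolates u F t a} else 2)"

definition recursion_at :: "('v set \<Rightarrow> real) \<Rightarrow> ('v \<times> 'v \<Rightarrow> real) \<Rightarrow> 'v \<times> 'v \<Rightarrow> bool" where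
  "recursion_at u x a \<longleftrightarrow> x a = freeze (u (edge a)) (Min (x ` children a))"

definition frozen_edges :: "('v set \<Rightarrow> real) \<Rightarrow> ('v \<times> 'v \<Rightarrow> real) \<Rightarrow> ('v \<times> 'v) set" where
  "frozen_edges u x = {a \<in> oriented E. Min (x ` children a) \<le> u (edge a)}"

text \<open>The infimum is attained, so weak inequality matches percolation at level
  \<open>t\<close>. Percolation at a level above 1 only is recorded as infinity, whence
  \<open>t <= 1\<close>.\<close>

lemma percolation_time_le_iff:
  assumes "t \<le> 1" shows "percolation_time u F a \<le> t \<longleftrightarrow> percolates u F t a"
proof (cases "percolates u F 1 a")
  case True
  have bdd: "bdd_below {t. percolates u F t a}"
    by (intro bdd_belowI[of _ "u (edge a)"]) (simp add: percolates_label)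
  show ?thesis
  proof
    assume "percolates u F t a"
    then show "percolation_time u F a \<le> t"
      using True bdd by (auto simp: percolation_time_def intro: cInf_lower)
  next
    assume *: "percolation_time u F a \<le> t"
    show "percolates u F t a"
    proof (rule percolates_right_closed)
      fix s assume "s > t"
      then have "Inf {t. percolates u F t a} < s" using True * by (simp add: percolation_time_def)
      then obtain r where "percolates u F r a" "r < s"
        using True bdd by (subst (asm) cInf_less_iff) auto
      then show "percolates u F s a" using percolates_mono by (metis less_imp_le)
    qed
  qed
next
  case False
  then have "\<not> percolates u F t a" using assms percolates_mono by blast
  then show ?thesis using False assms by (simp add: percolation_time_def)
qed

lemma percolation_time_range:
  assumes "0 \<le> u (edge a)" shows "percolation_time u F a \<in> {0..1} \<union> {2}"
proof (cases "percolates u F 1 a")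
  case True
  have "0 \<le> Inf {t. percolates u F t a}"
    by (rule cInf_greatest) (use True percolates_label[of u F _ a] assms in \<open>auto intro: order_trans\<close>)
  moreover have "percolation_time u F a \<le> 1" using True percolation_time_le_iff by simp
  ultimately show ?thesis using True by (simp add: percolation_time_def)
qed (simp add: percolation_time_def)

lemma Min_children_le_iff:
  "a \<in> oriented E \<Longrightarrow> Min (x ` children a) \<le> t \<longleftrightarrow> (\<exists>c\<in>children a. x c \<le> t)" for t :: real
  using children_nonempty by (subst Min_le_iff) auto

lemma Min_children_gr_iff:
  "a \<in> oriented E \<Longrightarrow> t < Min (x ` children a) \<longleftrightarrow> (\<forall>c\<in>children a. t < x c)" for t :: real
  using children_nonempty by (subst Min_gr_iff) auto

lemma percolation_time_eqI:
  fixes x y :: real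
  assumes "x \<in> {0..1} \<union> {2}" "y \<in> {0..1} \<union> {2}" "\<And>t. 0 \<le> t \<Longrightarrow> t \<le> 1 \<Longrightarrow> x \<le> t \<longleftrightarrow> y \<le> t"
  shows "x = y"
  using assms(1,2) assms(3)[of x] assms(3)[of y] by auto

lemma ray_condition_recursion:
  assumes R: "ray_condition E u F" and u: "\<And>e. e \<in> E \<Longrightarrow> u e \<in> {0..1}" and a: "a \<in> oriented E"
  shows "recursion_at u (percolation_time u F) a"
    and "a \<in> F \<longleftrightarrow> Min (percolation_time u F ` children a) \<le> u (edge a)"
proof -
  let ?x = "percolation_time u F" and ?m = "Min (percolation_time u F ` children a)"
  have u01: "0 \<le> u (edge b)" "u (edge b) \<le> 1" if "b \<in> oriented E" for b
    using u[of "edge b"] that by (auto simp: oriented_iff)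
  have m_le: "?m \<le> t \<longleftrightarrow> (\<exists>c\<in>children a. percolates u F t c)" if "t \<le> 1" for t
    using Min_children_le_iff[OF a] percolation_time_le_iff[OF that] by simp
  show F: "a \<in> F \<longleftrightarrow> ?m \<le> u (edge a)"
    using R a m_le[OF u01(2)[OF a]] unfolding ray_condition_iff by blast
  have "?m \<in> ?x ` children a" using children_nonempty[OF a] by (intro Min_in) auto
  then obtain c where c: "c \<in> children a" "?m = ?x c" by auto
  then have "?m \<in> {0..1} \<union> {2}" using percolation_time_range u01(1)[OF childrenD(1)[OF c(1)]] by metis
  then have "freeze (u (edge a)) ?m \<in> {0..1} \<union> {2}" by (auto simp: freeze_def)
  moreover have "?x a \<in> {0..1} \<union> {2}" using percolation_time_range u01(1)[OF a] by blast
  moreover have "?x a \<le> t \<longleftrightarrow> freeze (u (edge a)) ?m \<le> t" if "0 \<le> t" "t \<le> 1" for t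
  proof -
    have "?x a \<le> t \<longleftrightarrow> u (edge a) \<le> t \<and> a \<notin> F \<and> ?m \<le> t"
      unfolding percolation_time_le_iff[OF that(2)] percolates_unfold[OF a, of u F t] m_le[OF that(2)] ..
    \<comment> \<open>If \<open>a\<close> is not frozen, its label is below the minimum, so openness
      at level \<open>t\<close> follows from the minimum being at most \<open>t\<close>.\<close>
    then show ?thesis using that F by (auto simp: freeze_def)
  qed
  ultimately show "recursion_at u ?x a" unfolding recursion_at_def by (intro percolation_time_eqI)
qed

text \<open>For random labels and times with \<open>P (x b > t) = S t\<close>, the edges explored here, conditioned on \<open>x a > t\<close>,
  form a branching process with two offspring with probability \<open>t * S t\<close> and none otherwise.\<close>

definition late_open :: "('v set \<Rightarrow> real) \<Rightarrow> ('v \<times> 'v \<Rightarrow> real) \<Rightarrow> real \<Rightarrow> nat \<Rightarrow> 'v \<times> 'v \<Rightarrow> bool" where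
  "late_open u x t = reach (\<lambda>b. t < x b) (\<lambda>b. u (edge b) \<le> t \<and> (\<forall>c\<in>children b. t < x c))"

lemma late_open_Suc_0:
  assumes "a \<in> oriented E" "recursion_at u x a" "late_open u x t (Suc n) a" shows "t < x a"
proof -
  have "u (edge a) \<le> t" "t < Min (x ` children a)"
    using assms Min_children_gr_iff[OF assms(1)] by (auto simp: late_open_def)
  then show ?thesis using assms(2) by (simp add: recursion_at_def freeze_def)
qed

text \<open>Survival of the exploration means percolation at level \<open>t\<close> although the
  time at \<open>a\<close> is later than \<open>t\<close>, which true percolation times
  forbid.\<close>

lemma late_open_percolates:
  assumes R: "\<And>b. b \<in> oriented E \<Longrightarrow> recursion_at u x b" and a: "a \<in> oriented E"
    and l: "\<And>n. late_open u x t n a"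
  shows "percolates u (frozen_edges u x) t a"
proof -
  obtain p where p: "ray E p" "p 0 = a" "\<And>n. u (edge (p n)) \<le> t \<and> (\<forall>c\<in>children (p n). t < x c)"
  proof (rule koenig[of "\<lambda>b. t < x b" "\<lambda>b. u (edge b) \<le> t \<and> (\<forall>c\<in>children b. t < x c)" a])
    show "t < x b" if "b \<in> oriented E"
      "reach (\<lambda>b. t < x b) (\<lambda>b. u (edge b) \<le> t \<and> (\<forall>c\<in>children b. t < x c)) 1 b" for b
      using late_open_Suc_0[OF that(1) R[OF that(1)]] that(2) unfolding late_open_def One_nat_def .
  qed (use a l in \<open>auto simp: late_open_def\<close>)
  have "p n \<notin> frozen_edges u x" for n
    using p(3)[of n] Min_children_le_iff[OF ray_oriented[OF p(1)], of x n] by (force simp: frozen_edges_def)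
  then show ?thesis using p unfolding percolates_ray[OF a] by blast
qed

text \<open>Along a percolating ray the time of each edge equals the minimum of the times of its
  children, so lateness is passed on to both of them.\<close>

lemma percolates_late_open:
  assumes R: "\<And>b. b \<in> oriented E \<Longrightarrow> recursion_at u x b" and a: "a \<in> oriented E"
    and "t < x a" "percolates u (frozen_edges u x) t a"
  shows "late_open u x t n a"
  using a assms(3,4)
proof (induction n arbitrary: a)
  case 0 then show ?case by (simp add: late_open_def)
next
  case (Suc n)
  from percolates_unfold[OF Suc.prems(1), of u "frozen_edges u x" t] Suc.prems(3)
  obtain c where c: "u (edge a) \<le> t" "a \<notin> frozen_edges u x" "c \<in> children a" "percolates u (frozen_edges u x) t c"
    by blast
  have "u (edge a) < Min (x ` children a)" using c Suc.prems(1) by (simp add: frozen_edges_def)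
  then have "x a = Min (x ` children a)" using R[OF Suc.prems(1)] by (simp add: recursion_at_def freeze_def)
  then have *: "\<forall>c\<in>children a. t < x c" using Suc.prems Min_children_gr_iff[OF Suc.prems(1)] by metis
  then have "late_open u x t n c" using Suc.IH[OF childrenD(1)[OF c(3)]] c by blast
  then show ?case using * c by (auto simp: late_open_def)
qed

text \<open>A solution of the recursion can fail to be the percolation time in one direction only:
  if \<open>x c <= t < 2\<close>, following minimal children yields percolation, whereas the
  converse is what \<open>dies\<close> supplies. Rational levels are used so that the exceptional
  null sets remain countable in number.\<close>

lemma recursion_ray_condition:
  assumes R: "\<And>b. b \<in> oriented E \<Longrightarrow> recursion_at u x b" and u: "\<And>e. e \<in> E \<Longrightarrow> u e \<in> {0..1}"
    and dies: "\<And>a t. a \<in> oriented E \<Longrightarrow> t \<in> \<rat> \<Longrightarrow> 0 \<le> t \<Longrightarrow> t \<le> 1 \<Longrightarrow> t < x a \<Longrightarrow> \<not> percolates u (frozen_edges u x) t a"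
  shows "ray_condition E u (frozen_edges u x)"
  unfolding ray_condition_iff
proof
  fix a assume a: "a \<in> oriented E"
  have up: "percolates u (frozen_edges u x) t c" if "c \<in> oriented E" "x c \<le> t" "t < 2" for c t
  proof -
    have "reach (\<lambda>_. True) (\<lambda>b. u (edge b) \<le> t \<and> b \<notin> frozen_edges u x) n c" for n
      using that(1,2)
    proof (induction n arbitrary: c)
      case (Suc n)
      have "u (edge c) < Min (x ` children c)" "x c = Min (x ` children c)"
        using R[OF Suc.prems(1)] Suc.prems(2) that(3) by (auto simp: recursion_at_def freeze_def split: if_splits)
      moreover obtain d where d: "d \<in> children c" "x d \<le> t"
        using Min_children_le_iff[OF Suc.prems(1)] Suc.prems(2) calculation(2) by metis
      moreover note Suc.IH[OF childrenD(1)[OF d(1)] d(2)]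
      ultimately show ?case using Suc.prems by (auto simp: frozen_edges_def)
    qed simp
    then show ?thesis by (simp add: percolates_def)
  qed
  have ua: "u (edge a) \<in> {0..1}" using u a by (simp add: oriented_iff)
  show "a \<in> frozen_edges u x \<longleftrightarrow> (\<exists>c\<in>children a. percolates u (frozen_edges u x) (u (edge a)) c)"
  proof
    assume "a \<in> frozen_edges u x"
    then obtain c where "c \<in> children a" "x c \<le> u (edge a)"
      using Min_children_le_iff[OF a] by (auto simp: frozen_edges_def)
    then show "\<exists>c\<in>children a. percolates u (frozen_edges u x) (u (edge a)) c"
      using up[of c "u (edge a)"] childrenD(1)[of c a] ua by auto
  next
    assume "\<exists>c\<in>children a. percolates u (frozen_edges u x) (u (edge a)) c"
    then obtain c where c: "c \<in> children a" "percolates u (frozen_edges u x) (u (edge a)) c" by blast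
    have "x c \<le> u (edge a)"
    proof (rule ccontr)
      assume less: "\<not> ?thesis"
      \<comment> \<open>Raises the level to a rational one still earlier than \<open>x c\<close>; a
        label equal to 1 is rational already and cannot be raised within the unit interval.\<close>
      have "\<exists>s\<in>\<rat>. u (edge a) \<le> s \<and> s \<le> 1 \<and> s < x c"
      proof (cases "u (edge a) = 1")
        case False
        then have "u (edge a) < min 1 (x c)" using less ua by auto
        then obtain s where "s \<in> \<rat>" "u (edge a) < s" "s < min 1 (x c)" using Rats_dense_in_real by blast
        then show ?thesis by (intro bexI[of _ s]) auto
      qed (use less in \<open>auto intro!: bexI[of _ 1]\<close>)
      then obtain s where s: "s \<in> \<rat>" "u (edge a) \<le> s" "s \<le> 1" "s < x c" by blast
      then have "0 \<le> s" using ua by simp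
      then show False using dies[OF childrenD(1)[OF c(1)] s(1) _ s(3,4)] percolates_mono[OF s(2) c(2)] by blast
    qed
    then show "a \<in> frozen_edges u x" using Min_children_le_iff[OF a] c a by (auto simp: frozen_edges_def)
  qed
qed

section \<open>The freezing rule\<close>

text \<open>Since \<open>a\<close> itself is not in \<open>D\<close>, the cluster of its head stays
  in the branch of \<open>a\<close>. There it is a finitely branching tree of outward steps, which
  is infinite iff it contains a ray.\<close>

lemma infinite_cluster_iff_ray:
  assumes a: "a \<in> oriented E" and D: "D \<subseteq> E" "edge a \<notin> D"
  shows "(\<exists>C\<in>clusters T D. infinite C \<and> snd a \<in> C) \<longleftrightarrow>
         (\<exists>p. ray E p \<and> p 0 = a \<and> (\<forall>n\<ge>1. edge (p n) \<in> D))" (is "?L \<longleftrightarrow> ?R")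
proof
  assume ?L
  then obtain v where v: "v \<in> T" "infinite {w \<in> T. (v, w) \<in> (oriented D)\<^sup>*}" "(v, snd a) \<in> (oriented D)\<^sup>*"
    unfolding clusters_def by blast
  define W where "W = {(b, c). b \<in> oriented E \<and> c \<in> children b \<and> edge c \<in> D}"
  have reach: "y \<in> snd ` (W\<^sup>* `` {a})" if "(snd a, y) \<in> (oriented D)\<^sup>*" for y
    using that
  proof induction
    case base show ?case by (intro image_eqI[of _ _ a]) auto
  next
    case (step y z)
    then obtain b where b: "(a, b) \<in> W\<^sup>*" "y = snd b" by auto
    have yz: "{y, z} \<in> D" using step by (simp add: oriented_def)
    have bO: "b \<in> oriented E" using b(1) a by induction (auto simp: W_def dest: childrenD)
    show ?case
    proof (cases "z = fst b")
      \<comment> \<open>An inward step returns to the head of the parent; at \<open>a\<close> it is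
        impossible because \<open>edge a\<close> is not in \<open>D\<close>.\<close>
      case True
      then have eb: "edge b \<in> D" using yz b(2) by (simp add: insert_commute)
      from b(1) show ?thesis
      proof (cases rule: rtranclE)
        case base then show ?thesis using eb D(2) by simp
      next
        case (step b')
        then have "fst b = snd b'" by (auto simp: W_def children_iff)
        then show ?thesis using step(1) True by (intro image_eqI[of _ _ b']) auto
      qed
    next
      case False
      then have "(y, z) \<in> children b" using yz b(2) D(1) by (auto simp: children_def)
      then have "(b, (y, z)) \<in> W" using bO yz by (simp add: W_def)
      then have "(a, (y, z)) \<in> W\<^sup>*" using b(1) by (rule rtrancl_into_rtrancl[rotated])
      then show ?thesis by (intro image_eqI[of _ _ "(y, z)"]) auto
    qed
  qed
  have "{w \<in> T. (v, w) \<in> (oriented D)\<^sup>*} \<subseteq> snd ` (W\<^sup>* `` {a})"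
    using reach reachable_sym[OF v(3)] by (auto intro: rtrancl_trans)
  then have inf: "infinite (W\<^sup>* `` {a})" using v(2) finite_subset finite_imageI by metis
  have step: "\<exists>c\<in>children b. infinite (W\<^sup>* `` {c}) \<and> edge c \<in> D"
    if b: "b \<in> oriented E" "infinite (W\<^sup>* `` {b})" for b
  proof (rule ccontr)
    assume *: "\<not> ?thesis"
    have "W\<^sup>* `` {b} \<subseteq> insert b (\<Union>c\<in>{c \<in> children b. edge c \<in> D}. W\<^sup>* `` {c})"
      by (auto simp: W_def elim: converse_rtranclE)
    moreover have "finite (insert b (\<Union>c\<in>{c \<in> children b. edge c \<in> D}. W\<^sup>* `` {c}))"
      using * by auto
    ultimately show False using b(2) finite_subset by blast
  qed
  obtain p where p: "ray E p" "p 0 = a" "\<And>n. infinite (W\<^sup>* `` {p n}) \<and> (edge (p n) \<in> D \<or> p n = a)"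
    by (rule choose_ray[of a "\<lambda>b. infinite (W\<^sup>* `` {b}) \<and> (edge b \<in> D \<or> b = a)"]) (use a inf step in blast)+
  have "edge (p n) \<in> D" if "n \<ge> 1" for n
    using p(3)[of n] p(2) ray_edge_ne[OF p(1), of 0 n] that by auto
  then show ?R using p by blast
next
  assume ?R
  then obtain p where p: "ray E p" "p 0 = a" "\<And>n. n \<ge> 1 \<Longrightarrow> edge (p n) \<in> D" by blast
  have reach: "(snd a, snd (p n)) \<in> (oriented D)\<^sup>*" for n
  proof (induction n)
    case (Suc n)
    have "fst (p (Suc n)) = snd (p n)" using p(1) by (simp add: ray_def)
    then have "(snd (p n), snd (p (Suc n))) \<in> oriented D" using p(3)[of "Suc n"] by (simp add: oriented_def)
    then show ?case using Suc by (rule rtrancl_into_rtrancl[rotated])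
  qed (simp add: p)
  have T: "snd (p n) \<in> T" for n using orientedD[OF ray_oriented[OF p(1)]] by blast
  let ?C = "{w \<in> T. (snd a, w) \<in> (oriented D)\<^sup>*}"
  have "inj (\<lambda>n. snd (p n))"
    using ray_snd_ne[OF p(1)] by (intro injI) (metis linorder_neqE_nat)
  then have "infinite (range (\<lambda>n. snd (p n)))" by (rule range_inj_infinite)
  moreover have "range (\<lambda>n. snd (p n)) \<subseteq> ?C" using reach T by auto
  ultimately have "infinite ?C" using finite_subset by blast
  moreover have "snd a \<in> T" using T[of 0] p(2) by simp
  ultimately show ?L unfolding clusters_def by auto
qed

text \<open>In (i) a ray avoids edges frozen in its own direction only, whereas (a) also removes
  edges frozen in the opposite direction. The claim is that some witnessing ray avoids both.\<close>

lemma frozen_iff_unfrozen_ray: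
  assumes R: "ray_condition E u F" and u: "\<And>e. e \<in> E \<Longrightarrow> u e \<in> {0..1}" and inj: "inj_on u E"
    and a: "a \<in> oriented E"
  defines "D \<equiv> edges_upto E u (u (edge a)) - (edge ` {b \<in> oriented E. b \<in> F} \<union> {edge a})"
  shows "a \<in> F \<longleftrightarrow> (\<exists>p. ray E p \<and> p 0 = a \<and> (\<forall>n\<ge>1. edge (p n) \<in> D))"
proof
  assume "\<exists>p. ray E p \<and> p 0 = a \<and> (\<forall>n\<ge>1. edge (p n) \<in> D)"
  then obtain p where p: "ray E p" "p 0 = a" "\<And>n. n \<ge> 1 \<Longrightarrow> edge (p n) \<in> D" by blast
  have "u (edge (p (n + 1))) \<le> u (edge a) \<and> p (n + 1) \<notin> F" for n
    using p(3)[of "n + 1"] ray_oriented[OF p(1), of "n + 1"] unfolding D_def edges_upto_def by force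
  moreover have c: "p 1 \<in> children a" using ray_children[OF p(1), of 0] p(2) by simp
  ultimately have "percolates u F (u (edge a)) (p 1)"
    using ray_shift[OF p(1), of 1] unfolding percolates_ray[OF childrenD(1)[OF c]]
    by (intro exI[of _ "\<lambda>n. p (n + 1)"]) simp
  then show "a \<in> F" using R a c unfolding ray_condition_iff by blast
next
  assume "a \<in> F"
  define x where "x = Min (percolation_time u F ` children a)"
  have ua: "u (edge a) \<le> 1" using u a by (simp add: oriented_iff)
  have x_le: "x \<le> u (edge a)"
    using ray_condition_recursion(2)[OF R u a] \<open>a \<in> F\<close> unfolding x_def by blast
  have min: "x \<le> s" if "c \<in> children a" "percolates u F s c" "s \<le> 1" for s c
  proof -
    have "x \<le> percolation_time u F c" unfolding x_def using that by (intro Min_le) auto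
    also have "\<dots> \<le> s" using that percolation_time_le_iff by blast
    finally show ?thesis .
  qed
  have "x \<in> percolation_time u F ` children a"
    unfolding x_def using children_nonempty[OF a] by (intro Min_in) auto
  then obtain c where c: "c \<in> children a" "percolation_time u F c = x" by auto
  then have "percolates u F x c" using percolation_time_le_iff[of x u F c] x_le ua by simp
  then obtain q where q: "ray E q" "q 0 = c" "\<And>n. u (edge (q n)) \<le> x \<and> q n \<notin> F"
    using percolates_ray[OF childrenD(1)[OF c(1)]] by blast
  define p where "p = case_nat a q"
  have p: "ray E p" unfolding p_def using ray_Cons[OF q(1) a] c q(2) by simp
  have p0: "p 0 = a" and pS: "u (edge (p (Suc n))) \<le> x" "p (Suc n) \<notin> F" for n
    using q(3) by (auto simp: p_def)
  text \<open>If the reversal of \<open>p (Suc n)\<close> were frozen, a ray at the level of its label would leave \<open>p\<close>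
    before \<open>p (Suc n)\<close>, contradicting the minimality of \<open>x\<close>.\<close>
  have notF: "prod.swap (p (Suc n)) \<notin> F" for n
  proof
    assume rev: "prod.swap (p (Suc n)) \<in> F"
    define s where "s = u (edge (p (Suc n)))"
    have pO: "p k \<in> oriented E" for k using ray_oriented[OF p] .
    have s1: "s \<le> 1" using u pO by (simp add: s_def oriented_iff)
    have sw: "edge (prod.swap b) = edge b" for b :: "'v \<times> 'v" by auto
    have "\<exists>c\<in>children (prod.swap (p (Suc n))). percolates u F s c"
      using R rev pO[of "Suc n"] unfolding ray_condition_iff s_def by (metis oriented_swap sw)
    \<comment> \<open>Follows the ray that freezes the reversal back along \<open>p\<close> until it
      turns off. It cannot run through \<open>p 0\<close> backwards: that would force
      \<open>u (edge (p 0)) <= s\<close>, hence equality with \<open>s\<close>, against distinctness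
      of the labels.\<close>
    then have bwd: "\<exists>j\<le>n. \<exists>c\<in>children (p j). percolates u F s c"
    proof -
      have "k \<le> n \<Longrightarrow> \<exists>c\<in>children (prod.swap (p (Suc k))). percolates u F s c \<Longrightarrow>
          \<exists>j\<le>n. \<exists>c\<in>children (p j). percolates u F s c" for k
      proof (induction k)
        case 0
        then obtain d where d: "d \<in> children (prod.swap (p (Suc 0)))" "percolates u F s d" by blast
        have "d \<in> children (p 0)"
        proof (rule ccontr)
          assume "d \<notin> children (p 0)"
          then have "d = prod.swap (p 0)"
            using childrenD[OF d(1)] childrenD[OF ray_children[OF p, of 0]]
            by (auto simp: children_iff prod_eq_iff)
          then have "u (edge (p 0)) \<le> s" using percolates_label[OF d(2)] sw by metis
          then have "u (edge (p 0)) = u (edge (p (Suc n)))"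
            using pS(1)[of n] x_le p0 unfolding s_def by simp
          then have "edge (p 0) = edge (p (Suc n))"
            using inj pO unfolding oriented_iff by (meson inj_onD)
          then show False using ray_edge_ne[OF p, of 0 "Suc n"] by simp
        qed
        then show ?case using d(2) by blast
      next
        case (Suc k)
        then obtain d where d: "d \<in> children (prod.swap (p (Suc (Suc k))))" "percolates u F s d" by blast
        show ?case
        proof (cases "d \<in> children (p (Suc k))")
          case True then show ?thesis using d(2) Suc.prems(1) by blast
        next
          case False
          then have "d = prod.swap (p (Suc k))"
            using childrenD[OF d(1)] childrenD[OF ray_children[OF p, of "Suc k"]]
            by (auto simp: children_iff prod_eq_iff)
          then have "\<exists>c\<in>children (prod.swap (p (Suc k))). percolates u F s c"
            using d(2) percolates_unfold[OF childrenD(1)[OF d(1)], of u F s] by blast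
          then show ?thesis using Suc by simp
        qed
      qed
      then show ?thesis using \<open>\<exists>c\<in>children (prod.swap (p (Suc n))). percolates u F s c\<close> by blast
    qed
    \<comment> \<open>A child percolating at level \<open>s\<close> would freeze \<open>p j\<close>
      if its label were above \<open>s\<close>; as \<open>p j\<close> is unfrozen for
      \<open>j >= 1\<close>, it is open at level \<open>s\<close> and percolation extends back to
      its parent.\<close>
    have fwd: "\<exists>c\<in>children (p j). percolates u F s c \<Longrightarrow> \<exists>c\<in>children (p 0). percolates u F s c" for j
    proof (induction j)
      case (Suc j)
      then obtain d where d: "d \<in> children (p (Suc j))" "percolates u F s d" by blast
      have "u (edge (p (Suc j))) \<le> s"
      proof (rule ccontr)
        assume "\<not> ?thesis"
        then have "percolates u F (u (edge (p (Suc j)))) d" using percolates_mono[OF _ d(2)] by simp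
        then show False using R pO[of "Suc j"] d(1) pS(2)[of j] unfolding ray_condition_iff by blast
      qed
      then have "percolates u F s (p (Suc j))" using percolates_unfold[OF pO] d pS(2) by blast
      then show ?case using Suc.IH ray_children[OF p, of j] by blast
    qed blast
    then have "\<exists>c\<in>children a. percolates u F s c" using bwd p0 by metis
    then have "x \<le> s" using min s1 by blast
    \<comment> \<open>Since \<open>x <= s\<close>, the rest of \<open>p\<close> beyond this edge
      percolates at the level of its label, so the edge itself would be frozen.\<close>
    have "ray E (\<lambda>k. p (k + Suc (Suc n)))" by (rule ray_shift[OF p])
    then have "percolates u F x (p (Suc (Suc n)))"
      unfolding percolates_ray[OF pO] using pS by (intro exI[of _ "\<lambda>k. p (k + Suc (Suc n))"]) simp
    then have "percolates u F s (p (Suc (Suc n)))" using percolates_mono[OF \<open>x \<le> s\<close>] by blast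
    then have "p (Suc n) \<in> F"
      using R pO[of "Suc n"] ray_children[OF p, of "Suc n"] unfolding ray_condition_iff s_def by blast
    then show False using pS(2) by blast
  qed
  have "edge (p n) \<in> D" if n1: "n \<ge> 1" for n
  proof -
    obtain m where m: "n = Suc m" using n1 by (cases n) auto
    have O: "p n \<in> oriented E" using ray_oriented[OF p] .
    have "edge (p n) \<noteq> edge a" using ray_edge_ne[OF p, of 0 n] n1 p0 by simp
    moreover have "edge (p n) \<notin> edge ` {b \<in> oriented E. b \<in> F}"
    proof
      assume "edge (p n) \<in> edge ` {b \<in> oriented E. b \<in> F}"
      then obtain b where "b \<in> F" "edge (p n) = edge b" by auto
      then have "b = p n \<or> b = prod.swap (p n)" by (auto simp: doubleton_eq_iff prod_eq_iff)
      then show False using \<open>b \<in> F\<close> notF[of m] pS(2)[of m] m by blast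
    qed
    moreover have "edge (p n) \<in> E" "u (edge (p n)) \<le> u (edge a)"
      using O pS(1)[of m] x_le m by (auto simp: oriented_iff)
    ultimately show ?thesis by (simp add: D_def edges_upto_def)
  qed
  then show "\<exists>p. ray E p \<and> p 0 = a \<and> (\<forall>n\<ge>1. edge (p n) \<in> D)" using p p0 by blast
qed

lemma ray_condition_freezing_rule:
  assumes R: "ray_condition E u F" and u: "\<And>e. e \<in> E \<Longrightarrow> u e \<in> {0..1}" and inj: "inj_on u E"
  shows "freezing_rule T E u (edge ` {b \<in> oriented E. b \<in> F})" (is "freezing_rule T E u ?F")
  unfolding freezing_rule_def
proof
  fix e assume "e \<in> E"
  then obtain a where a: "a \<in> oriented E" "e = edge a" by (rule edge_cases)
  define D where "D = edges_upto E u (u e) - (?F \<union> {e})"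
  have D: "D \<subseteq> E" "e \<notin> D" by (auto simp: D_def edges_upto_def)
  have end_a: "b \<in> F \<longleftrightarrow> (\<exists>C\<in>clusters T D. infinite C \<and> snd b \<in> C)" if "b \<in> oriented E" "edge b = e" for b
  proof -
    have "b \<in> F \<longleftrightarrow> (\<exists>p. ray E p \<and> p 0 = b \<and> (\<forall>n\<ge>1. edge (p n) \<in> D))"
      using frozen_iff_unfrozen_ray[OF R u inj that(1)] unfolding D_def that(2) .
    also have "\<dots> \<longleftrightarrow> (\<exists>C\<in>clusters T D. infinite C \<and> snd b \<in> C)"
      using infinite_cluster_iff_ray[OF that(1) D(1)] D(2) that(2) by simp
    finally show ?thesis .
  qed
  have sw: "prod.swap a \<in> oriented E" "edge (prod.swap a) = e" using a oriented_swap by auto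
  have "e \<in> ?F \<longleftrightarrow> a \<in> F \<or> prod.swap a \<in> F"
  proof
    assume "e \<in> ?F"
    then obtain b where "b \<in> F" "edge a = edge b" unfolding a(2) by auto
    then have "b = a \<or> b = prod.swap a" by (auto simp: doubleton_eq_iff prod_eq_iff)
    then show "a \<in> F \<or> prod.swap a \<in> F" using \<open>b \<in> F\<close> by blast
  next
    assume "a \<in> F \<or> prod.swap a \<in> F"
    then show "e \<in> ?F"
    proof
      assume "a \<in> F" then show ?thesis unfolding a(2) using a(1) by (intro imageI) simp
    next
      assume "prod.swap a \<in> F" then show ?thesis using sw by (intro image_eqI[of _ _ "prod.swap a"]) simp_all
    qed
  qed
  also have "\<dots> \<longleftrightarrow> (\<exists>v\<in>e. \<exists>C\<in>clusters T D. infinite C \<and> v \<in> C)"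
    using end_a[OF a(1) a(2)[symmetric]] end_a[OF sw] a(2) by auto
  finally show "e \<notin> ?F \<longleftrightarrow> \<not> (\<exists>v\<in>e. \<exists>C\<in>clusters T (edges_upto E u (u e) - (?F \<union> {e})). infinite C \<and> v \<in> C)"
    unfolding D_def by blast
qed

end

section \<open>Extinction of the branching process\<close>

lemma (in cubic_tree) late_open_antimono:
  assumes R: "\<And>b. b \<in> oriented E \<Longrightarrow> recursion_at u x b" and "a \<in> oriented E" "m \<le> n" "late_open u x t n a"
  shows "late_open u x t m a"
  unfolding late_open_def
proof (rule reach_antimono[OF _ assms(2,3)])
  show "t < x b" if "b \<in> oriented E"
    "reach (\<lambda>b. t < x b) (\<lambda>b. u (edge b) \<le> t \<and> (\<forall>c\<in>children b. t < x c)) 1 b" for b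
    using late_open_Suc_0[OF that(1) R[OF that(1)]] that(2) unfolding late_open_def One_nat_def .
qed (use assms(4) in \<open>simp add: late_open_def\<close>)

text \<open>\<open>B a\<close> stands for the information in the branch of \<open>a\<close>. For a
  given coupling \<open>S\<close> is unknown and the process yields the bound on it; for the limit
  law \<open>S\<close> is \<open>tail\<close> and the process yields extinction.\<close>

locale branch_process = cubic_tree T E + prob_space M
  for T :: "'v set" and E and M :: "'m measure" +
  fixes U :: "'v set \<Rightarrow> 'm \<Rightarrow> real" and X :: "'v \<times> 'v \<Rightarrow> 'm \<Rightarrow> real"
    and B :: "'v \<times> 'v \<Rightarrow> 'm set set" and S :: "real \<Rightarrow> real"
  assumes B_algebra: "a \<in> oriented E \<Longrightarrow> sigma_algebra (space M) (B a)"
    and B_events: "a \<in> oriented E \<Longrightarrow> B a \<subseteq> events"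
    and B_child: "a \<in> oriented E \<Longrightarrow> c \<in> children a \<Longrightarrow> B c \<subseteq> B a"
    and X_B: "a \<in> oriented E \<Longrightarrow> {\<omega> \<in> space M. t < X a \<omega>} \<in> B a"
    and U_B: "a \<in> oriented E \<Longrightarrow> {\<omega> \<in> space M. U (edge a) \<omega> \<le> t} \<in> B a"
    and recursion: "a \<in> oriented E \<Longrightarrow> AE \<omega> in M. recursion_at (\<lambda>e. U e \<omega>) (\<lambda>b. X b \<omega>) a"
    and indep: "a \<in> oriented E \<Longrightarrow> children a = {c, d} \<Longrightarrow> c \<noteq> d \<Longrightarrow> C \<in> B c \<Longrightarrow> D \<in> B d \<Longrightarrow>
       0 \<le> t \<Longrightarrow> t \<le> 1 \<Longrightarrow> prob ({\<omega> \<in> space M. U (edge a) \<omega> \<le> t} \<inter> C \<inter> D) = t * prob C * prob D"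
    and S: "a \<in> oriented E \<Longrightarrow> 0 \<le> t \<Longrightarrow> t \<le> 1 \<Longrightarrow> prob {\<omega> \<in> space M. t < X a \<omega>} = S t"
begin

abbreviation late :: "real \<Rightarrow> nat \<Rightarrow> 'v \<times> 'v \<Rightarrow> 'm set" where
  "late t n a \<equiv> {\<omega> \<in> space M. late_open (\<lambda>e. U e \<omega>) (\<lambda>b. X b \<omega>) t n a}"

abbreviation frozen :: "'m \<Rightarrow> ('v \<times> 'v) set" where
  "frozen \<omega> \<equiv> frozen_edges (\<lambda>e. U e \<omega>) (\<lambda>b. X b \<omega>)"

lemma late_0: "late t 0 a = {\<omega> \<in> space M. t < X a \<omega>}"
  by (simp add: late_open_def)

lemma late_Suc:
  assumes "children a = {c, d}"
  shows "late t (Suc n) a = {\<omega> \<in> space M. U (edge a) \<omega> \<le> t} \<inter>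
    ((late t 0 c \<inter> late t 0 d) \<inter> (late t n c \<union> late t n d))"
  by (auto simp: late_open_def assms)

lemma late_B: "a \<in> oriented E \<Longrightarrow> late t n a \<in> B a"
proof (induction n arbitrary: a)
  case 0 then show ?case unfolding late_0 by (rule X_B)
next
  case (Suc n)
  obtain c d where cd: "children a = {c, d}" "c \<noteq> d" using children_pair[OF Suc.prems] .
  then have O: "c \<in> oriented E" "d \<in> oriented E" using childrenD(1)[of c a] childrenD(1)[of d a] by auto
  interpret A: sigma_algebra "space M" "B a" by (rule B_algebra[OF Suc.prems])
  have sub: "B c \<subseteq> B a" "B d \<subseteq> B a" using B_child[OF Suc.prems] cd by auto
  have "late t 0 c \<in> B a" "late t 0 d \<in> B a" "late t n c \<in> B a" "late t n d \<in> B a"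
    using sub Suc.IH[OF O(1)] Suc.IH[OF O(2)] X_B[OF O(1)] X_B[OF O(2)] unfolding late_0 by blast+
  then show ?case unfolding late_Suc[OF cd(1)] by (intro A.Int A.Un U_B Suc.prems)
qed

lemma late_events: "a \<in> oriented E \<Longrightarrow> late t n a \<in> events"
  using late_B B_events by blast

lemma recursion_all: "AE \<omega> in M. \<forall>a\<in>oriented E. recursion_at (\<lambda>e. U e \<omega>) (\<lambda>b. X b \<omega>) a"
  using recursion countable_oriented by (subst AE_ball_countable) auto

lemma late_antimono:
  assumes "a \<in> oriented E" "m \<le> n"
  shows "AE \<omega> in M. \<omega> \<in> late t n a \<longrightarrow> \<omega> \<in> late t m a"
  using recursion_all
proof eventually_elim
  case (elim \<omega>)
  then show ?case using late_open_antimono[of "\<lambda>e. U e \<omega>" "\<lambda>b. X b \<omega>" a m n t] assms by blast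
qed

text \<open>Given that the edge is open and both children are late, survival to the next generation
  fails only if both subtrees have died, and these two events are independent.\<close>

lemma late_prob:
  assumes "a \<in> oriented E" "0 \<le> t" "t \<le> 1" shows "prob (late t n a) = survival (S t) t n"
  using assms(1)
proof (induction n arbitrary: a)
  case 0 then show ?case unfolding late_0 using S assms by simp
next
  case (Suc n)
  obtain c d where cd: "children a = {c, d}" "c \<noteq> d" using children_pair[OF Suc.prems] .
  then have O: "c \<in> oriented E" "d \<in> oriented E" using childrenD(1)[of c a] childrenD(1)[of d a] by auto
  note ind = indep[OF Suc.prems cd _ _ assms(2,3)]
  let ?A = "{\<omega> \<in> space M. U (edge a) \<omega> \<le> t}"
  have A: "?A \<in> events" using U_B[OF Suc.prems] B_events[OF Suc.prems] by blast
  have diff: "prob (late t 0 b - late t n b) = S t - survival (S t) t n" "late t 0 b - late t n b \<in> B b"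
    if b: "b \<in> oriented E" for b
  proof -
    interpret A: sigma_algebra "space M" "B b" by (rule B_algebra[OF b])
    show "late t 0 b - late t n b \<in> B b" using late_B[OF b] by (intro A.Diff)
    have "prob (late t 0 b \<inter> late t n b) = prob (late t n b)"
      by (rule finite_measure_eq_AE)
        (use late_antimono[OF b, of 0 n t] late_events[OF b] in \<open>auto elim!: eventually_mono\<close>)
    then show "prob (late t 0 b - late t n b) = S t - survival (S t) t n"
      using finite_measure_Diff'[OF late_events[OF b] late_events[OF b], of t 0 t n] Suc.IH[OF b]
        S[OF b assms(2,3)] unfolding late_0 by simp
  qed
  have L0: "prob (late t 0 b) = S t" if "b \<in> oriented E" for b
    unfolding late_0 using S[OF that assms(2,3)] .
  \<comment> \<open>\<open>?K\<close>: open with both children late. \<open>?L\<close>: in addition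
    both explorations stop before generation \<open>n\<close>.\<close>
  let ?K = "?A \<inter> late t 0 c \<inter> late t 0 d" and ?L = "?A \<inter> (late t 0 c - late t n c) \<inter> (late t 0 d - late t n d)"
  note ev = late_events[OF O(1)] late_events[OF O(2)]
  have "?K \<in> events" "?L \<in> events" by (intro sets.Int sets.Diff A ev)+
  moreover have "?L \<subseteq> ?K" by blast
  ultimately have KL: "prob (?K - ?L) = prob ?K - prob ?L" by (rule finite_measure_Diff)
  have set_eq: "P \<inter> ((Q \<inter> R) \<inter> (V \<union> W)) = P \<inter> Q \<inter> R - P \<inter> (Q - V) \<inter> (R - W)" for P Q R V W :: "'m set"
    by blast
  have "prob (late t (Suc n) a) = prob ?K - prob ?L"
    unfolding late_Suc[OF cd(1)] set_eq by (rule KL)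
  also have "\<dots> = t * S t * S t - t * (S t - survival (S t) t n) * (S t - survival (S t) t n)"
    using ind[OF late_B[OF O(1)] late_B[OF O(2)], of t 0 t 0] ind[OF diff(2)[OF O(1)] diff(2)[OF O(2)]]
      L0[OF O(1)] L0[OF O(2)] diff(1)[OF O(1)] diff(1)[OF O(2)] by simp
  finally show ?case by (simp add: power2_eq_square algebra_simps)
qed

lemma S_bounds: assumes "a \<in> oriented E" "0 \<le> t" "t \<le> 1" shows "0 \<le> S t" "S t \<le> 1"
  unfolding S[OF assms, symmetric] by simp_all

text \<open>Late percolation is contained in survival to all generations, whose probability tends to
  0 by \<open>survival_subcritical\<close>.\<close>

lemma no_late_percolation:
  assumes a: "a \<in> oriented E" and t: "0 \<le> t" "t \<le> 1" "2 * t * S t \<le> 1"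
  shows "AE \<omega> in M. t < X a \<omega> \<longrightarrow> \<not> percolates (\<lambda>e. U e \<omega>) (frozen \<omega>) t a"
proof -
  let ?N = "\<Inter>n. late t n a"
  have N: "?N \<in> events" using late_events[OF a] by blast
  have "prob ?N \<le> survival (S t) t n" for n
    unfolding late_prob[OF a t(1,2), symmetric] by (rule finite_measure_mono[OF _ late_events[OF a]]) blast
  moreover have "survival (S t) t \<longlonglongrightarrow> 0"
    using survival_subcritical S_bounds[OF a t(1,2)] t by blast
  ultimately have "prob ?N \<le> 0" using LIMSEQ_le_const by blast
  then have "prob ?N = 0" by (simp only: measure_le_0_iff)
  then have "AE \<omega> in M. \<omega> \<notin> ?N" using prob_eq_0[OF N] by (rule iffD1[rotated])
  then show ?thesis
    using recursion_all AE_space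
  proof eventually_elim
    case (elim \<omega>)
    show ?case
    proof (intro impI notI)
      assume "t < X a \<omega>" "percolates (\<lambda>e. U e \<omega>) (frozen \<omega>) t a"
      then have "late_open (\<lambda>e. U e \<omega>) (\<lambda>b. X b \<omega>) t n a" for n
        using elim(2) by (intro percolates_late_open a) auto
      then show False using elim(1,3) by simp
    qed
  qed
qed

text \<open>Otherwise the exploration survives with probability at least
  \<open>2 * S t - 1 / t > 0\<close>, and then percolation at level \<open>t\<close> coexists with a
  time later than \<open>t\<close>.\<close>

lemma not_supercritical:
  assumes a: "a \<in> oriented E" and t: "0 \<le> t" "t \<le> 1"
    and no: "AE \<omega> in M. t < X a \<omega> \<longrightarrow> \<not> percolates (\<lambda>e. U e \<omega>) (frozen \<omega>) t a"
  shows "2 * t * S t \<le> 1"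
proof (rule ccontr)
  assume "\<not> ?thesis"
  then have sup: "1 < 2 * t * S t" by simp
  then have "t \<noteq> 0" by auto
  then have t0: "0 < t" using t by simp
  define q where "q = 2 * S t - 1 / t"
  have "0 < q" unfolding q_def using sup t0 by (simp add: field_simps)
  \<comment> \<open>The sets \<open>late t n a\<close> decrease only up to null sets; their finite
    intersections decrease everywhere.\<close>
  let ?A = "\<lambda>n. \<Inter>m\<in>{..n}. late t m a"
  have A: "?A n \<in> events" for n using late_events[OF a] by (intro sets.finite_INT) auto
  have "q \<le> prob (?A n)" for n
  proof -
    have "AE \<omega> in M. \<forall>m\<in>{..n}. \<omega> \<in> late t n a \<longrightarrow> \<omega> \<in> late t m a"
      using late_antimono[OF a] by (subst AE_ball_countable) auto
    then have "AE \<omega> in M. \<omega> \<in> late t n a \<longleftrightarrow> \<omega> \<in> ?A n" by eventually_elim auto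
    then have "prob (late t n a) = prob (?A n)" by (rule finite_measure_eq_AE[OF _ late_events[OF a] A])
    then show ?thesis
      using late_prob[OF a t, of n] survival_supercritical[of "S t" t n] S_bounds[OF a t] t t0 q_def by simp
  qed
  moreover have "(\<lambda>n. prob (?A n)) \<longlonglongrightarrow> prob (\<Inter>n. ?A n)"
    by (rule finite_Lim_measure_decseq) (use A in \<open>auto simp: decseq_def\<close>)
  ultimately have le: "q \<le> prob (\<Inter>n. ?A n)" using LIMSEQ_le_const by blast
  have "AE \<omega> in M. \<omega> \<notin> (\<Inter>n. ?A n)"
    using no recursion_all AE_space
  proof eventually_elim
    case (elim \<omega>)
    show ?case
    proof
      assume "\<omega> \<in> (\<Inter>n. ?A n)"
      then have l: "late_open (\<lambda>e. U e \<omega>) (\<lambda>b. X b \<omega>) t n a" for n by auto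
      then have "percolates (\<lambda>e. U e \<omega>) (frozen \<omega>) t a"
        using elim(2) by (intro late_open_percolates a) auto
      moreover have "t < X a \<omega>" using l[of 0] by (simp add: late_open_def)
      ultimately show False using elim by blast
    qed
  qed
  moreover have "(\<Inter>n. ?A n) \<in> events" using A by blast
  ultimately have "prob (\<Inter>n. ?A n) = 0" by (simp only: prob_eq_0)
  with le show False using \<open>0 < q\<close> by linarith
qed

lemma U_measurable: "a \<in> oriented E \<Longrightarrow> U (edge a) \<in> borel_measurable M"
  using U_B B_events by (intro borel_measurableI_le) blast

lemma X_measurable: "a \<in> oriented E \<Longrightarrow> X a \<in> borel_measurable M"
  using X_B B_events by (intro borel_measurableI_greater) blast

text \<open>The law of a label is hidden in \<open>indep\<close>, from which it is recovered with
  trivial events for the children.\<close>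

lemma U_pos: assumes "a \<in> oriented E" shows "AE \<omega> in M. 0 < U (edge a) \<omega>"
proof -
  obtain c d where cd: "children a = {c, d}" "c \<noteq> d" using children_pair[OF assms] .
  then have O: "c \<in> oriented E" "d \<in> oriented E" using childrenD(1)[of c a] childrenD(1)[of d a] by auto
  have "space M \<in> B b" if "b \<in> oriented E" for b
    using sigma_algebra.axioms(1)[OF B_algebra[OF that]] by (rule algebra.top)
  then have "prob ({\<omega> \<in> space M. U (edge a) \<omega> \<le> 0} \<inter> space M \<inter> space M) = 0 * prob (space M) * prob (space M)"
    using O by (intro indep[OF assms cd]) auto
  moreover have "{\<omega> \<in> space M. U (edge a) \<omega> \<le> 0} \<inter> space M \<inter> space M = {\<omega> \<in> space M. U (edge a) \<omega> \<le> 0}" by auto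
  ultimately have "prob {\<omega> \<in> space M. U (edge a) \<omega> \<le> 0} = 0" by simp
  then have "AE \<omega> in M. \<not> U (edge a) \<omega> \<le> 0"
    using U_measurable[OF assms] by (subst (asm) prob_Collect_eq_0) auto
  then show ?thesis by eventually_elim simp
qed

lemma joint_prob:
  assumes "a \<in> oriented E" "children a = {c, d}" "c \<noteq> d" "0 \<le> r" "r \<le> 1" "0 \<le> x" "x \<le> 1"
  shows "prob {\<omega> \<in> space M. U (edge a) \<omega> \<le> r \<and> x < X c \<omega> \<and> x < X d \<omega>} = r * (S x)\<^sup>2"
proof -
  have O: "c \<in> oriented E" "d \<in> oriented E" using childrenD(1)[of c a] childrenD(1)[of d a] assms(2) by auto
  have "{\<omega> \<in> space M. U (edge a) \<omega> \<le> r \<and> x < X c \<omega> \<and> x < X d \<omega>} =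
     {\<omega> \<in> space M. U (edge a) \<omega> \<le> r} \<inter> {\<omega> \<in> space M. x < X c \<omega>} \<inter> {\<omega> \<in> space M. x < X d \<omega>}" by auto
  then show ?thesis
    using indep[OF assms(1-3) X_B[OF O(1)] X_B[OF O(2)] assms(4,5), of x x]
      S[OF O(1) assms(6,7)] S[OF O(2) assms(6,7)] by (simp add: power2_eq_square)
qed

lemma S_eq_tail:
  assumes a: "a \<in> oriented E"
    and no: "\<And>t. 0 \<le> t \<Longrightarrow> t \<le> 1 \<Longrightarrow>
       AE \<omega> in M. t < X a \<omega> \<longrightarrow> \<not> percolates (\<lambda>e. U e \<omega>) (frozen \<omega>) t a"
    and t: "0 \<le> t" "t \<le> 1"
  shows "S t = tail t"
proof -
  \<comment> \<open>\<open>R\<close> agrees with \<open>S\<close> on the unit interval but is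
    defined on the whole line, so that right continuity can be taken from a distribution
    function.\<close>
  define R where "R t = prob {\<omega> \<in> space M. t < X a \<omega>}" for t
  have RS: "R t = S t" if "0 \<le> t" "t \<le> 1" for t using S[OF a that] by (simp add: R_def)
  note [measurable] = X_measurable[OF a] U_measurable[OF a]
  obtain c d where cd: "children a = {c, d}" "c \<noteq> d" using children_pair[OF a] .
  then have "c \<in> oriented E" "d \<in> oriented E" using childrenD(1)[of c a] childrenD(1)[of d a] by auto
  note [measurable] = X_measurable[OF this(1)] X_measurable[OF this(2)]
  let ?W = "\<lambda>\<omega>. freeze (U (edge a) \<omega>) (min (X c \<omega>) (X d \<omega>))"
  have [measurable]: "?W \<in> borel_measurable M" unfolding freeze_def by measurable
  have XW: "AE \<omega> in M. X a \<omega> = ?W \<omega>"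
    using recursion[OF a] by eventually_elim (simp add: recursion_at_def cd(1))
  have "R t = tail t"
  proof (rule tail_unique[OF _ _ _ _ _ t])
    fix s t :: real assume st: "0 \<le> s" "s \<le> t" "t \<le> 1"
    show "R t \<le> R s" unfolding R_def by (rule finite_measure_mono) (use st in auto)
    have "R s - R t = prob ({\<omega> \<in> space M. s < X a \<omega>} - {\<omega> \<in> space M. t < X a \<omega>})"
      unfolding R_def by (rule finite_measure_Diff[symmetric]) (use st in auto)
    also have "\<dots> = prob {\<omega> \<in> space M. s < ?W \<omega> \<and> ?W \<omega> \<le> t}"
    proof (rule finite_measure_eq_AE)
      show "AE \<omega> in M. \<omega> \<in> {\<omega> \<in> space M. s < X a \<omega>} - {\<omega> \<in> space M. t < X a \<omega>} \<longleftrightarrow>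
        \<omega> \<in> {\<omega> \<in> space M. s < ?W \<omega> \<and> ?W \<omega> \<le> t}" using XW by eventually_elim auto
    qed measurable
    also have "\<dots> \<le> t * ((S s)\<^sup>2 - (S t)\<^sup>2)"
      by (rule freeze_window(2)) (use st joint_prob[OF a cd] in measurable)
    finally show "R s - R t \<le> t * ((R s)\<^sup>2 - (R t)\<^sup>2)" using RS st by simp
  next
    fix t :: real assume "0 \<le> t" "t \<le> 1"
    then show "2 * t * R t \<le> 1" using not_supercritical[OF a _ _ no] RS by simp
  next
    fix t :: real
    interpret D: real_distribution "distr M borel (X a)" by (rule real_distribution_distr) measurable
    have "R t = 1 - cdf (distr M borel (X a)) t" for t
    proof -
      have "R t = measure (distr M borel (X a)) {t<..}"
        unfolding R_def by (subst measure_distr) (auto intro!: arg_cong[where f = prob])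
      also have "\<dots> = 1 - measure (distr M borel (X a)) {..t}"
        using D.prob_compl[of "{..t}"] by (simp add: Compl_eq_Diff_UNIV[symmetric])
      finally show ?thesis by (simp add: cdf_def)
    qed
    then have "R = (\<lambda>t. 1 - cdf (distr M borel (X a)) t)" by auto
    then show "continuous (at_right t) R"
      using D.cdf_is_right_cont[of t] by (auto intro!: continuous_intros)
  next
    have "AE \<omega> in M. 0 < X a \<omega>"
      using U_pos[OF a] XW by eventually_elim (auto simp: freeze_def)
    then show "R 0 = 1" unfolding R_def by (subst prob_Collect_eq_1) auto
  qed
  then show ?thesis using RS t by simp
qed

end

section \<open>The limit law of labels and times\<close>

text \<open>A configuration assigns a label to every edge (\<open>Inl\<close>) and a percolation time to every oriented
  edge (\<open>Inr\<close>).\<close>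

definition coord_law :: "'v set + 'v \<times> 'v \<Rightarrow> real measure" where
  "coord_law i = (case i of Inl _ \<Rightarrow> uniform_01 | Inr _ \<Rightarrow> time_law)"

lemma coord_law_simps [simp]: "coord_law (Inl e) = uniform_01" "coord_law (Inr a) = time_law"
  by (simp_all add: coord_law_def)

lemma sets_coord_law [simp, measurable_cong]: "sets (coord_law i) = sets borel"
  by (cases i) auto

lemma space_coord_law [simp]: "space (coord_law i) = UNIV"
  using sets_eq_imp_space_eq[OF sets_coord_law] by simp

lemma prob_space_coord_law: "prob_space (coord_law i)"
  by (cases i) (auto simp: prob_space_uniform_01 prob_space_time_law)

definition product_law :: "('v set + 'v \<times> 'v) set \<Rightarrow> ('v set + 'v \<times> 'v \<Rightarrow> real) measure" where
  "product_law I = PiM I coord_law"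

lemma sets_product_law [simp, measurable_cong]: "sets (product_law I) = sets (PiM I (\<lambda>_. borel))"
  unfolding product_law_def by (rule sets_PiM_cong) auto

lemma prob_space_product_law: "prob_space (product_law I)"
  unfolding product_law_def by (rule prob_space_PiM) (rule prob_space_coord_law)

definition independent_coords :: "'m measure \<Rightarrow> ('v set + 'v \<times> 'v \<Rightarrow> 'm \<Rightarrow> real) \<Rightarrow> ('v set + 'v \<times> 'v) set \<Rightarrow> bool" where
  "independent_coords M Z I \<longleftrightarrow> prob_space M \<and> prob_space.indep_vars M (\<lambda>_. borel) Z I \<and>
     (\<forall>i\<in>I. distr M borel (Z i) = coord_law i)"

lemma independent_coords_measurable:
  assumes "independent_coords M Z I" "i \<in> I" shows "Z i \<in> borel_measurable M"
proof -
  interpret prob_space M using assms(1) by (simp add: independent_coords_def)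
  have "indep_vars (\<lambda>_. borel) Z I" using assms(1) by (simp add: independent_coords_def)
  then show ?thesis using assms(2) unfolding indep_vars_def by blast
qed

lemma independent_coords_iff:
  assumes "prob_space M" "I \<noteq> {}" "\<And>i. i \<in> I \<Longrightarrow> Z i \<in> borel_measurable M"
  shows "independent_coords M Z I \<longleftrightarrow>
     distr M (PiM I (\<lambda>_. borel)) (\<lambda>\<omega>. \<lambda>i\<in>I. Z i \<omega>) = product_law I"
proof -
  interpret prob_space M by fact
  have *: "indep_vars (\<lambda>_. borel) Z I \<longleftrightarrow>
      distr M (PiM I (\<lambda>_. borel)) (\<lambda>\<omega>. \<lambda>i\<in>I. Z i \<omega>) = PiM I (\<lambda>i. distr M borel (Z i))"
    using assms by (intro indep_vars_iff_distr_eq_PiM')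
  have [measurable]: "(\<lambda>\<omega>. \<lambda>i\<in>I. Z i \<omega>) \<in> measurable M (PiM I (\<lambda>_. borel))"
    using assms by measurable
  show ?thesis
  proof
    assume "independent_coords M Z I"
    moreover then have "PiM I (\<lambda>i. distr M borel (Z i)) = product_law I"
      unfolding product_law_def independent_coords_def by (intro PiM_cong) auto
    ultimately show "distr M (PiM I (\<lambda>_. borel)) (\<lambda>\<omega>. \<lambda>i\<in>I. Z i \<omega>) = product_law I"
      using * by (simp add: independent_coords_def)
  next
    assume D: "distr M (PiM I (\<lambda>_. borel)) (\<lambda>\<omega>. \<lambda>i\<in>I. Z i \<omega>) = product_law I"
    have m: "distr M borel (Z i) = coord_law i" if i: "i \<in> I" for i
    proof -
      have "distr (distr M (PiM I (\<lambda>_. borel)) (\<lambda>\<omega>. \<lambda>i\<in>I. Z i \<omega>)) borel (\<lambda>z. z i) = distr M borel (Z i)"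
        using i by (subst distr_distr) (auto simp: comp_def)
      moreover have "distr (product_law I) borel (\<lambda>z. z i) = coord_law i"
      proof -
        have "distr (product_law I) borel (\<lambda>z. z i) = distr (PiM I coord_law) (coord_law i) (\<lambda>z. z i)"
          unfolding product_law_def by (rule distr_cong) auto
        then show ?thesis using distr_PiM_component[OF prob_space_coord_law i] by simp
      qed
      ultimately show ?thesis using D by simp
    qed
    then have "PiM I (\<lambda>i. distr M borel (Z i)) = product_law I"
      unfolding product_law_def by (intro PiM_cong) auto
    then show "independent_coords M Z I" using D * m assms(1) by (simp add: independent_coords_def)
  qed
qed

lemma product_law_coords:
  assumes "I \<noteq> {}" shows "independent_coords (product_law I) (\<lambda>i z. z i) I"
proof (subst independent_coords_iff)
  have "distr (product_law I) (PiM I (\<lambda>_. borel)) (\<lambda>z. \<lambda>i\<in>I. z i) = distr (product_law I) (product_law I) (\<lambda>z. z)"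
  proof (rule distr_cong)
    fix z assume "z \<in> space (product_law I)"
    then show "(\<lambda>i\<in>I. z i) = z" by (auto simp: product_law_def space_PiM PiE_def extensional_restrict)
  qed simp_all
  then show "distr (product_law I) (PiM I (\<lambda>_. borel)) (\<lambda>z. \<lambda>i\<in>I. z i) = product_law I" by (simp add: distr_id2)
qed (use assms prob_space_product_law in auto)

lemma (in prob_space) indep_vars_group:
  assumes "indep_vars M' Z I" "\<And>j. j \<in> J \<Longrightarrow> L j \<subseteq> I" "disjoint_family_on L J"
    and "\<And>j. j \<in> J \<Longrightarrow> h j \<in> measurable (PiM (L j) M') (N j)"
    and eq: "\<And>j. j \<in> J \<Longrightarrow> Y j = (\<lambda>\<omega>. h j (\<lambda>i\<in>L j. Z i \<omega>))"
  shows "indep_vars N Y J"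
proof -
  have "indep_vars N (\<lambda>j \<omega>. h j (\<lambda>i\<in>L j. Z i \<omega>)) J"
    by (rule indep_vars_compose2[OF indep_vars_restrict[OF assms(1-3)] assms(4)])
  moreover have "indep_vars N Y J = indep_vars N (\<lambda>j \<omega>. h j (\<lambda>i\<in>L j. Z i \<omega>)) J"
    by (rule indep_vars_cong[OF refl eq refl])
  ultimately show ?thesis by (rule iffD2[rotated])
qed

context cubic_tree
begin

text \<open>The free coordinates of a finite subtree: they are to be independent, and the recursion
  computes the remaining \<open>inner_coords\<close> from them.\<close>

definition coords :: "'v set \<Rightarrow> ('v set + 'v \<times> 'v) set" where
  "coords S = Inl ` induced_edges E S \<union> Inr ` boundary T E S"

definition inner_coords :: "'v set \<Rightarrow> ('v set + 'v \<times> 'v) set" where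
  "inner_coords S = Inl ` induced_edges E S \<union> Inr ` (oriented (induced_edges E S) \<union> boundary T E S)"

definition all_coords :: "('v set + 'v \<times> 'v) set" where
  "all_coords = Inl ` E \<union> Inr ` oriented E"

lemma coords_simps [simp]:
  "Inl e \<in> coords S \<longleftrightarrow> e \<in> induced_edges E S" "Inr a \<in> coords S \<longleftrightarrow> a \<in> boundary T E S"
  "Inl e \<in> inner_coords S \<longleftrightarrow> e \<in> induced_edges E S"
  "Inr a \<in> inner_coords S \<longleftrightarrow> a \<in> oriented (induced_edges E S) \<or> a \<in> boundary T E S"
  "Inl e \<in> all_coords \<longleftrightarrow> e \<in> E" "Inr a \<in> all_coords \<longleftrightarrow> a \<in> oriented E"
  by (auto simp: coords_def inner_coords_def all_coords_def)

lemma coords_subset: "coords S \<subseteq> inner_coords S" "inner_coords S \<subseteq> all_coords"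
  by (auto simp: coords_def inner_coords_def all_coords_def induced_edges_def boundary_def oriented_def)

lemma boundary_nonempty:
  assumes "finite_subtree T E S" shows "boundary T E S \<noteq> {}"
  using assms
proof (induction S rule: subtree_induct)
  case (singleton v)
  then have "{x. {v, x} \<in> E} \<noteq> {}" using neighbours_card by force
  then show ?case by (auto simp: boundary_singleton oriented_iff)
next
  case (insert R a)
  then have "children a \<noteq> {}" by (intro children_nonempty) (simp add: boundary_iff)
  then show ?case using subtree_insert(4)[OF insert(1,2)] by auto
qed

lemma coords_nonempty: "finite_subtree T E S \<Longrightarrow> coords S \<noteq> {}"
  using boundary_nonempty by (auto simp: coords_def)

lemma finite_coords: "finite_subtree T E S \<Longrightarrow> finite (coords S)"
  by (auto simp: coords_def finite_subtree_iff finite_induced_edges finite_boundary)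

definition extension_rel :: "'v set \<Rightarrow> (('v \<times> 'v) \<times> ('v \<times> 'v)) set" where
  "extension_rel S = {(c, b). b \<in> oriented (induced_edges E S) \<and> c \<in> children b}"

text \<open>Solves the recursion from the boundary inwards. On the whole tree it has no such
  solution by well-founded recursion, as rays never end.\<close>

definition extend :: "'v set \<Rightarrow> ('v set + 'v \<times> 'v \<Rightarrow> real) \<Rightarrow> 'v \<times> 'v \<Rightarrow> real" where
  "extend S z = wfrec (extension_rel S)
     (\<lambda>f b. if b \<in> oriented (induced_edges E S) then freeze (z (Inl (edge b))) (Min (f ` children b)) else z (Inr b))"

lemma wf_extension_rel: assumes "finite S" shows "wf (extension_rel S)"
proof -
  let ?D = "oriented (induced_edges E S)"
  have "finite ?D"
    by (rule finite_subset[of _ "S \<times> S"]) (use assms in \<open>auto simp: oriented_induced_iff\<close>)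
  moreover have "extension_rel S \<subseteq> (\<Union>b\<in>?D. children b \<times> {b})" by (auto simp: extension_rel_def)
  ultimately have "finite (extension_rel S)" by (rule_tac finite_subset) auto
  moreover have "(extension_rel S)\<inverse> \<subseteq> child_rel"
    by (auto simp: extension_rel_def child_rel_def oriented_induced_iff)
  then have "acyclic ((extension_rel S)\<inverse>)" by (rule acyclic_subset[OF child_rel_acyclic])
  then have "acyclic (extension_rel S)" by (simp only: acyclic_converse)
  ultimately show ?thesis by (rule finite_acyclic_wf)
qed

lemma extend_unfold:
  assumes "finite S"
  shows "extend S z b = (if b \<in> oriented (induced_edges E S)
    then freeze (z (Inl (edge b))) (Min (extend S z ` children b)) else z (Inr b))"
proof -
  have "cut f (extension_rel S) b ` children b = f ` children b"
    if "b \<in> oriented (induced_edges E S)" for f :: "'v \<times> 'v \<Rightarrow> real"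
    using that by (auto simp: cut_def extension_rel_def intro!: image_cong)
  then show ?thesis unfolding extend_def by (subst wfrec[OF wf_extension_rel[OF assms]]) auto
qed

lemma boundary_not_induced: "b \<in> boundary T E S \<Longrightarrow> b \<notin> oriented (induced_edges E S)"
  by (auto simp: boundary_iff oriented_induced_iff)

lemma extend_unique:
  assumes "finite S" and out: "\<And>b. b \<in> boundary T E S \<Longrightarrow> x b = z (Inr b)"
    and rec: "\<And>b. b \<in> oriented (induced_edges E S) \<Longrightarrow> x b = freeze (z (Inl (edge b))) (Min (x ` children b))"
    and b: "b \<in> oriented (induced_edges E S) \<or> b \<in> boundary T E S"
  shows "x b = extend S z b"
proof -
  have o: "x b = extend S z b" if "b \<in> boundary T E S" for b
    using extend_unfold[OF assms(1), of z b] out[OF that] boundary_not_induced[OF that] by simp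
  have "x b = extend S z b" if "b \<in> oriented (induced_edges E S)" for b
    using assms(1) that
  proof (induction b rule: induced_induct)
    case (less b)
    have "x c = extend S z c" if "c \<in> children b" for c
      using less.IH[OF that] o children_induced[OF less.hyps] that by blast
    then have "x ` children b = extend S z ` children b" by (rule image_cong[OF refl])
    then show ?case using rec[OF less.hyps] extend_unfold[OF assms(1), of z b] less.hyps by simp
  qed
  with o b show ?thesis by blast
qed

text \<open>\<open>A\<close> is a set of edges closed under children inside \<open>S\<close>, and
  \<open>L\<close> the coordinates it reads. All edges give plain measurability; the descendants of
  a boundary edge show that a branch reads only its own coordinates.\<close>

lemma extend_measurable:
  assumes "finite S"
    and A: "\<And>b. b \<in> A \<Longrightarrow> b \<in> boundary T E S \<Longrightarrow> Inr b \<in> L"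
      "\<And>b. b \<in> A \<Longrightarrow> b \<in> oriented (induced_edges E S) \<Longrightarrow> Inl (edge b) \<in> L \<and> children b \<subseteq> A"
    and b: "b \<in> A" "b \<in> oriented (induced_edges E S) \<or> b \<in> boundary T E S"
  shows "(\<lambda>z. extend S z b) \<in> borel_measurable (PiM L (\<lambda>_. borel)) \<and>
    (\<forall>z. extend S (restrict z L) b = extend S z b)" (is "?P b")
proof -
  have o: "?P b" if "b \<in> boundary T E S" "b \<in> A" for b
  proof -
    have "extend S z b = z (Inr b)" for z
      using extend_unfold[OF assms(1)] boundary_not_induced[OF that(1)] by simp
    moreover have L: "Inr b \<in> L" using A(1) that by blast
    moreover have "(\<lambda>z. z (Inr b)) \<in> borel_measurable (PiM L (\<lambda>_. borel :: real measure))"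
      by (rule measurable_component_singleton[OF L])
    ultimately show ?thesis by simp
  qed
  have "b \<in> A \<longrightarrow> ?P b" if "b \<in> oriented (induced_edges E S)" for b
    using assms(1) that
  proof (induction b rule: induced_induct)
    case (less b)
    show ?case
    proof
      assume bA: "b \<in> A"
      have "b \<in> oriented E" using less.hyps by (simp add: oriented_induced_iff)
      then obtain c d where cd: "children b = {c, d}" "c \<noteq> d" by (rule children_pair)
      have P: "?P e" if "e \<in> children b" for e
        using less.IH[OF that] o[of e] children_induced[OF less.hyps] A(2)[OF bA less.hyps] that by blast
      have L: "Inl (edge b) \<in> L" using A(2)[OF bA less.hyps] by blast
      have eq: "extend S z b = freeze (z (Inl (edge b))) (min (extend S z c) (extend S z d))" for z
        using extend_unfold[OF assms(1), of z b] less.hyps cd by simp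
      have [measurable]: "(\<lambda>z. z (Inl (edge b))) \<in> borel_measurable (PiM L (\<lambda>_. borel :: real measure))"
        by (rule measurable_component_singleton[OF L])
      have [measurable]: "(\<lambda>z. extend S z c) \<in> borel_measurable (PiM L (\<lambda>_. borel))"
        "(\<lambda>z. extend S z d) \<in> borel_measurable (PiM L (\<lambda>_. borel))" using P[of c] P[of d] cd by auto
      have "(\<lambda>z. extend S z b) \<in> borel_measurable (PiM L (\<lambda>_. borel))"
        unfolding eq freeze_def by measurable
      moreover have "extend S (restrict z L) b = extend S z b" for z
      proof -
        have "extend S (restrict z L) c = extend S z c" "extend S (restrict z L) d = extend S z d"
          using P[of c] P[of d] cd(1) by blast+
        then show ?thesis unfolding eq using L by simp
      qed
      ultimately show "?P b" by blast
    qed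
  qed
  with o b show ?thesis by blast
qed

definition full :: "'v set \<Rightarrow> 'v set + 'v \<times> 'v \<Rightarrow> ('v set + 'v \<times> 'v \<Rightarrow> real) \<Rightarrow> real" where
  "full S i z = (case i of Inl e \<Rightarrow> z (Inl e) | Inr b \<Rightarrow> extend S z b)"

lemma full_simps [simp]: "full S (Inl e) z = z (Inl e)" "full S (Inr b) z = extend S z b"
  by (simp_all add: full_def)

lemma full_measurable [measurable]:
  assumes "finite S" "i \<in> inner_coords S" shows "full S i \<in> borel_measurable (PiM (coords S) (\<lambda>_. borel))"
proof (cases i)
  case (Inl e)
  then have "Inl e \<in> coords S" using assms by simp
  then show ?thesis unfolding Inl full_simps by (rule measurable_component_singleton)
next
  case (Inr b)
  have "(\<lambda>z. extend S z b) \<in> borel_measurable (PiM (coords S) (\<lambda>_. borel)) \<and>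
    (\<forall>z. extend S (restrict z (coords S)) b = extend S z b)"
    by (rule extend_measurable[where A = UNIV]) (use assms Inr in \<open>auto simp: oriented_induced_iff induced_edge_iff\<close>)
  then show ?thesis unfolding Inr full_simps by simp
qed

lemma full_coords: "finite S \<Longrightarrow> i \<in> coords S \<Longrightarrow> full S i z = z i"
  using extend_unfold boundary_not_induced by (cases i) auto

lemma full_restrict:
  assumes "finite S" "i \<in> inner_coords S" shows "full S i (restrict z (coords S)) = full S i z"
proof (cases i)
  case (Inl e) then show ?thesis using assms by simp
next
  case (Inr b)
  have "(\<lambda>z. extend S z b) \<in> borel_measurable (PiM (coords S) (\<lambda>_. borel)) \<and>
    (\<forall>z. extend S (restrict z (coords S)) b = extend S z b)"
    by (rule extend_measurable[where A = UNIV]) (use assms Inr in \<open>auto simp: oriented_induced_iff induced_edge_iff\<close>)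
  then show ?thesis unfolding Inr full_simps by simp
qed

lemma full_recursion:
  assumes "finite S" "b \<in> oriented (induced_edges E S)"
  shows "recursion_at (\<lambda>e. full S (Inl e) z) (\<lambda>b. full S (Inr b) z) b"
  using extend_unfold[OF assms(1), of z b] assms(2) by (simp add: recursion_at_def image_def)

end

section \<open>Consistency of the finite-dimensional laws\<close>

lemma independent_coords_cong:
  assumes "\<And>i. i \<in> I \<Longrightarrow> Z i = Y i"
  shows "independent_coords M Z I \<longleftrightarrow> independent_coords M Y I"
proof (cases "prob_space M")
  case True
  then interpret prob_space M .
  have "indep_vars (\<lambda>_. borel) Z I = indep_vars (\<lambda>_. borel) Y I"
    by (rule indep_vars_cong[OF refl assms refl])
  then show ?thesis using assms by (simp add: independent_coords_def)
qed (simp add: independent_coords_def)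

lemma independent_coords_prob:
  assumes "independent_coords M Z I" "finite J" "J \<noteq> {}" "J \<subseteq> I" "\<And>i. i \<in> J \<Longrightarrow> A i \<in> sets borel"
  shows "measure M (\<Inter>i\<in>J. Z i -` A i \<inter> space M) = (\<Prod>i\<in>J. measure (coord_law i) (A i))"
proof -
  interpret prob_space M using assms(1) by (simp add: independent_coords_def)
  have "indep_vars (\<lambda>_. borel) Z I" using assms(1) by (simp add: independent_coords_def)
  then have "prob (\<Inter>i\<in>J. Z i -` A i \<inter> space M) = (\<Prod>i\<in>J. prob (Z i -` A i \<inter> space M))"
    using assms by (intro indep_varsD) auto
  also have "\<dots> = (\<Prod>i\<in>J. measure (coord_law i) (A i))"
  proof (rule prod.cong[OF refl])
    fix i assume i: "i \<in> J"
    have "Z i \<in> borel_measurable M" using assms(1,4) i by (auto intro: independent_coords_measurable)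
    then have "prob (Z i -` A i \<inter> space M) = measure (distr M borel (Z i)) (A i)"
      using assms(5)[OF i] by (simp add: measure_distr)
    also have "distr M borel (Z i) = coord_law i" using assms(1,4) i by (auto simp: independent_coords_def)
    finally show "prob (Z i -` A i \<inter> space M) = measure (coord_law i) (A i)" .
  qed
  finally show ?thesis .
qed

lemma independent_coords_AE:
  assumes "independent_coords M Z I" "i \<in> I" "AE x in coord_law i. P x" shows "AE \<omega> in M. P (Z i \<omega>)"
proof -
  have "distr M borel (Z i) = coord_law i" using assms by (auto simp: independent_coords_def)
  then show ?thesis using AE_distrD[OF independent_coords_measurable[OF assms(1,2)]] assms(3) by metis
qed

context cubic_tree
begin

text \<open>Removing one vertex replaces the label of \<open>a\<close> and the times of its two
  children by the time of \<open>a\<close>. Its law is again \<open>time_law\<close> by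
  \<open>freeze_time_law\<close>, and independence is kept since a disjoint group of coordinates is
  merged.\<close>

lemma independent_coords_step:
  assumes S: "finite_subtree T E S" and a: "a \<in> boundary T E S"
    and ind: "independent_coords M Z (coords (insert (snd a) S))"
    and rec: "\<And>\<omega>. recursion_at (\<lambda>e. Z (Inl e) \<omega>) (\<lambda>b. Z (Inr b) \<omega>) a"
  shows "independent_coords M Z (coords S)"
proof -
  let ?I = "coords (insert (snd a) S)"
  interpret prob_space M using ind by (simp add: independent_coords_def)
  note N = subtree_insert[OF S a]
  have aO: "a \<in> oriented E" using a by (simp add: boundary_iff)
  obtain c d where cd: "children a = {c, d}" "c \<noteq> d" using children_pair[OF aO] .
  have I: "Inl (edge a) \<in> ?I" "Inr c \<in> ?I" "Inr d \<in> ?I" using cd by (simp_all add: N)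
  have Za: "Z (Inr a) = (\<lambda>\<omega>. freeze (Z (Inl (edge a)) \<omega>) (min (Z (Inr c) \<omega>) (Z (Inr d) \<omega>)))"
    using rec by (auto simp: recursion_at_def cd(1))
  have iv: "indep_vars (\<lambda>_. borel) Z ?I" using ind by (simp add: independent_coords_def)
  \<comment> \<open>The time of \<open>a\<close> is a function of three old coordinates; every other
    coordinate is its own group.\<close>
  define L where "L j = (if j = Inr a then {Inl (edge a), Inr c, Inr d} else {j})" for j :: "'v set + 'v \<times> 'v"
  define h where "h j w = (if j = Inr a then freeze (w (Inl (edge a))) (min (w (Inr c)) (w (Inr d))) else w j)"
    for j :: "'v set + 'v \<times> 'v" and w :: "'v set + 'v \<times> 'v \<Rightarrow> real"
  have "indep_vars (\<lambda>_. borel) Z (coords S)"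
  proof (rule indep_vars_group[OF iv, of _ L h])
    fix j assume j: "j \<in> coords S"
    then show "L j \<subseteq> ?I" using I by (cases j) (auto simp: L_def N)
    show "h j \<in> borel_measurable (PiM (L j) (\<lambda>_. borel))"
    proof (cases "j = Inr a")
      case True
      have [measurable]: "(\<lambda>w. w (Inl (edge a))) \<in> borel_measurable (PiM (L j) (\<lambda>_. borel :: real measure))"
        "(\<lambda>w. w (Inr c)) \<in> borel_measurable (PiM (L j) (\<lambda>_. borel :: real measure))"
        "(\<lambda>w. w (Inr d)) \<in> borel_measurable (PiM (L j) (\<lambda>_. borel :: real measure))"
        by (rule measurable_component_singleton, simp add: L_def True)+
      have "(\<lambda>w. freeze (w (Inl (edge a))) (min (w (Inr c)) (w (Inr d)))) \<in> borel_measurable (PiM (L j) (\<lambda>_. borel))"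
        unfolding freeze_def by measurable
      then show ?thesis unfolding h_def using True by simp
    next
      case False
      have "(\<lambda>w. w j) \<in> borel_measurable (PiM (L j) (\<lambda>_. borel :: real measure))"
        by (rule measurable_component_singleton) (simp add: L_def False)
      then show ?thesis unfolding h_def using False by simp
    qed
    show "Z j = (\<lambda>\<omega>. h j (\<lambda>i\<in>L j. Z i \<omega>))" by (auto simp: h_def L_def Za)
  next
    have "c \<notin> boundary T E S" "d \<notin> boundary T E S" using N(5) cd by auto
    then show "disjoint_family_on L (coords S)"
      using N(3) unfolding disjoint_family_on_def L_def by auto
  qed
  moreover have "distr M borel (Z i) = coord_law i" if i: "i \<in> coords S" for i
  proof (cases "i = Inr a")
    case False
    then have "i \<in> ?I" using i by (cases i) (auto simp: N)
    then show ?thesis using ind by (simp add: independent_coords_def)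
  next
    case True
    have joint: "prob {\<omega> \<in> space M. Z (Inl (edge a)) \<omega> \<le> r \<and> x < Z (Inr c) \<omega> \<and> x < Z (Inr d) \<omega>} = r * (tail x)\<^sup>2"
      if "0 \<le> r" "r \<le> 1" "0 \<le> x" "x \<le> 1" for r x
    proof -
      let ?J = "{Inl (edge a), Inr c, Inr d}"
      let ?A = "\<lambda>i :: 'v set + 'v \<times> 'v. case i of Inl _ \<Rightarrow> {..r} | Inr _ \<Rightarrow> {x<..}"
      have "prob (\<Inter>i\<in>?J. Z i -` ?A i \<inter> space M) = (\<Prod>i\<in>?J. measure (coord_law i) (?A i))"
        by (rule independent_coords_prob[OF ind]) (use I in \<open>auto split: sum.split\<close>)
      also have "\<dots> = r * (tail x)\<^sup>2"
        using that cd(2) by (simp add: uniform_01_atMost time_law_tail power2_eq_square)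
      also have "(\<Inter>i\<in>?J. Z i -` ?A i \<inter> space M) =
          {\<omega> \<in> space M. Z (Inl (edge a)) \<omega> \<le> r \<and> x < Z (Inr c) \<omega> \<and> x < Z (Inr d) \<omega>}" by auto
      finally show ?thesis .
    qed
    have r1: "AE \<omega> in M. Z (Inl (edge a)) \<omega> \<in> {0..1}"
      by (rule independent_coords_AE[OF ind I(1)]) (unfold coord_law_simps, rule AE_uniform_01)
    have r2: "AE \<omega> in M. Z (Inr b) \<omega> \<in> {0..1} \<union> {2}" if "Inr b \<in> ?I" for b
      by (rule independent_coords_AE[OF ind that]) (unfold coord_law_simps, rule AE_time_law)
    show ?thesis unfolding True Za coord_law_simps
      by (rule freeze_time_law[OF _ _ _ r1 r2[OF I(2)] r2[OF I(3)] joint])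
        (use independent_coords_measurable[OF ind] I in auto)
  qed
  ultimately show ?thesis using prob_space_axioms by (simp add: independent_coords_def)
qed

lemma finite_subtree_finite: "finite_subtree T E S \<Longrightarrow> finite S"
  by (simp add: finite_subtree_iff)

text \<open>The growth from \<open>S\<close> to \<open>R\<close> is run with an implication as
  predicate, which turns it into a descent from \<open>R\<close> to \<open>S\<close> by one vertex
  at a time.\<close>

lemma product_law_project:
  assumes S: "finite_subtree T E S" and R: "finite_subtree T E R" and "S \<subseteq> R"
  shows "independent_coords (product_law (coords R)) (full R) (coords S)"
proof -
  let ?P = "\<lambda>Q. independent_coords (product_law (coords R)) (full R) (coords Q)"
  have fR: "finite R" using R by (rule finite_subtree_finite)
  have "?P R \<longrightarrow> ?P S"
    using assms
  proof (induction rule: subtree_grow[where P = "\<lambda>Q. ?P Q \<longrightarrow> ?P S"])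
    case (step Q a)
    have a: "a \<in> oriented (induced_edges E R)"
      using step by (auto simp: oriented_induced_iff boundary_iff)
    have "?P (insert (snd a) Q) \<Longrightarrow> ?P Q"
      by (rule independent_coords_step[OF step(1,2) _ full_recursion[OF fR a]])
    then show ?case using step by blast
  qed simp
  moreover have "?P R"
  proof (subst independent_coords_cong)
    show "independent_coords (product_law (coords R)) (\<lambda>i z. z i) (coords R)"
      by (rule product_law_coords[OF coords_nonempty[OF R]])
    show "full R i = (\<lambda>z. z i)" if "i \<in> coords R" for i
      using full_coords[OF fR that] by auto
  qed
  ultimately show ?thesis by blast
qed

definition config_law :: "'v set \<Rightarrow> ('v set + 'v \<times> 'v) set \<Rightarrow> ('v set + 'v \<times> 'v \<Rightarrow> real) measure" where
  "config_law S J = distr (product_law (coords S)) (PiM J (\<lambda>_. borel)) (\<lambda>z. \<lambda>i\<in>J. full S i z)"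

lemma full_measurable': "finite_subtree T E S \<Longrightarrow> i \<in> inner_coords S \<Longrightarrow> full S i \<in> borel_measurable (product_law (coords S))"
  using full_measurable finite_subtree_finite by (subst measurable_cong_sets[OF sets_product_law refl]) auto

lemma restrict_full_measurable:
  assumes "finite_subtree T E S" "J \<subseteq> inner_coords S"
  shows "(\<lambda>z. \<lambda>i\<in>J. full S i z) \<in> measurable (product_law (coords S)) (PiM J (\<lambda>_. borel))"
  using assms full_measurable' by (intro measurable_restrict) blast

lemma recursion_full:
  assumes "finite S" "i \<in> inner_coords S"
    and rec: "\<And>b. b \<in> oriented (induced_edges E S) \<Longrightarrow> recursion_at (\<lambda>e. z (Inl e)) (\<lambda>b. z (Inr b)) b"
  shows "z i = full S i (\<lambda>i\<in>coords S. z i)"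
proof -
  have "z i = full S i z"
  proof (cases i)
    case (Inr b)
    have "z (Inr b) = extend S z b"
      by (rule extend_unique[where x = "\<lambda>b. z (Inr b)"])
        (use assms Inr in \<open>auto simp: recursion_at_def\<close>)
    then show ?thesis using Inr by simp
  qed simp
  then show ?thesis using full_restrict[OF assms(1,2)] by simp
qed

text \<open>Identifies the finite-dimensional law of any process with these properties. Applied to
  \<open>full R\<close> it gives consistency, applied to a general process it gives
  uniqueness.\<close>

lemma config_law_process:
  assumes S: "finite_subtree T E S" and J: "J \<subseteq> inner_coords S" and ind: "independent_coords M Z (coords S)"
    and Z: "\<And>i. i \<in> inner_coords S \<Longrightarrow> Z i \<in> borel_measurable M"
    and rec: "AE \<omega> in M. \<forall>b\<in>oriented (induced_edges E S). recursion_at (\<lambda>e. Z (Inl e) \<omega>) (\<lambda>b. Z (Inr b) \<omega>) b"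
  shows "distr M (PiM J (\<lambda>_. borel)) (\<lambda>\<omega>. \<lambda>i\<in>J. Z i \<omega>) = config_law S J"
proof -
  interpret prob_space M using ind by (simp add: independent_coords_def)
  have fS: "finite S" using S by (rule finite_subtree_finite)
  let ?r = "\<lambda>\<omega>. \<lambda>i\<in>coords S. Z i \<omega>"
  have rM: "?r \<in> measurable M (PiM (coords S) (\<lambda>_. borel))"
    using Z coords_subset(1) by (intro measurable_restrict) blast
  have fM: "(\<lambda>z. \<lambda>i\<in>J. full S i z) \<in> measurable (PiM (coords S) (\<lambda>_. borel)) (PiM J (\<lambda>_. borel))"
    using J full_measurable[OF fS] by (intro measurable_restrict) blast
  have law: "product_law (coords S) = distr M (PiM (coords S) (\<lambda>_. borel)) ?r"
    using independent_coords_iff[OF prob_space_axioms coords_nonempty[OF S]] ind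
      independent_coords_measurable[OF ind] by auto
  have "config_law S J = distr M (PiM J (\<lambda>_. borel)) (\<lambda>\<omega>. \<lambda>i\<in>J. full S i (?r \<omega>))"
    unfolding config_law_def law using rM fM by (subst distr_distr) (auto simp: comp_def)
  also have "\<dots> = distr M (PiM J (\<lambda>_. borel)) (\<lambda>\<omega>. \<lambda>i\<in>J. Z i \<omega>)"
  proof (rule distr_cong_AE[OF refl refl])
    show "AE \<omega> in M. (\<lambda>i\<in>J. full S i (?r \<omega>)) = (\<lambda>i\<in>J. Z i \<omega>)"
      using rec
    proof eventually_elim
      case (elim \<omega>)
      have "Z i \<omega> = full S i (?r \<omega>)" if "i \<in> J" for i
        using recursion_full[OF fS, of i "\<lambda>i. Z i \<omega>"] elim J that by blast
      then show ?case by (simp add: restrict_def fun_eq_iff)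
    qed
    show "(\<lambda>\<omega>. \<lambda>i\<in>J. full S i (?r \<omega>)) \<in> measurable M (PiM J (\<lambda>_. borel))"
      using measurable_compose[OF rM fM] .
    show "(\<lambda>\<omega>. \<lambda>i\<in>J. Z i \<omega>) \<in> measurable M (PiM J (\<lambda>_. borel))"
      using Z J by (intro measurable_restrict) blast
  qed
  finally show ?thesis ..
qed

lemma induced_edges_mono: "S \<subseteq> R \<Longrightarrow> induced_edges E S \<subseteq> induced_edges E R"
  by (auto simp: induced_edges_def)

lemma inner_coords_mono: assumes "S \<subseteq> R" shows "inner_coords S \<subseteq> inner_coords R"
proof
  fix i assume i: "i \<in> inner_coords S"
  show "i \<in> inner_coords R"
  proof (cases i)
    case (Inl e) then show ?thesis using i induced_edges_mono[OF assms] by auto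
  next
    case (Inr a) then show ?thesis using i assms unfolding Inr coords_simps oriented_induced_iff boundary_iff by blast
  qed
qed

lemma config_law_mono:
  assumes "finite_subtree T E S" "finite_subtree T E R" "S \<subseteq> R" "J \<subseteq> inner_coords S"
  shows "config_law R J = config_law S J"
  unfolding config_law_def[of R]
proof (rule config_law_process[OF assms(1,4) product_law_project[OF assms(1-3)]])
  show "full R i \<in> borel_measurable (product_law (coords R))" if "i \<in> inner_coords S" for i
    using full_measurable'[OF assms(2)] inner_coords_mono[OF assms(3)] that by blast
  show "AE z in product_law (coords R). \<forall>b\<in>oriented (induced_edges E S).
      recursion_at (\<lambda>e. full R (Inl e) z) (\<lambda>b. full R (Inr b) z) b"
  proof (intro AE_I2 ballI full_recursion)
    show "finite R" using assms(2) by (rule finite_subtree_finite)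
    fix b assume "b \<in> oriented (induced_edges E S)"
    then show "b \<in> oriented (induced_edges E R)" using assms(3) by (auto simp: oriented_induced_iff)
  qed
qed

section \<open>The Kolmogorov limit and its characterisation\<close>

lemma cover_exists:
  assumes "finite J" "J \<subseteq> all_coords" shows "\<exists>S. finite_subtree T E S \<and> J \<subseteq> inner_coords S"
proof -
  obtain S0 where S0: "finite_subtree T E S0" using subtree_exists by blast
  define V where "V = (\<Union>i\<in>J. case i of Inl e \<Rightarrow> e | Inr a \<Rightarrow> edge a)"
  have sub: "e \<subseteq> T \<and> finite e" if e: "e \<in> E" for e
  proof -
    obtain a where a: "a \<in> oriented E" "e = edge a" using e by (rule edge_cases)
    then show ?thesis using orientedD[OF a(1)] by simp
  qed
  have each: "(case i of Inl e \<Rightarrow> e | Inr a \<Rightarrow> edge a) \<in> E" if "i \<in> J" for i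
    using assms(2) that by (cases i) (auto simp: oriented_iff)
  have "finite V" "V \<subseteq> T" unfolding V_def using each sub assms(1) by auto
  then obtain S where S: "finite_subtree T E S" "S0 \<subseteq> S" "V \<subseteq> S" using subtree_cover[OF S0] by blast
  have "i \<in> inner_coords S" if i: "i \<in> J" for i
  proof (cases i)
    case (Inl e)
    then have "e \<subseteq> V" unfolding V_def using i by (intro UN_upper[of _ J, THEN order_trans[rotated]]) auto
    then show ?thesis using Inl each[OF i] S(3) by (auto simp: induced_edges_def)
  next
    case (Inr a)
    have "edge a \<subseteq> V" unfolding V_def using i Inr by (intro UN_upper[of _ J, THEN order_trans[rotated]]) auto
    then show ?thesis using Inr each[OF i] S(3) by (auto simp: oriented_induced_iff oriented_iff)
  qed
  then show ?thesis using S(1) by blast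
qed

definition cover :: "('v set + 'v \<times> 'v) set \<Rightarrow> 'v set" where
  "cover J = (SOME S. finite_subtree T E S \<and> J \<subseteq> inner_coords S)"

lemma cover: "finite J \<Longrightarrow> J \<subseteq> all_coords \<Longrightarrow> finite_subtree T E (cover J) \<and> J \<subseteq> inner_coords (cover J)"
  unfolding cover_def by (rule someI_ex) (rule cover_exists)

text \<open>The arbitrary choice in \<open>cover\<close> does not matter: two covering subtrees are
  compared inside a third one that contains both.\<close>

lemma config_law_cover:
  assumes "finite_subtree T E S" "J \<subseteq> inner_coords S" "finite J"
  shows "config_law (cover J) J = config_law S J"
proof -
  have C: "finite_subtree T E (cover J)" "J \<subseteq> inner_coords (cover J)"
    using cover[OF assms(3)] assms(2) coords_subset(2)[of S] by auto
  obtain R where "finite_subtree T E R" "S \<subseteq> R" "cover J \<subseteq> R"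
    using subtree_cover[OF assms(1), of "cover J"] C(1) by (auto simp: finite_subtree_iff)
  then show ?thesis
    using config_law_mono[OF assms(1) _ _ assms(2), of R] config_law_mono[OF C(1) _ _ C(2), of R] by simp
qed

lemma polish_projective_config: "polish_projective all_coords (\<lambda>J. config_law (cover J) J)"
proof (intro polish_projective.intro projective_family.intro)
  fix J H assume JH: "J \<subseteq> H" "finite H" "H \<subseteq> (all_coords :: ('v set + 'v \<times> 'v) set)"
  have C: "finite_subtree T E (cover H)" "H \<subseteq> inner_coords (cover H)" using cover JH by auto
  have "config_law (cover J) J = config_law (cover H) J"
    using JH C by (intro config_law_cover) (auto intro: finite_subset)
  also have "\<dots> = distr (config_law (cover H) H) (PiM J (\<lambda>_. borel)) (\<lambda>f. restrict f J)"
    unfolding config_law_def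
    by (subst distr_distr[OF measurable_restrict_subset[OF JH(1)] restrict_full_measurable[OF C]])
      (use JH(1) in \<open>auto simp: comp_def restrict_def fun_eq_iff intro!: distr_cong\<close>)
  finally show "config_law (cover J) J = distr (config_law (cover H) H) (PiM J (\<lambda>_. borel)) (\<lambda>f. restrict f J)" .
next
  fix J assume J: "finite J" "J \<subseteq> (all_coords :: ('v set + 'v \<times> 'v) set)"
  then have C: "finite_subtree T E (cover J)" "J \<subseteq> inner_coords (cover J)" using cover by auto
  show "prob_space (config_law (cover J) J)"
    unfolding config_law_def
    by (rule prob_space.prob_space_distr[OF prob_space_product_law restrict_full_measurable[OF C]])
qed

definition limit_law :: "('v set + 'v \<times> 'v \<Rightarrow> real) measure" where
  "limit_law = projective_family.lim all_coords (\<lambda>J. config_law (cover J) J) (\<lambda>_. borel)"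

lemma sets_limit_law [simp, measurable_cong]: "sets limit_law = sets (PiM all_coords (\<lambda>_. borel))"
proof -
  interpret polish_projective all_coords "\<lambda>J. config_law (cover J) J" by (rule polish_projective_config)
  show ?thesis unfolding limit_law_def by simp
qed

lemma prob_space_limit_law: "prob_space limit_law"
proof -
  interpret polish_projective all_coords "\<lambda>J. config_law (cover J) J" by (rule polish_projective_config)
  show ?thesis unfolding limit_law_def by (rule P.prob_space_axioms)
qed

lemma limit_law_emb:
  assumes "finite_subtree T E S" "J \<subseteq> inner_coords S" "finite J" "A \<in> sets (PiM J (\<lambda>_. borel))"
  shows "emeasure limit_law (prod_emb all_coords (\<lambda>_. borel) J A) = emeasure (config_law S J) A"
proof -
  interpret polish_projective all_coords "\<lambda>J. config_law (cover J) J" by (rule polish_projective_config)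
  have "J \<subseteq> all_coords" using assms(2) coords_subset(2) by blast
  then show ?thesis unfolding limit_law_def
    using emeasure_lim_emb[OF _ assms(3,4)] config_law_cover[OF assms(1-3)] by simp
qed

lemma limit_law_restrict:
  assumes "finite_subtree T E S" "J \<subseteq> inner_coords S" "finite J"
  shows "distr limit_law (PiM J (\<lambda>_. borel)) (\<lambda>z. \<lambda>i\<in>J. z i) = config_law S J"
proof (rule measure_eqI)
  have J: "J \<subseteq> all_coords" using assms(2) coords_subset(2) by blast
  fix A assume "A \<in> sets (distr limit_law (PiM J (\<lambda>_. borel)) (\<lambda>z. \<lambda>i\<in>J. z i))"
  then have A: "A \<in> sets (PiM J (\<lambda>_. borel))" by simp
  have m: "(\<lambda>z. \<lambda>i\<in>J. z i) \<in> measurable limit_law (PiM J (\<lambda>_. borel :: real measure))"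
    using measurable_restrict_subset[OF J] by (subst measurable_cong_sets[OF sets_limit_law refl])
  have "emeasure (distr limit_law (PiM J (\<lambda>_. borel)) (\<lambda>z. \<lambda>i\<in>J. z i)) A =
      emeasure limit_law ((\<lambda>z. \<lambda>i\<in>J. z i) -` A \<inter> space limit_law)"
    by (rule emeasure_distr[OF m A])
  also have "(\<lambda>z. \<lambda>i\<in>J. z i) -` A \<inter> space limit_law = prod_emb all_coords (\<lambda>_. borel) J A"
    using sets_eq_imp_space_eq[OF sets_limit_law] by (simp add: prod_emb_def space_PiM)
  finally show "emeasure (distr limit_law (PiM J (\<lambda>_. borel)) (\<lambda>z. \<lambda>i\<in>J. z i)) A = emeasure (config_law S J) A"
    unfolding limit_law_emb[OF assms A] .
qed (simp add: config_law_def)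

text \<open>Serves both claims: applied to a given coupling it yields uniqueness, and applied to the
  limit law with coordinates permuted by an automorphism it yields invariance.\<close>

theorem limit_law_unique:
  assumes "prob_space M" and Z: "\<And>i. i \<in> all_coords \<Longrightarrow> Z i \<in> borel_measurable M"
    and rec: "\<And>b. b \<in> oriented E \<Longrightarrow> AE \<omega> in M. recursion_at (\<lambda>e. Z (Inl e) \<omega>) (\<lambda>b. Z (Inr b) \<omega>) b"
    and ind: "\<And>S. finite_subtree T E S \<Longrightarrow> independent_coords M Z (coords S)"
  shows "distr M (PiM all_coords (\<lambda>_. borel)) (\<lambda>\<omega>. \<lambda>i\<in>all_coords. Z i \<omega>) = limit_law" (is "?D = _")
proof (rule measure_eqI_PiM_infinite[where I = all_coords and M = "\<lambda>_. borel"])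
  interpret prob_space M by fact
  have m: "(\<lambda>\<omega>. \<lambda>i\<in>all_coords. Z i \<omega>) \<in> measurable M (PiM all_coords (\<lambda>_. borel))"
    using Z by (intro measurable_restrict)
  interpret D: prob_space ?D by (rule prob_space_distr[OF m])
  show "finite_measure ?D" by (rule D.finite_measure_axioms)
  fix A and J :: "('v set + 'v \<times> 'v) set" assume J: "finite J" "J \<subseteq> all_coords" "\<And>i. i \<in> J \<Longrightarrow> A i \<in> sets (borel :: real measure)"
  have C: "finite_subtree T E (cover J)" "J \<subseteq> inner_coords (cover J)" using cover J by auto
  let ?B = "Pi\<^sub>E J A"
  have B: "?B \<in> sets (PiM J (\<lambda>_. borel))" using J by (intro sets_PiM_I_finite) auto
  have "AE \<omega> in M. \<forall>b\<in>oriented (induced_edges E (cover J)). recursion_at (\<lambda>e. Z (Inl e) \<omega>) (\<lambda>b. Z (Inr b) \<omega>) b"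
  proof (subst AE_ball_countable)
    have "oriented (induced_edges E (cover J)) \<subseteq> oriented E" by (auto simp: oriented_def induced_edges_def)
    then show "countable (oriented (induced_edges E (cover J)))" using countable_oriented by (rule countable_subset)
  qed (use rec in \<open>simp add: oriented_induced_iff\<close>)
  then have law: "distr M (PiM J (\<lambda>_. borel)) (\<lambda>\<omega>. \<lambda>i\<in>J. Z i \<omega>) = config_law (cover J) J"
    using Z coords_subset(2) by (intro config_law_process[OF C ind[OF C(1)]]) auto
  have mJ: "(\<lambda>\<omega>. \<lambda>i\<in>J. Z i \<omega>) \<in> measurable M (PiM J (\<lambda>_. borel))"
    using Z J(2) by (intro measurable_restrict) blast
  have "emeasure ?D (prod_emb all_coords (\<lambda>_. borel) J ?B) =
      emeasure M ((\<lambda>\<omega>. \<lambda>i\<in>all_coords. Z i \<omega>) -` prod_emb all_coords (\<lambda>_. borel) J ?B \<inter> space M)"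
    using J by (intro emeasure_distr[OF m] sets_PiM_I) auto
  also have "(\<lambda>\<omega>. \<lambda>i\<in>all_coords. Z i \<omega>) -` prod_emb all_coords (\<lambda>_. borel) J ?B \<inter> space M =
      (\<lambda>\<omega>. \<lambda>i\<in>J. Z i \<omega>) -` ?B \<inter> space M"
    by (auto simp: prod_emb_def Int_absorb1[OF J(2)])
  also have "emeasure M \<dots> = emeasure (config_law (cover J) J) ?B"
    unfolding law[symmetric] by (rule emeasure_distr[OF mJ B, symmetric])
  also have "\<dots> = emeasure limit_law (prod_emb all_coords (\<lambda>_. borel) J ?B)"
    using limit_law_emb[OF C J(1) B] by simp
  finally show "emeasure ?D (prod_emb all_coords (\<lambda>_. borel) J ?B) = emeasure limit_law (prod_emb all_coords (\<lambda>_. borel) J ?B)" .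
qed simp_all

lemma limit_law_measurable: "i \<in> all_coords \<Longrightarrow> (\<lambda>z. z i) \<in> borel_measurable limit_law"
  by (subst measurable_cong_sets[OF sets_limit_law refl]) (rule measurable_component_singleton)

lemma limit_law_independent:
  assumes S: "finite_subtree T E S" shows "independent_coords limit_law (\<lambda>i z. z i) (coords S)"
proof (subst independent_coords_iff[OF prob_space_limit_law coords_nonempty[OF S]])
  have "config_law S (coords S) = product_law (coords S)"
  proof -
    have "independent_coords (product_law (coords S)) (full S) (coords S)"
      by (rule product_law_project[OF S S]) simp
    then show ?thesis
      unfolding config_law_def
      using independent_coords_iff[OF prob_space_product_law coords_nonempty[OF S], of "full S"]
        full_measurable'[OF S] coords_subset(1)[of S] by blast
  qed
  then show "distr limit_law (PiM (coords S) (\<lambda>_. borel)) (\<lambda>z. \<lambda>i\<in>coords S. z i) = product_law (coords S)"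
    using limit_law_restrict[OF S coords_subset(1) finite_coords[OF S]] by simp
qed (use limit_law_measurable coords_subset in blast)

text \<open>The recursion at one edge concerns four coordinates, all visible in the subtree formed
  by that edge, where it holds by construction.\<close>

lemma limit_law_recursion:
  assumes b: "b \<in> oriented E"
  shows "AE z in limit_law. recursion_at (\<lambda>e. z (Inl e)) (\<lambda>c. z (Inr c)) b"
proof -
  obtain c d where cd: "children b = {c, d}" "c \<noteq> d" using children_pair[OF b] .
  define S where "S = edge b"
  have S: "finite_subtree T E S" "finite S" using subtree_edge(1)[OF b] by (auto simp: S_def)
  have bS: "b \<in> oriented (induced_edges E S)" using b by (simp add: S_def oriented_induced_iff)
  define J where "J = {Inl (edge b), Inr b, Inr c, Inr d}"
  have J: "J \<subseteq> inner_coords S" "finite J"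
    using bS children_induced[OF bS] cd b
    by (auto simp: J_def induced_edge_iff S_def)
  let ?Q = "\<lambda>z :: 'v set + 'v \<times> 'v \<Rightarrow> real. z (Inr b) = freeze (z (Inl (edge b))) (min (z (Inr c)) (z (Inr d)))"
  have comp: "(\<lambda>z. z i) \<in> borel_measurable (PiM J (\<lambda>_. borel :: real measure))" if "i \<in> J" for i
    using that by (rule measurable_component_singleton)
  have [measurable]: "(\<lambda>z. z (Inl (edge b))) \<in> borel_measurable (PiM J (\<lambda>_. borel :: real measure))"
    "(\<lambda>z. z (Inr b)) \<in> borel_measurable (PiM J (\<lambda>_. borel :: real measure))"
    "(\<lambda>z. z (Inr c)) \<in> borel_measurable (PiM J (\<lambda>_. borel :: real measure))"
    "(\<lambda>z. z (Inr d)) \<in> borel_measurable (PiM J (\<lambda>_. borel :: real measure))"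
    by (rule comp, simp add: J_def)+
  have Q: "{z \<in> space (PiM J (\<lambda>_. borel)). ?Q z} \<in> sets (PiM J (\<lambda>_. borel))"
    unfolding freeze_def by measurable
  have "AE z in config_law S J. ?Q z"
    unfolding config_law_def
  proof (subst AE_distr_iff[OF restrict_full_measurable[OF S(1) J(1)] Q], rule AE_I2)
    fix z
    show "?Q (\<lambda>i\<in>J. full S i z)"
      using full_recursion[OF S(2) bS, of z] cd by (simp add: J_def recursion_at_def)
  qed
  then have "AE z in distr limit_law (PiM J (\<lambda>_. borel)) (\<lambda>z. \<lambda>i\<in>J. z i). ?Q z"
    unfolding limit_law_restrict[OF S(1) J] .
  moreover have "(\<lambda>z. \<lambda>i\<in>J. z i) \<in> measurable limit_law (PiM J (\<lambda>_. borel :: real measure))"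
    using J(1) coords_subset(2) limit_law_measurable by (intro measurable_restrict) blast
  ultimately have "AE z in limit_law. ?Q (\<lambda>i\<in>J. z i)" using AE_distrD by blast
  then show ?thesis by eventually_elim (simp add: J_def recursion_at_def cd)
qed

end

section \<open>Independence of branches\<close>

lemma space_subset_space [simp]: "space (subset_space D) = Pow D"
  unfolding subset_space_def by (rule space_measure_of) auto

lemma measurable_subset_space:
  assumes "\<And>\<omega>. \<omega> \<in> space M \<Longrightarrow> f \<omega> \<subseteq> D" "\<And>d. d \<in> D \<Longrightarrow> {\<omega> \<in> space M. d \<in> f \<omega>} \<in> sets M"
  shows "f \<in> measurable M (subset_space D)"
  unfolding subset_space_def
proof (rule measurable_measure_of)
  show "f \<in> space M \<rightarrow> Pow D" using assms(1) by auto
  fix A assume "A \<in> (\<lambda>d. {X \<in> Pow D. d \<in> X}) ` D"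
  then obtain d where d: "d \<in> D" "A = {X \<in> Pow D. d \<in> X}" by auto
  have "f -` A \<inter> space M = {\<omega> \<in> space M. d \<in> f \<omega>}" using assms(1) d(2) by auto
  then show "f -` A \<inter> space M \<in> sets M" using assms(2)[OF d(1)] by simp
qed auto

lemma subset_space_member:
  assumes "f \<in> measurable M (subset_space D)" shows "{\<omega> \<in> space M. d \<in> f \<omega>} \<in> sets M"
proof (cases "d \<in> D")
  case True
  then have "{X \<in> Pow D. d \<in> X} \<in> sets (subset_space D)"
    unfolding subset_space_def by (subst sets_measure_of) auto
  from measurable_sets[OF assms this] have "f -` {X \<in> Pow D. d \<in> X} \<inter> space M \<in> sets M" .
  moreover have "f -` {X \<in> Pow D. d \<in> X} \<inter> space M = {\<omega> \<in> space M. d \<in> f \<omega>}"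
    using measurable_space[OF assms] by auto
  ultimately show ?thesis by simp
next
  case False
  then have eq: "{\<omega> \<in> space M. d \<in> f \<omega>} = {}" using measurable_space[OF assms] by auto
  show ?thesis unfolding eq by simp
qed

text \<open>Used to carry independence over from the limit law to its image, the law of the
  coupling.\<close>

lemma indep_sets_distr:
  assumes "prob_space M" and f: "f \<in> measurable M N" and G: "\<And>i. i \<in> I \<Longrightarrow> G i \<subseteq> sets N"
    and H: "prob_space.indep_sets M H I" "\<And>i A. i \<in> I \<Longrightarrow> A \<in> G i \<Longrightarrow> f -` A \<inter> space M \<in> H i"
  shows "prob_space.indep_sets (distr M N f) G I"
proof -
  interpret prob_space M by fact
  interpret D: prob_space "distr M N f" by (rule prob_space_distr[OF f])
  show ?thesis
  proof (rule D.indep_setsI)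
    fix A J assume J: "J \<noteq> {}" "J \<subseteq> I" "finite J" "\<forall>j\<in>J. A j \<in> G j"
    have A: "A j \<in> sets N" if "j \<in> J" for j using J G that by blast
    have "(\<Inter>j\<in>J. A j) \<in> sets N" using A J by (intro sets.finite_INT) auto
    then have "D.prob (\<Inter>j\<in>J. A j) = prob (f -` (\<Inter>j\<in>J. A j) \<inter> space M)" by (rule measure_distr[OF f])
    also have "f -` (\<Inter>j\<in>J. A j) \<inter> space M = (\<Inter>j\<in>J. f -` A j \<inter> space M)" using J(1) by auto
    also have "prob \<dots> = (\<Prod>j\<in>J. prob (f -` A j \<inter> space M))"
      by (rule indep_setsD[OF H(1) J(2,1,3)]) (use H(2) J in blast)
    also have "\<dots> = (\<Prod>j\<in>J. D.prob (A j))"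
      by (rule prod.cong[OF refl]) (simp add: measure_distr[OF f A])
    finally show "D.prob (\<Inter>j\<in>J. A j) = (\<Prod>j\<in>J. D.prob (A j))" .
  qed (use G in auto)
qed

lemma independent_coords_indep_vars:
  "independent_coords M Z I \<Longrightarrow> prob_space.indep_vars M (\<lambda>_. borel) Z I"
  by (simp add: independent_coords_def)

text \<open>Boxes over the full finite index set suffice, because single factors may be the whole
  line.\<close>

lemma independent_coords_boxI:
  assumes M: "prob_space M" and I: "finite I" "I \<noteq> {}" and Z: "\<And>i. i \<in> I \<Longrightarrow> Z i \<in> borel_measurable M"
    and box: "\<And>A. (\<And>i. i \<in> I \<Longrightarrow> A i \<in> sets borel) \<Longrightarrow>
      measure M (\<Inter>i\<in>I. Z i -` A i \<inter> space M) = (\<Prod>i\<in>I. measure (coord_law i) (A i))"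
  shows "independent_coords M Z I"
proof (subst independent_coords_iff[OF M I(2) Z])
  interpret prob_space M by fact
  interpret P: product_prob_space coord_law I
    by (simp add: product_prob_space_def product_prob_space_axioms_def product_sigma_finite_def
        prob_space_coord_law prob_space_imp_sigma_finite)
  have m: "(\<lambda>\<omega>. \<lambda>i\<in>I. Z i \<omega>) \<in> measurable M (PiM I (\<lambda>_. borel))"
    using Z by (intro measurable_restrict)
  show "distr M (PiM I (\<lambda>_. borel)) (\<lambda>\<omega>. \<lambda>i\<in>I. Z i \<omega>) = product_law I"
    unfolding product_law_def
  proof (rule P.PiM_eqI[OF I(1)])
    show "sets (distr M (PiM I (\<lambda>_. borel)) (\<lambda>\<omega>. \<lambda>i\<in>I. Z i \<omega>)) = sets (PiM I coord_law)"
      using sets_product_law[of I] by (simp add: product_law_def)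
    fix A assume "\<And>i. i \<in> I \<Longrightarrow> A i \<in> sets (coord_law i)"
    then have A: "\<And>i. i \<in> I \<Longrightarrow> A i \<in> sets borel" by simp
    have "emeasure (distr M (PiM I (\<lambda>_. borel)) (\<lambda>\<omega>. \<lambda>i\<in>I. Z i \<omega>)) (Pi\<^sub>E I A) =
        emeasure M ((\<lambda>\<omega>. \<lambda>i\<in>I. Z i \<omega>) -` (Pi\<^sub>E I A) \<inter> space M)"
      by (rule emeasure_distr[OF m sets_PiM_I_finite[OF I(1) A]])
    also have "(\<lambda>\<omega>. \<lambda>i\<in>I. Z i \<omega>) -` (Pi\<^sub>E I A) \<inter> space M = (\<Inter>i\<in>I. Z i -` A i \<inter> space M)"
      using I(2) by auto
    also have "emeasure M \<dots> = ennreal (\<Prod>i\<in>I. measure (coord_law i) (A i))"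
      unfolding emeasure_eq_measure by (subst box) (use A in simp_all)
    also have "\<dots> = (\<Prod>i\<in>I. emeasure (coord_law i) (A i))"
      by (simp add: prod_ennreal finite_measure.emeasure_eq_measure prob_space.finite_measure prob_space_coord_law)
    finally show "emeasure (distr M (PiM I (\<lambda>_. borel)) (\<lambda>\<omega>. \<lambda>i\<in>I. Z i \<omega>)) (Pi\<^sub>E I A) =
      (\<Prod>i\<in>I. emeasure (coord_law i) (A i))" .
  qed
qed (use Z in auto)

lemma independent_coords_reindex:
  assumes ind: "independent_coords M Z (g ` I)" and I: "finite I" "I \<noteq> {}" "inj_on g I"
    and law: "\<And>i. i \<in> I \<Longrightarrow> coord_law (g i) = coord_law i"
  shows "independent_coords M (\<lambda>i. Z (g i)) I"
proof (rule independent_coords_boxI[OF _ I(1,2)])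
  show "prob_space M" using ind by (simp add: independent_coords_def)
  show "Z (g i) \<in> borel_measurable M" if "i \<in> I" for i
    using independent_coords_measurable[OF ind] that by blast
  fix A assume A: "\<And>i. i \<in> I \<Longrightarrow> A i \<in> sets (borel :: real measure)"
  let ?B = "\<lambda>j. A (inv_into I g j)"
  have "measure M (\<Inter>j\<in>g ` I. Z j -` ?B j \<inter> space M) = (\<Prod>j\<in>g ` I. measure (coord_law j) (?B j))"
    by (rule independent_coords_prob[OF ind]) (use I A in auto)
  moreover have "(\<lambda>j. Z j -` ?B j \<inter> space M) ` g ` I = (\<lambda>i. Z (g i) -` A i \<inter> space M) ` I"
    unfolding image_image by (rule image_cong[OF refl]) (use I(3) in simp)
  moreover have "(\<Prod>j\<in>g ` I. measure (coord_law j) (?B j)) = (\<Prod>i\<in>I. measure (coord_law i) (A i))"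
    using I(3) law by (simp add: prod.reindex)
  ultimately show "measure M (\<Inter>i\<in>I. Z (g i) -` A i \<inter> space M) = (\<Prod>i\<in>I. measure (coord_law i) (A i))"
    by (simp only:)
qed

section \<open>Cylinder events of branches under the limit law\<close>

context cubic_tree
begin

definition branch_coords :: "'v \<times> 'v \<Rightarrow> ('v set + 'v \<times> 'v) set" where
  "branch_coords a = Inl ` branch_edges a \<union> Inr ` descendants E a"

text \<open>A generator, stable under intersection, for the events determined by the coordinates in
  \<open>L\<close>. Cylinders are chosen because each of them is visible in a finite
  subtree.\<close>

definition box_events :: "('v set + 'v \<times> 'v) set \<Rightarrow> ('v set + 'v \<times> 'v \<Rightarrow> real) set set" where
  "box_events L = {{z \<in> space limit_law. \<forall>i\<in>J. z i \<in> A i} | J A.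
     finite J \<and> J \<subseteq> L \<and> (\<forall>i. A i \<in> sets (borel :: real measure))}"

definition group_coords :: "'v set \<Rightarrow> ('v \<times> 'v) option \<Rightarrow> ('v set + 'v \<times> 'v) set" where
  "group_coords S i = (case i of None \<Rightarrow> Inl ` induced_edges E S | Some a \<Rightarrow> branch_coords a)"

lemma branch_edges_E: "branch_edges a \<subseteq> E"
proof
  fix e assume "e \<in> branch_edges a"
  then obtain b where "b \<in> descendants E a" "e = edge b" unfolding branch_edges_iff by blast
  then show "e \<in> E" using descendants_oriented[of a] by (simp add: oriented_iff subset_iff)
qed

lemma branch_coords_subset: "branch_coords a \<subseteq> all_coords"
  unfolding branch_coords_def all_coords_def
  by (intro Un_mono image_mono branch_edges_E descendants_oriented)

lemma group_coords_subset: "group_coords S i \<subseteq> all_coords"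
proof (cases i)
  case None then show ?thesis by (auto simp: group_coords_def all_coords_def induced_edges_def)
next
  case (Some a) then show ?thesis using branch_coords_subset by (simp add: group_coords_def)
qed

lemma limit_law_box:
  assumes "finite J" "J \<subseteq> all_coords" "\<And>i. i \<in> J \<Longrightarrow> A i \<in> sets borel"
  shows "{z \<in> space limit_law. \<forall>i\<in>J. z i \<in> A i} \<in> sets limit_law"
proof -
  have "{z \<in> space limit_law. z i \<in> A i} \<in> sets limit_law" if "i \<in> J" for i
  proof -
    have "(\<lambda>z. z i) -` A i \<inter> space limit_law \<in> sets limit_law"
      using assms(2) that by (intro measurable_sets[OF limit_law_measurable assms(3)]) auto
    moreover have "(\<lambda>z. z i) -` A i \<inter> space limit_law = {z \<in> space limit_law. z i \<in> A i}" by auto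
    ultimately show ?thesis by simp
  qed
  then show ?thesis using assms(1) by (intro sets.sets_Collect_finite_All) auto
qed

lemma box_events_sets: "L \<subseteq> all_coords \<Longrightarrow> box_events L \<subseteq> sets limit_law"
  unfolding box_events_def using limit_law_box by blast

lemma box_events_Int_stable: "Int_stable (box_events L)"
proof (rule Int_stableI)
  fix X Y assume "X \<in> box_events L" "Y \<in> box_events L"
  then obtain J A K B where X: "X = {z \<in> space limit_law. \<forall>i\<in>J. z i \<in> A i}" "finite J" "J \<subseteq> L"
      "\<And>i. A i \<in> sets (borel :: real measure)"
    and Y: "Y = {z \<in> space limit_law. \<forall>i\<in>K. z i \<in> B i}" "finite K" "K \<subseteq> L"
      "\<And>i. B i \<in> sets (borel :: real measure)"
    unfolding box_events_def by blast
  let ?C = "\<lambda>i. (if i \<in> J then A i else UNIV) \<inter> (if i \<in> K then B i else UNIV)"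
  have "X \<inter> Y = {z \<in> space limit_law. \<forall>i\<in>J \<union> K. z i \<in> ?C i}" unfolding X(1) Y(1) by auto
  moreover have "?C i \<in> sets borel" for i using X(4) Y(4) by auto
  ultimately show "X \<inter> Y \<in> box_events L"
    unfolding box_events_def using X(2,3) Y(2,3)
    by (intro CollectI exI[of _ "J \<union> K"] exI[of _ ?C]) simp
qed

lemma measure_limit_law_box:
  assumes R: "finite_subtree T E R" and J: "finite J" "J \<subseteq> inner_coords R" and A: "\<And>i. i \<in> J \<Longrightarrow> A i \<in> sets borel"
  shows "measure limit_law {z \<in> space limit_law. \<forall>i\<in>J. z i \<in> A i} =
    measure (product_law (coords R)) {w \<in> space (product_law (coords R)). \<forall>i\<in>J. full R i w \<in> A i}"
proof -
  let ?B = "Pi\<^sub>E J A"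
  have B: "?B \<in> sets (PiM J (\<lambda>_. borel :: real measure))" using J(1) A by (intro sets_PiM_I_finite) auto
  have m: "(\<lambda>z. \<lambda>i\<in>J. z i) \<in> measurable limit_law (PiM J (\<lambda>_. borel :: real measure))"
    using J(2) coords_subset(2) limit_law_measurable by (intro measurable_restrict) blast
  have "{z \<in> space limit_law. \<forall>i\<in>J. z i \<in> A i} = (\<lambda>z. \<lambda>i\<in>J. z i) -` ?B \<inter> space limit_law" by auto
  also have "measure limit_law \<dots> = measure (config_law R J) ?B"
    unfolding limit_law_restrict[OF R J(2,1), symmetric] by (rule measure_distr[OF m B, symmetric])
  also have "\<dots> = measure (product_law (coords R))
      ((\<lambda>z. \<lambda>i\<in>J. full R i z) -` ?B \<inter> space (product_law (coords R)))"
    unfolding config_law_def by (rule measure_distr[OF restrict_full_measurable[OF R J(2)] B])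
  also have "(\<lambda>z. \<lambda>i\<in>J. full R i z) -` ?B \<inter> space (product_law (coords R)) =
      {w \<in> space (product_law (coords R)). \<forall>i\<in>J. full R i w \<in> A i}" by auto
  finally show ?thesis .
qed

lemma group_coords_disjoint:
  assumes S: "finite_subtree T E S"
  shows "disjoint_family_on (group_coords S) (insert None (Some ` boundary T E S))"
proof -
  note P = branches_partition[OF S, THEN bspec]
  have disj: "branch_coords a \<inter> branch_coords b = {}"
    if ab: "a \<in> boundary T E S" "b \<in> boundary T E S" "a \<noteq> b" for a b
  proof -
    have D: "branch_edges a \<inter> branch_edges b = {}" using P[OF ab(1)] ab by blast
    have "descendants E a \<inter> descendants E b = {}"
    proof (rule ccontr)
      assume "\<not> ?thesis"
      then obtain x where "x \<in> descendants E a" "x \<in> descendants E b" by blast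
      then have "edge x \<in> branch_edges a" "edge x \<in> branch_edges b" unfolding branch_edges_iff by (blast intro: imageI)+
      then show False using D by blast
    qed
    then show ?thesis using D by (auto simp: branch_coords_def)
  qed
  have disj_inner: "branch_coords a \<inter> Inl ` induced_edges E S = {}" if "a \<in> boundary T E S" for a
    using P[OF that] by (auto simp: branch_coords_def)
  show ?thesis
    unfolding disjoint_family_on_def
  proof (intro ballI impI)
    fix i j assume ij: "i \<in> insert None (Some ` boundary T E S)" "j \<in> insert None (Some ` boundary T E S)" "i \<noteq> j"
    then consider a where "i = None" "j = Some a" "a \<in> boundary T E S"
      | a where "i = Some a" "j = None" "a \<in> boundary T E S"
      | a b where "i = Some a" "j = Some b" "a \<in> boundary T E S" "b \<in> boundary T E S" "a \<noteq> b"
      by blast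
    then show "group_coords S i \<inter> group_coords S j = {}"
    proof cases
      case (1 a) then show ?thesis using disj_inner[of a] by (simp add: group_coords_def Int_commute)
    next
      case (2 a) then show ?thesis using disj_inner[of a] by (simp add: group_coords_def)
    next
      case (3 a b) then show ?thesis using disj[of a b] by (simp add: group_coords_def)
    qed
  qed
qed

text \<open>Inside a larger subtree \<open>R\<close>, the coordinates of a group are computed from
  the free coordinates of the same group alone.\<close>

lemma full_group:
  assumes S: "finite_subtree T E S" "finite R" "S \<subseteq> R" and j: "j \<in> insert None (Some ` boundary T E S)"
    and i: "i \<in> group_coords S j" "i \<in> inner_coords R"
  defines "L \<equiv> group_coords S j \<inter> coords R"
  shows "full R i \<in> borel_measurable (PiM L (\<lambda>_. borel)) \<and> (\<forall>w. full R i (restrict w L) = full R i w)"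
proof (cases i)
  case (Inl e)
  then have L: "Inl e \<in> L" using i by (simp add: L_def)
  then have "(\<lambda>w. w (Inl e)) \<in> borel_measurable (PiM L (\<lambda>_. borel :: real measure))"
    by (rule measurable_component_singleton)
  then show ?thesis using L unfolding Inl full_simps by simp
next
  case (Inr b)
  then obtain a where a: "j = Some a" "a \<in> boundary T E S" "b \<in> descendants E a"
    using i j by (cases j) (auto simp: group_coords_def branch_coords_def)
  have aO: "a \<in> oriented E" using a(2) by (simp add: boundary_iff)
  have L: "L = branch_coords a \<inter> coords R" using a by (simp add: L_def group_coords_def)
  have *: "(\<lambda>z. extend R z b) \<in> borel_measurable (PiM L (\<lambda>_. borel)) \<and>
    (\<forall>z. extend R (restrict z L) b = extend R z b)"
  proof (rule extend_measurable[OF S(2), where A = "descendants E a"])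
    show "Inr b \<in> L" if "b \<in> descendants E a" "b \<in> boundary T E R" for b
      using that by (auto simp: L branch_coords_def)
    show "Inl (edge b) \<in> L \<and> children b \<subseteq> descendants E a"
      if b: "b \<in> descendants E a" "b \<in> oriented (induced_edges E R)" for b
    proof
      have "edge b \<in> branch_edges a" unfolding branch_edges_iff using b(1) by (rule imageI)
      moreover have "edge b \<in> induced_edges E R" using b(2) unfolding oriented_induced_iff induced_edge_iff .
      ultimately show "Inl (edge b) \<in> L" by (simp add: L branch_coords_def)
      show "children b \<subseteq> descendants E a" by (rule descendants_child[OF aO b(1)])
    qed
    show "b \<in> descendants E a" by fact
    show "b \<in> oriented (induced_edges E R) \<or> b \<in> boundary T E R" using i(2) Inr by simp
  qed
  then show ?thesis unfolding Inr full_simps by blast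
qed

text \<open>Finitely many cylinders fit into one finite subtree \<open>R\<close> containing
  \<open>S\<close>. There they depend on disjoint groups of independent free coordinates.\<close>

lemma box_events_indep:
  assumes S: "finite_subtree T E S"
  shows "prob_space.indep_sets limit_law (\<lambda>j. box_events (group_coords S j)) (insert None (Some ` boundary T E S))"
proof -
  interpret limit: prob_space limit_law by (rule prob_space_limit_law)
  let ?I = "insert None (Some ` boundary T E S)"
  show ?thesis
  proof (rule limit.indep_setsI)
    fix j assume "j \<in> ?I"
    show "box_events (group_coords S j) \<subseteq> limit.events" by (rule box_events_sets[OF group_coords_subset])
  next
    fix X J assume J: "J \<noteq> {}" "J \<subseteq> ?I" "finite J" "\<forall>j\<in>J. X j \<in> box_events (group_coords S j)"
    let ?Q = "\<lambda>j KA. X j = {z \<in> space limit_law. \<forall>i\<in>fst KA. z i \<in> snd KA i} \<and>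
        finite (fst KA) \<and> fst KA \<subseteq> group_coords S j \<and> (\<forall>i. snd KA i \<in> sets (borel :: real measure))"
    have "\<exists>KA. ?Q j KA" if "j \<in> J" for j
    proof -
      have "X j \<in> box_events (group_coords S j)" using J(4) that by blast
      then obtain L B where "X j = {z \<in> space limit_law. \<forall>i\<in>L. z i \<in> B i}" "finite L" "L \<subseteq> group_coords S j"
        "\<forall>i. B i \<in> sets (borel :: real measure)" unfolding box_events_def mem_Collect_eq by (elim exE conjE)
      then have "?Q j (L, B)" by (simp only: fst_conv snd_conv simp_thms)
      then show ?thesis by (rule exI)
    qed
    then have "\<forall>j\<in>J. \<exists>KA. ?Q j KA" by (rule ballI)
    then obtain KA where KA': "\<forall>j\<in>J. ?Q j (KA j)" by (rule bchoice[THEN exE])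
    note KA = bspec[OF KA']
    define K where "K j = fst (KA j)" for j
    define A where "A j = snd (KA j)" for j
    have X: "X j = {z \<in> space limit_law. \<forall>i\<in>K j. z i \<in> A j i}" if "j \<in> J" for j
      unfolding K_def A_def using KA[OF that] by (elim conjE)
    have K: "finite (K j)" "K j \<subseteq> group_coords S j" if "j \<in> J" for j
      unfolding K_def
      by (rule KA[OF that, THEN conjunct2, THEN conjunct1] KA[OF that, THEN conjunct2, THEN conjunct2, THEN conjunct1])+
    have A: "A j i \<in> sets borel" if "j \<in> J" for j i
      unfolding A_def by (rule KA[OF that, THEN conjunct2, THEN conjunct2, THEN conjunct2, THEN spec])
    define K0 where "K0 = (\<Union>j\<in>J. K j)"
    have K0: "finite K0" "K0 \<subseteq> all_coords" using K J(3) group_coords_subset unfolding K0_def by blast+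
    obtain R0 where R0: "finite_subtree T E R0" "K0 \<subseteq> inner_coords R0" using cover_exists[OF K0] by blast
    obtain R where R: "finite_subtree T E R" "S \<subseteq> R" "R0 \<subseteq> R"
      using subtree_cover[OF S, of R0] R0(1) by (auto simp: finite_subtree_iff)
    have K0R: "K0 \<subseteq> inner_coords R" using R0(2) inner_coords_mono[OF R(3)] by blast
    have fR: "finite R" using R(1) by (rule finite_subtree_finite)
    let ?N = "product_law (coords R)"
    interpret N: prob_space ?N by (rule prob_space_product_law)
    \<comment> \<open>Indicators of the events, as functions of the free coordinates, so that
      independence of random variables can be used.\<close>
    let ?Y = "\<lambda>j w. if \<forall>i\<in>K j. full R i w \<in> A j i then 1 else 0 :: real"
    let ?L = "\<lambda>j. group_coords S j \<inter> coords R"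
    have Kin: "i \<in> group_coords S j" "i \<in> inner_coords R" if "j \<in> J" "i \<in> K j" for i j
      using K(2)[OF that(1)] K0R that by (auto simp: K0_def)
    have fg: "full R i \<in> borel_measurable (PiM (?L j) (\<lambda>_. borel))" "full R i (restrict w (?L j)) = full R i w"
      if "j \<in> J" "i \<in> K j" for i j w
    proof -
      note F = full_group[OF S fR R(2) subsetD[OF J(2) that(1)] Kin[OF that]]
      show "full R i \<in> borel_measurable (PiM (?L j) (\<lambda>_. borel))" by (rule F[THEN conjunct1])
      show "full R i (restrict w (?L j)) = full R i w" by (rule F[THEN conjunct2, THEN spec])
    qed
    have Nind: "N.indep_vars (\<lambda>_. borel) (\<lambda>i w. w i) (coords R)"
      by (rule independent_coords_indep_vars[OF product_law_coords[OF coords_nonempty[OF R(1)]]])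
    have indY: "N.indep_vars (\<lambda>_. borel) ?Y J"
    proof (rule N.indep_vars_group[OF Nind, where L = ?L and h = ?Y and J = J and N = "\<lambda>_. borel" and Y = ?Y])
      show "disjoint_family_on ?L J"
        unfolding disjoint_family_on_def
      proof (intro ballI impI)
        fix i j assume "i \<in> J" "j \<in> J" "i \<noteq> j"
        then have "group_coords S i \<inter> group_coords S j = {}"
          by (intro disjoint_family_onD[OF group_coords_disjoint[OF S]] subsetD[OF J(2)])
        then show "?L i \<inter> ?L j = {}" by blast
      qed
      fix j assume j: "j \<in> J"
      show "?L j \<subseteq> coords R" by blast
      show "?Y j \<in> borel_measurable (PiM (?L j) (\<lambda>_. borel))"
      proof (rule measurable_If)
        have "{w \<in> space (PiM (?L j) (\<lambda>_. borel)). full R i w \<in> A j i} \<in> sets (PiM (?L j) (\<lambda>_. borel))"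
          if "i \<in> K j" for i
          using measurable_sets[OF fg(1)[OF j that] A[OF j, of i]] by (simp add: vimage_def Int_def conj_commute)
        then show "{w \<in> space (PiM (?L j) (\<lambda>_. borel)). \<forall>i\<in>K j. full R i w \<in> A j i} \<in> sets (PiM (?L j) (\<lambda>_. borel))"
          using K(1)[OF j] by (intro sets.sets_Collect_finite_All) auto
      qed simp_all
      show "?Y j = (\<lambda>w. ?Y j (restrict w (?L j)))" by (rule ext) (simp add: fg(2)[OF j] del: restrict_apply)
    qed
    \<comment> \<open>Needed for \<open>J\<close> itself and for its singletons, which give the two
      sides of the product formula.\<close>
    have transfer: "limit.prob (\<Inter>j\<in>J'. X j) = N.prob (\<Inter>j\<in>J'. ?Y j -` {1} \<inter> space ?N)"
      if J': "J' \<subseteq> J" "J' \<noteq> {}" for J'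
    proof -
      let ?K = "\<Union>j\<in>J'. K j"
      \<comment> \<open>Combines the cylinders into a single one by collecting all constraints on
        each coordinate.\<close>
      let ?A = "\<lambda>i. \<Inter>j\<in>{j\<in>J'. i \<in> K j}. A j i"
      have "finite J'" using J(3) J'(1) by (rule finite_subset[rotated])
      have XX: "z \<in> X j \<longleftrightarrow> z \<in> space limit_law \<and> (\<forall>i\<in>K j. z i \<in> A j i)" if "j \<in> J'" for j z
        unfolding X[OF subsetD[OF J'(1) that]] by simp
      obtain j0 where j0: "j0 \<in> J'" using J'(2) by blast
      have "(\<Inter>j\<in>J'. X j) = {z \<in> space limit_law. \<forall>i\<in>?K. z i \<in> ?A i}"
        using XX j0 by blast
      also have "limit.prob \<dots> = N.prob {w \<in> space ?N. \<forall>i\<in>?K. full R i w \<in> ?A i}"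
      proof (rule measure_limit_law_box[OF R(1)])
        show "finite ?K" using K(1) J'(1) \<open>finite J'\<close> by auto
        show "?K \<subseteq> inner_coords R" using J'(1) K0R by (auto simp: K0_def)
        show "?A i \<in> sets borel" if "i \<in> ?K" for i
          using that \<open>finite J'\<close> A J'(1) by (intro sets.finite_INT) auto
      qed
      also have "{w \<in> space ?N. \<forall>i\<in>?K. full R i w \<in> ?A i} = (\<Inter>j\<in>J'. ?Y j -` {1} \<inter> space ?N)"
        using j0 by (auto split: if_splits)
      finally show ?thesis .
    qed
    have "limit.prob (\<Inter>j\<in>J. X j) = N.prob (\<Inter>j\<in>J. ?Y j -` {1} \<inter> space ?N)"
      by (rule transfer) (use J in auto)
    also have "\<dots> = (\<Prod>j\<in>J. N.prob (?Y j -` {1} \<inter> space ?N))"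
      by (rule N.indep_varsD_finite[OF indY J(1,3)]) simp
    also have "\<dots> = (\<Prod>j\<in>J. limit.prob (X j))"
      by (rule prod.cong[OF refl]) (use transfer[of "{j}" for j] in simp)
    finally show "limit.prob (\<Inter>j\<in>J. X j) = (\<Prod>j\<in>J. limit.prob (X j))" .
  qed
qed

definition group_events :: "'v set \<Rightarrow> ('v \<times> 'v) option \<Rightarrow> ('v set + 'v \<times> 'v \<Rightarrow> real) set set" where
  "group_events S j = sigma_sets (space limit_law) (box_events (group_coords S j))"

lemma group_events_indep:
  "finite_subtree T E S \<Longrightarrow>
   prob_space.indep_sets limit_law (group_events S) (insert None (Some ` boundary T E S))"
  unfolding group_events_def
  by (rule prob_space.indep_sets_sigma[OF prob_space_limit_law box_events_indep box_events_Int_stable])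

end

section \<open>Existence of the coupling\<close>

text \<open>\<open>iid_uniform\<close> asks for labels in the unit interval everywhere, while the
  coordinates of the limit law lie there only almost surely.\<close>

definition clip :: "real \<Rightarrow> real" where "clip x = max 0 (min 1 x)"

lemma clip_measurable [measurable]: "clip \<in> borel_measurable borel"
  unfolding clip_def by measurable

lemma clip_range: "clip x \<in> {0..1}" by (simp add: clip_def)

lemma clip_id: "x \<in> {0..1} \<Longrightarrow> clip x = x" by (simp add: clip_def)

lemma joint_law_distr:
  assumes \<Phi>: "\<Phi> \<in> measurable N P" and m: "(\<lambda>x. (\<lambda>e\<in>A. U e x, F x)) \<in> measurable P (pair_space A D)"
  shows "joint_law A D (distr N P \<Phi>) U F = joint_law A D N (\<lambda>e z. U e (\<Phi> z)) (\<lambda>z. F (\<Phi> z))"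
  unfolding joint_law_def using m \<Phi> by (subst distr_distr) (auto simp: comp_def)

lemma measurable_pair_space:
  assumes "\<And>e. e \<in> A \<Longrightarrow> U e \<in> borel_measurable M" "F \<in> measurable M (subset_space D)"
  shows "(\<lambda>x. (\<lambda>e\<in>A. U e x, F x)) \<in> measurable M (pair_space A D)"
  unfolding pair_space_def using assms by (intro measurable_Pair measurable_restrict)

lemma space_pair_space: "space (pair_space A D) = (A \<rightarrow>\<^sub>E UNIV) \<times> Pow D"
  by (simp add: pair_space_def space_pair_measure space_PiM)

lemma pair_space_label: "e \<in> A \<Longrightarrow> (\<lambda>x. fst x e) \<in> borel_measurable (pair_space A D)"
  unfolding pair_space_def
  by (rule measurable_compose[OF measurable_fst measurable_component_singleton])

lemma pair_space_snd: "snd \<in> measurable (pair_space A D) (subset_space D)"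
  unfolding pair_space_def by (rule measurable_snd)

context cubic_tree
begin

definition branch_events :: "'v \<times> 'v \<Rightarrow> ('v set + 'v \<times> 'v \<Rightarrow> real) set set" where
  "branch_events a = sigma_sets (space limit_law) (box_events (branch_coords a))"

lemma group_events_Some: "group_events S (Some a) = branch_events a"
  by (simp add: group_events_def branch_events_def group_coords_def)

lemma box_events_singleton:
  assumes "i \<in> L" "A \<in> sets borel" shows "{z \<in> space limit_law. z i \<in> A} \<in> box_events L"
  unfolding box_events_def using assms
  by (intro CollectI exI[of _ "{i}"] exI[of _ "\<lambda>_. A"]) auto

lemma box_events_Pow: "box_events L \<subseteq> Pow (space limit_law)"
  by (auto simp: box_events_def)

lemma box_events_mono: "L \<subseteq> L' \<Longrightarrow> box_events L \<subseteq> box_events L'"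
  unfolding box_events_def by blast

lemma branch_coords_label:
  "b \<in> descendants E a \<Longrightarrow> Inl (edge b) \<in> branch_coords a \<and> Inr b \<in> branch_coords a"
  unfolding branch_coords_def branch_edges_iff by blast

lemma limit_law_tail:
  assumes a: "a \<in> oriented E" and t: "0 \<le> t" "t \<le> 1"
  shows "measure limit_law {z \<in> space limit_law. t < z (Inr a)} = tail t"
proof -
  have S: "finite_subtree T E {fst a}" using orientedD[OF a] finite_subtree_singleton by blast
  have i: "Inr a \<in> coords {fst a}" using a by (simp add: boundary_singleton)
  have "measure limit_law (\<Inter>i\<in>{Inr a}. (\<lambda>z. z i) -` {t<..} \<inter> space limit_law) =
      (\<Prod>i\<in>{Inr a}. measure (coord_law i) {t<..})"
    by (rule independent_coords_prob[OF limit_law_independent[OF S]]) (use i in auto)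
  moreover have "(\<Inter>i\<in>{Inr a}. (\<lambda>z. z i) -` {t<..} \<inter> space limit_law) = {z \<in> space limit_law. t < z (Inr a)}"
    by auto
  ultimately show ?thesis using time_law_tail[OF t] by simp
qed

lemma limit_law_label:
  assumes e: "e \<in> E" shows "distr limit_law borel (\<lambda>z. z (Inl e)) = uniform_01"
proof -
  obtain a where a: "a \<in> oriented E" "e = edge a" using e by (rule edge_cases)
  have "independent_coords limit_law (\<lambda>i z. z i) (coords (edge a))"
    by (rule limit_law_independent[OF subtree_edge(1)[OF a(1)]])
  moreover have "Inl e \<in> coords (edge a)" using subtree_edge(2)[OF a(1)] a(2) by simp
  ultimately have "distr limit_law borel (\<lambda>z. z (Inl e)) = coord_law (Inl e)"
    unfolding independent_coords_def by blast
  then show ?thesis by simp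
qed

lemma limit_law_label_range: "AE z in limit_law. \<forall>e\<in>E. z (Inl e) \<in> {0..1}"
proof (subst AE_ball_countable[OF countable_edges], intro ballI)
  fix e assume e: "e \<in> E"
  then have "(\<lambda>z. z (Inl e)) \<in> borel_measurable limit_law" by (intro limit_law_measurable) simp
  then show "AE z in limit_law. z (Inl e) \<in> {0..1}"
    by (rule AE_distrD) (unfold limit_law_label[OF e], rule AE_uniform_01)
qed

text \<open>Independence of a label and the two child branches is the case of (iii) for the subtree
  formed by a single edge.\<close>

lemma limit_branch_process:
  "branch_process T E limit_law (\<lambda>e z. z (Inl e)) (\<lambda>b z. z (Inr b)) branch_events tail"
proof (intro branch_process.intro branch_process_axioms.intro)
  show "cubic_tree T E" by (rule cubic_tree_axioms)
  show "prob_space limit_law" by (rule prob_space_limit_law)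
  interpret limit: prob_space limit_law by (rule prob_space_limit_law)
  show "sigma_algebra (space limit_law) (branch_events a)" for a
    unfolding branch_events_def by (rule sigma_algebra_sigma_sets[OF box_events_Pow])
  show "branch_events a \<subseteq> limit.events" for a
    unfolding branch_events_def by (rule sets.sigma_sets_subset[OF box_events_sets[OF branch_coords_subset]])
  show "branch_events c \<subseteq> branch_events a" if ac: "a \<in> oriented E" "c \<in> children a" for a c
  proof -
    have "descendants E c \<subseteq> descendants E a" using descendants_unfold[OF ac(1)] ac(2) by blast
    then have "branch_coords c \<subseteq> branch_coords a"
      unfolding branch_coords_def branch_edges_iff by (intro Un_mono image_mono)
    then show ?thesis unfolding branch_events_def by (intro sigma_sets_mono' box_events_mono)
  qed
  show "{z \<in> space limit_law. t < z (Inr a)} \<in> branch_events a" if a: "a \<in> oriented E" for a t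
  proof -
    have "{z \<in> space limit_law. z (Inr a) \<in> {t<..}} \<in> box_events (branch_coords a)"
      using branch_coords_label[OF descendants_self[OF a]] by (intro box_events_singleton) auto
    then show ?thesis unfolding branch_events_def by (intro sigma_sets.Basic) simp
  qed
  show U_B: "{z \<in> space limit_law. z (Inl (edge a)) \<le> t} \<in> branch_events a" if a: "a \<in> oriented E" for a t
  proof -
    have "{z \<in> space limit_law. z (Inl (edge a)) \<in> {..t}} \<in> box_events (branch_coords a)"
      using branch_coords_label[OF descendants_self[OF a]] by (intro box_events_singleton) auto
    then show ?thesis unfolding branch_events_def by (intro sigma_sets.Basic) simp
  qed
  show "AE z in limit_law. recursion_at (\<lambda>e. z (Inl e)) (\<lambda>b. z (Inr b)) a" if "a \<in> oriented E" for a
    by (rule limit_law_recursion[OF that])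
  show "limit.prob {z \<in> space limit_law. t < z (Inr a)} = tail t"
    if "a \<in> oriented E" "0 \<le> t" "t \<le> 1" for a t by (rule limit_law_tail[OF that])
  show "limit.prob ({z \<in> space limit_law. z (Inl (edge a)) \<le> t} \<inter> C \<inter> D) = t * limit.prob C * limit.prob D"
    if a: "a \<in> oriented E" and cd: "children a = {c, d}" "c \<noteq> d" and CD: "C \<in> branch_events c" "D \<in> branch_events d"
      and t: "0 \<le> t" "t \<le> 1" for a c d C D t
  proof -
    note S = subtree_edge[OF a]
    let ?A = "{z \<in> space limit_law. z (Inl (edge a)) \<le> t}"
    let ?X = "\<lambda>j. case j of None \<Rightarrow> ?A | Some b \<Rightarrow> if b = c then C else D"
    have "limit.prob (\<Inter>j\<in>{None, Some c, Some d}. ?X j) = (\<Prod>j\<in>{None, Some c, Some d}. limit.prob (?X j))"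
    proof (rule limit.indep_setsD[OF group_events_indep[OF S(1)]])
      show "{None, Some c, Some d} \<subseteq> insert None (Some ` boundary T E (edge a))"
        unfolding S(3) using cd(1) by blast
      have "{z \<in> space limit_law. z (Inl (edge a)) \<in> {..t}} \<in> box_events (group_coords (edge a) None)"
        by (rule box_events_singleton) (simp_all add: group_coords_def S(2))
      then have "?A \<in> group_events (edge a) None" unfolding group_events_def by (intro sigma_sets.Basic) simp
      then show "\<forall>j\<in>{None, Some c, Some d}. ?X j \<in> group_events (edge a) j"
        using CD cd(2) by (simp add: group_events_Some)
    qed auto
    moreover have "(\<Inter>j\<in>{None, Some c, Some d}. ?X j) = ?A \<inter> C \<inter> D" using cd(2) by auto
    moreover have "limit.prob ?A = t"
    proof -
      have e: "edge a \<in> E" using a by (simp add: oriented_iff)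
      have "limit.prob ((\<lambda>z. z (Inl (edge a))) -` {..t} \<inter> space limit_law) = measure uniform_01 {..t}"
        unfolding limit_law_label[OF e, symmetric]
        by (rule measure_distr[symmetric]) (use e in \<open>auto intro: limit_law_measurable\<close>)
      moreover have "(\<lambda>z. z (Inl (edge a))) -` {..t} \<inter> space limit_law = ?A" by auto
      ultimately show ?thesis using uniform_01_atMost[OF t] by simp
    qed
    ultimately show ?thesis using cd(2) by simp
  qed
qed

section \<open>The coupling read off from a configuration\<close>

abbreviation frozen_config :: "('v set + 'v \<times> 'v \<Rightarrow> real) \<Rightarrow> ('v \<times> 'v) set" where
  "frozen_config z \<equiv> frozen_edges (\<lambda>e. z (Inl e)) (\<lambda>b. z (Inr b))"

text \<open>For \<open>tail\<close> the process is never supercritical, so it dies out at every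
  rational level, and the coordinates of the limit are true percolation times.\<close>

lemma limit_ray_condition: "AE z in limit_law. ray_condition E (\<lambda>e. z (Inl e)) (frozen_config z)"
proof -
  interpret branch_process T E limit_law "\<lambda>e z. z (Inl e)" "\<lambda>b z. z (Inr b)" branch_events tail
    by (rule limit_branch_process)
  have crit: "2 * t * tail t \<le> 1" if "0 \<le> t" "t \<le> 1" for t
    using that by (auto simp: tail_def)
  have "AE z in limit_law. \<forall>a\<in>oriented E. \<forall>t\<in>\<rat> \<inter> {0..1}. t < z (Inr a) \<longrightarrow>
      \<not> percolates (\<lambda>e. z (Inl e)) (frozen_config z) t a"
  proof (subst AE_ball_countable[OF countable_oriented], intro ballI)
    fix a assume a: "a \<in> oriented E"
    have "countable (\<rat> \<inter> {0..1::real})" using countable_rat by (rule countable_Int1)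
    then show "AE z in limit_law. \<forall>t\<in>\<rat> \<inter> {0..1}. t < z (Inr a) \<longrightarrow>
      \<not> percolates (\<lambda>e. z (Inl e)) (frozen_config z) t a"
      by (subst AE_ball_countable) (use no_late_percolation[OF a _ _ crit] in auto)
  qed
  then show ?thesis
    using recursion_all limit_law_label_range
  proof eventually_elim
    case (elim z)
    show ?case
    proof (rule recursion_ray_condition)
      fix a t assume "a \<in> oriented E" "t \<in> \<rat>" "0 \<le> t" "t \<le> 1" "t < z (Inr a)"
      then show "\<not> percolates (\<lambda>e. z (Inl e)) (frozen_config z) t a"
        using elim(1)[rule_format, of a t] by auto
    qed (use elim(2,3) in auto)
  qed
qed

lemma ray_condition_cong:
  assumes "\<And>e. e \<in> E \<Longrightarrow> u e = u' e" shows "ray_condition E u F \<longleftrightarrow> ray_condition E u' F"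
proof -
  have "edges_upto E u t = edges_upto E u' t" for t using assms by (auto simp: edges_upto_def)
  moreover have "u {v, w} = u' {v, w}" if "(v, w) \<in> oriented E" for v w
    using that assms by (simp add: oriented_def)
  ultimately show ?thesis unfolding ray_condition_def
    by (intro ball_cong refl) clarsimp
qed

definition config_pair :: "('v set + 'v \<times> 'v \<Rightarrow> real) \<Rightarrow> ('v set \<Rightarrow> real) \<times> ('v \<times> 'v) set" where
  "config_pair z = (\<lambda>e\<in>E. z (Inl e), frozen_config z)"

lemma frozen_edges_member:
  assumes "b \<in> oriented E" "U (edge b) \<in> borel_measurable M"
    and "\<And>c. c \<in> children b \<Longrightarrow> X c \<in> borel_measurable M"
  shows "{\<omega> \<in> space M. b \<in> frozen_edges (\<lambda>e. U e \<omega>) (\<lambda>c. X c \<omega>)} \<in> sets M"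
proof -
  obtain c d where cd: "children b = {c, d}" "c \<noteq> d" using children_pair[OF assms(1)] .
  have [measurable]: "X c \<in> borel_measurable M" "X d \<in> borel_measurable M" "U (edge b) \<in> borel_measurable M"
    using assms cd by auto
  have "{\<omega> \<in> space M. min (X c \<omega>) (X d \<omega>) \<le> U (edge b) \<omega>} \<in> sets M" by measurable
  then show ?thesis using assms(1) cd by (simp add: frozen_edges_def)
qed

lemma frozen_edges_subset: "frozen_edges u x \<subseteq> oriented E"
  by (auto simp: frozen_edges_def)

lemma frozen_edges_measurable:
  assumes "\<And>e. e \<in> E \<Longrightarrow> U e \<in> borel_measurable M" "\<And>b. b \<in> oriented E \<Longrightarrow> X b \<in> borel_measurable M"
  shows "(\<lambda>\<omega>. frozen_edges (\<lambda>e. U e \<omega>) (\<lambda>c. X c \<omega>)) \<in> measurable M (subset_space (oriented E))"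
proof (rule measurable_subset_space[OF frozen_edges_subset])
  fix b assume b: "b \<in> oriented E"
  show "{\<omega> \<in> space M. b \<in> frozen_edges (\<lambda>e. U e \<omega>) (\<lambda>c. X c \<omega>)} \<in> sets M"
    by (rule frozen_edges_member[OF b]) (use assms b childrenD(1) in \<open>auto simp: oriented_iff\<close>)
qed

lemma config_pair_measurable:
  assumes "sets M = sets (PiM all_coords (\<lambda>_. borel))"
  shows "config_pair \<in> measurable M (pair_space E (oriented E))"
proof -
  have c: "(\<lambda>z. z i) \<in> borel_measurable M" if "i \<in> all_coords" for i
    using measurable_component_singleton[OF that] by (subst measurable_cong_sets[OF assms refl])
  show ?thesis unfolding config_pair_def
    by (intro measurable_pair_space frozen_edges_measurable c) simp_all
qed

definition coupling_law :: "(('v set \<Rightarrow> real) \<times> ('v \<times> 'v) set) measure" where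
  "coupling_law = distr limit_law (pair_space E (oriented E)) config_pair"

text \<open>Agreement of \<open>U\<close> and \<open>F\<close> with the process is required almost
  surely only, which absorbs the clipping of labels and the null set where (i) fails.\<close>

lemma joint_law_coupling:
  assumes M: "prob_space M" and Z: "\<And>i. i \<in> all_coords \<Longrightarrow> Z i \<in> borel_measurable M"
    and rec: "\<And>b. b \<in> oriented E \<Longrightarrow> AE \<omega> in M. recursion_at (\<lambda>e. Z (Inl e) \<omega>) (\<lambda>b. Z (Inr b) \<omega>) b"
    and ind: "\<And>S. finite_subtree T E S \<Longrightarrow> independent_coords M Z (coords S)"
    and U: "\<And>e. e \<in> E \<Longrightarrow> U e \<in> borel_measurable M" and F: "F \<in> measurable M (subset_space (oriented E))"
    and eqU: "AE \<omega> in M. \<forall>e\<in>E. U e \<omega> = Z (Inl e) \<omega>"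
    and eqF: "AE \<omega> in M. F \<omega> = frozen_edges (\<lambda>e. Z (Inl e) \<omega>) (\<lambda>b. Z (Inr b) \<omega>)"
  shows "joint_law E (oriented E) M U F = coupling_law"
proof -
  let ?z = "\<lambda>\<omega>. \<lambda>i\<in>all_coords. Z i \<omega>"
  have zM: "?z \<in> measurable M (PiM all_coords (\<lambda>_. borel))" using Z by (intro measurable_restrict)
  have cz: "config_pair (?z \<omega>) = (\<lambda>e\<in>E. Z (Inl e) \<omega>, frozen_edges (\<lambda>e. Z (Inl e) \<omega>) (\<lambda>b. Z (Inr b) \<omega>))" for \<omega>
  proof -
    have "Min ((\<lambda>c. ?z \<omega> (Inr c)) ` children b) = Min ((\<lambda>c. Z (Inr c) \<omega>) ` children b)" for b
      using childrenD(1) by (intro arg_cong[where f = Min] image_cong) auto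
    then have "frozen_config (?z \<omega>) = frozen_edges (\<lambda>e. Z (Inl e) \<omega>) (\<lambda>b. Z (Inr b) \<omega>)"
      unfolding frozen_edges_def by (intro Collect_cong conj_cong refl) (simp add: oriented_iff)
    then show ?thesis by (auto simp: config_pair_def)
  qed
  have cm: "config_pair \<in> measurable (PiM all_coords (\<lambda>_. borel)) (pair_space E (oriented E))"
    by (rule config_pair_measurable) simp
  have L: "distr M (PiM all_coords (\<lambda>_. borel)) ?z = limit_law"
    by (rule limit_law_unique[OF M Z rec ind])
  have "coupling_law = distr (distr M (PiM all_coords (\<lambda>_. borel)) ?z) (pair_space E (oriented E)) config_pair"
    unfolding coupling_law_def L ..
  also have "\<dots> = distr M (pair_space E (oriented E)) (\<lambda>\<omega>. config_pair (?z \<omega>))"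
    using zM cm by (subst distr_distr) (auto simp: comp_def)
  also have "\<dots> = joint_law E (oriented E) M U F"
    unfolding joint_law_def
  proof (rule distr_cong_AE[OF refl refl])
    show "AE \<omega> in M. config_pair (?z \<omega>) = (\<lambda>e\<in>E. U e \<omega>, F \<omega>)"
      using eqU eqF by eventually_elim (auto simp: cz)
    show "(\<lambda>\<omega>. config_pair (?z \<omega>)) \<in> measurable M (pair_space E (oriented E))"
      by (rule measurable_compose[OF zM cm])
    show "(\<lambda>\<omega>. (\<lambda>e\<in>E. U e \<omega>, F \<omega>)) \<in> measurable M (pair_space E (oriented E))"
      by (rule measurable_pair_space[OF U F])
  qed
  finally show ?thesis ..
qed

lemma reach_measurable:
  assumes "\<And>b. b \<in> D \<Longrightarrow> {\<omega> \<in> space M. G \<omega> b} \<in> sets M" "\<And>b. b \<in> D \<Longrightarrow> children b \<subseteq> D" "b \<in> D"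
  shows "{\<omega> \<in> space M. reach (\<lambda>_. True) (G \<omega>) n b} \<in> sets M"
  using assms(3)
proof (induction n arbitrary: b)
  case (Suc n)
  have "{\<omega> \<in> space M. \<exists>c\<in>children b. reach (\<lambda>_. True) (G \<omega>) n c} \<in> sets M"
    using Suc.IH assms(2)[OF Suc.prems] by (intro sets.sets_Collect_finite_Ex) auto
  from sets.Int[OF assms(1)[OF Suc.prems] this] show ?case by (simp add: Int_def conj_ac)
qed simp

text \<open>\<open>D\<close> is a set closed under children: the descendants of \<open>a\<close>
  give measurability with respect to the branch, all oriented edges give (i). The level may be
  random because (i) takes it from a label.\<close>

lemma percolates_measurable:
  assumes U: "\<And>b. b \<in> D \<Longrightarrow> U (edge b) \<in> borel_measurable M"
    and t: "t \<in> borel_measurable M"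
    and F: "\<And>b. b \<in> D \<Longrightarrow> {\<omega> \<in> space M. b \<in> F \<omega>} \<in> sets M"
    and D: "\<And>b. b \<in> D \<Longrightarrow> children b \<subseteq> D" "a \<in> D"
  shows "{\<omega> \<in> space M. percolates (\<lambda>e. U e \<omega>) (F \<omega>) (t \<omega>) a} \<in> sets M"
proof -
  have "{\<omega> \<in> space M. reach (\<lambda>_. True) (\<lambda>b. U (edge b) \<omega> \<le> t \<omega> \<and> b \<notin> F \<omega>) n a} \<in> sets M" for n
  proof (rule reach_measurable[OF _ D])
    fix b assume b: "b \<in> D"
    have [measurable]: "U (edge b) \<in> borel_measurable M" "t \<in> borel_measurable M" using U[OF b] t by auto
    have "{\<omega> \<in> space M. U (edge b) \<omega> \<le> t \<omega>} \<in> sets M" by measurable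
    then show "{\<omega> \<in> space M. U (edge b) \<omega> \<le> t \<omega> \<and> b \<notin> F \<omega>} \<in> sets M"
      using F[OF b] by (intro sets.sets_Collect_conj sets.sets_Collect_neg)
  qed
  then show ?thesis unfolding percolates_def by (intro sets.sets_Collect_countable_All)
qed

lemma ray_condition_measurable:
  assumes "\<And>e. e \<in> E \<Longrightarrow> U e \<in> borel_measurable M" "F \<in> measurable M (subset_space (oriented E))"
  shows "{\<omega> \<in> space M. ray_condition E (\<lambda>e. U e \<omega>) (F \<omega>)} \<in> sets M"
proof -
  have U: "U (edge b) \<in> borel_measurable M" if "b \<in> oriented E" for b using assms(1) that by (simp add: oriented_iff)
  have "{\<omega> \<in> space M. a \<in> F \<omega> \<longleftrightarrow> (\<exists>c\<in>children a. percolates (\<lambda>e. U e \<omega>) (F \<omega>) (U (edge a) \<omega>) c)} \<in> sets M"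
    if a: "a \<in> oriented E" for a
  proof -
    have "{\<omega> \<in> space M. percolates (\<lambda>e. U e \<omega>) (F \<omega>) (U (edge a) \<omega>) c} \<in> sets M" if c: "c \<in> children a" for c
    proof (rule percolates_measurable[where D = "oriented E"])
      show "children b \<subseteq> oriented E" for b using childrenD(1) by blast
      show "c \<in> oriented E" using childrenD(1)[OF c] .
    qed (use U a subset_space_member[OF assms(2)] in auto)
    then have "{\<omega> \<in> space M. \<exists>c\<in>children a. percolates (\<lambda>e. U e \<omega>) (F \<omega>) (U (edge a) \<omega>) c} \<in> sets M"
      by (intro sets.sets_Collect_finite_Ex) auto
    moreover have "{\<omega> \<in> space M. a \<in> F \<omega>} \<in> sets M" by (rule subset_space_member[OF assms(2)])
    ultimately show ?thesis unfolding iff_conv_conj_imp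
      by (intro sets.sets_Collect_conj sets.sets_Collect_imp)
  qed
  then show ?thesis unfolding ray_condition_iff
    by (intro sets.sets_Collect_countable_All'[OF _ countable_oriented])
qed

end

text \<open>Empty \<open>J\<close> is included, as a subtree with one vertex has no inner
  edge.\<close>

lemma indep_vars_prob_Ball:
  assumes "prob_space M" "prob_space.indep_vars M (\<lambda>_. borel) U I" "finite J" "J \<subseteq> I" "\<And>i. i \<in> J \<Longrightarrow> A i \<in> sets borel"
  shows "measure M {\<omega> \<in> space M. \<forall>i\<in>J. U i \<omega> \<in> A i} = (\<Prod>i\<in>J. measure M (U i -` A i \<inter> space M))"
proof -
  interpret prob_space M by fact
  show ?thesis
  proof (cases "J = {}")
    case True then show ?thesis by (simp add: prob_space)
  next
    case False
    have "{\<omega> \<in> space M. \<forall>i\<in>J. U i \<omega> \<in> A i} = (\<Inter>i\<in>J. U i -` A i \<inter> space M)" using False by auto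
    then show ?thesis using indep_varsD[OF assms(2) False assms(3-5)] by simp
  qed
qed

context cubic_tree
begin

lemma clip_coord_measurable: "e \<in> E \<Longrightarrow> (\<lambda>z. clip (z (Inl e))) \<in> borel_measurable limit_law"
  by (rule measurable_compose[OF _ clip_measurable]) (simp add: limit_law_measurable)

text \<open>Any finite set of edges lies inside some finite subtree, where the inner labels are
  among the independent free coordinates.\<close>

lemma limit_labels_indep:
  "prob_space.indep_sets limit_law
     (\<lambda>e. {(\<lambda>z. clip (z (Inl e))) -` B \<inter> space limit_law | B. B \<in> sets borel}) E"
proof -
  interpret limit: prob_space limit_law by (rule prob_space_limit_law)
  show ?thesis
  proof (rule limit.indep_setsI)
    show "{(\<lambda>z. clip (z (Inl e))) -` B \<inter> space limit_law | B. B \<in> sets borel} \<subseteq> limit.events" if "e \<in> E" for e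
      using measurable_sets[OF clip_coord_measurable[OF that]] by blast
    fix A J assume J: "J \<noteq> {}" "J \<subseteq> E" "finite J"
      "\<forall>e\<in>J. A e \<in> {(\<lambda>z. clip (z (Inl e))) -` B \<inter> space limit_law | B. B \<in> sets borel}"
    then have "\<forall>e\<in>J. \<exists>B. A e = (\<lambda>z. clip (z (Inl e))) -` B \<inter> space limit_law \<and> B \<in> sets borel" by blast
    then obtain B where B: "\<forall>e\<in>J. A e = (\<lambda>z. clip (z (Inl e))) -` B e \<inter> space limit_law \<and> B e \<in> sets borel"
      by (rule bchoice[THEN exE])
    obtain S where S: "finite_subtree T E S" "Inl ` J \<subseteq> inner_coords S"
    proof -
      have "finite (Inl ` J)" "Inl ` J \<subseteq> all_coords" using J(2,3) by auto
      then show ?thesis using cover_exists that by blast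
    qed
    note ind = limit_law_independent[OF S(1)]
    let ?C = "\<lambda>i :: 'v set + 'v \<times> 'v. clip -` B (projl i)"
    have C: "?C i \<in> sets borel" if "i \<in> Inl ` J" for i
      using measurable_sets[OF clip_measurable, of "B (projl i)"] B that by auto
    have JS: "Inl ` J \<subseteq> coords S"
    proof
      fix i :: "'v set + 'v \<times> 'v" assume "i \<in> Inl ` J"
      then show "i \<in> coords S" using subsetD[OF S(2), of i] by auto
    qed
    have K: "limit.prob (\<Inter>i\<in>K. (\<lambda>z. z i) -` ?C i \<inter> space limit_law) = (\<Prod>i\<in>K. measure (coord_law i) (?C i))"
      if K: "K \<subseteq> Inl ` J" "K \<noteq> {}" for K :: "('v set + 'v \<times> 'v) set"
    proof (rule independent_coords_prob[OF ind _ K(2) subset_trans[OF K(1) JS] C[OF subsetD[OF K(1)]]])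
      show "finite K" using K(1) J(3) by (auto dest: finite_subset)
    qed
    have eq: "A e = (\<lambda>z. z (Inl e)) -` ?C (Inl e) \<inter> space limit_law" if "e \<in> J" for e
      using B that by auto
    have each: "limit.prob (A e) = measure (coord_law (Inl e)) (?C (Inl e))" if "e \<in> J" for e
      using K[of "{Inl e}"] that eq[OF that] by simp
    have "(\<lambda>i. (\<lambda>z. z i) -` ?C i \<inter> space limit_law) ` Inl ` J = A ` J"
      unfolding image_image by (rule image_cong[OF refl]) (simp add: eq)
    then have "limit.prob (\<Inter>e\<in>J. A e) = (\<Prod>i\<in>Inl ` J. measure (coord_law i) (?C i))"
      using K[of "Inl ` J"] J(1) by simp
    also have "\<dots> = (\<Prod>e\<in>J. limit.prob (A e))"
      by (simp add: prod.reindex each)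
    finally show "limit.prob (\<Inter>e\<in>J. A e) = (\<Prod>e\<in>J. limit.prob (A e))" .
  qed
qed

lemma config_pair_limit [measurable]: "config_pair \<in> measurable limit_law (pair_space E (oriented E))"
  by (rule config_pair_measurable) simp

definition coupled_label :: "'v set \<Rightarrow> ('v set \<Rightarrow> real) \<times> ('v \<times> 'v) set \<Rightarrow> real" where
  "coupled_label e x = clip (fst x e)"

lemma coupled_label_config: "e \<in> E \<Longrightarrow> coupled_label e (config_pair z) = clip (z (Inl e))"
  by (simp add: coupled_label_def config_pair_def)

lemma coupled_label_measurable: "e \<in> E \<Longrightarrow> coupled_label e \<in> borel_measurable (pair_space E (oriented E))"
  unfolding coupled_label_def using pair_space_label by measurable

lemma clip_coord_AE: "AE z in limit_law. \<forall>e\<in>E. clip (z (Inl e)) = z (Inl e)"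
  using limit_law_label_range by eventually_elim (simp add: clip_id)

lemma coupling_sets [simp, measurable_cong]: "sets coupling_law = sets (pair_space E (oriented E))"
  by (simp add: coupling_law_def)

lemma coupling_space [simp]: "space coupling_law = space (pair_space E (oriented E))"
  by (simp add: coupling_law_def)

lemma coupling_iid: "iid_uniform E coupling_law coupled_label"
proof -
  interpret prob_space coupling_law
    unfolding coupling_law_def by (rule prob_space.prob_space_distr[OF prob_space_limit_law config_pair_limit])
  have m: "coupled_label e \<in> borel_measurable coupling_law" if "e \<in> E" for e
    using coupled_label_measurable[OF that] by (subst measurable_cong_sets[OF coupling_sets refl])
  show ?thesis
    unfolding iid_uniform_def
  proof (intro conjI ballI)
    fix e assume e: "e \<in> E"
    show "coupled_label e \<in> space coupling_law \<rightarrow> {0..1}" using clip_range by (simp add: coupled_label_def)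
    have "distr coupling_law borel (coupled_label e) = distr limit_law borel (\<lambda>z. coupled_label e (config_pair z))"
      unfolding coupling_law_def using coupled_label_measurable[OF e] by (subst distr_distr) (auto simp: comp_def)
    also have "\<dots> = distr limit_law borel (\<lambda>z. z (Inl e))"
    proof (rule distr_cong_AE[OF refl refl])
      show "AE z in limit_law. coupled_label e (config_pair z) = z (Inl e)"
        using clip_coord_AE by eventually_elim (use e in \<open>simp add: coupled_label_config\<close>)
    qed (use e in \<open>simp_all add: coupled_label_config clip_coord_measurable limit_law_measurable\<close>)
    finally show "distr coupling_law borel (coupled_label e) = uniform_01" using limit_law_label[OF e] by simp
  next
    let ?G = "\<lambda>e. {coupled_label e -` B \<inter> space coupling_law | B. B \<in> sets borel}"
    have "indep_sets ?G E"
      unfolding coupling_law_def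
    proof (rule indep_sets_distr[OF prob_space_limit_law config_pair_limit _ limit_labels_indep])
      fix e assume e: "e \<in> E"
      show "{coupled_label e -` B \<inter> space (distr limit_law (pair_space E (oriented E)) config_pair) | B. B \<in> sets borel}
          \<subseteq> sets (pair_space E (oriented E))"
        using measurable_sets[OF coupled_label_measurable[OF e]] by auto
      fix A assume "A \<in> {coupled_label e -` B \<inter> space (distr limit_law (pair_space E (oriented E)) config_pair) | B. B \<in> sets borel}"
      then obtain B where B: "B \<in> sets borel" "A = coupled_label e -` B \<inter> space (pair_space E (oriented E))" by auto
      have "config_pair -` A \<inter> space limit_law = (\<lambda>z. clip (z (Inl e))) -` B \<inter> space limit_law"
        unfolding coupled_label_config[OF e, symmetric] B(2) using measurable_space[OF config_pair_limit] by blast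
      then show "config_pair -` A \<inter> space limit_law \<in>
          {(\<lambda>z. clip (z (Inl e))) -` B \<inter> space limit_law | B. B \<in> sets borel}" using B(1) by blast
    qed
    then show "indep_vars (\<lambda>_. borel) coupled_label E"
      unfolding indep_vars_def2 using m by blast
  qed
qed

section \<open>Branch independence of the coupling\<close>

lemma group_measurable:
  assumes "i \<in> group_coords S j"
  shows "(\<lambda>z. z i) \<in> borel_measurable (sigma (space limit_law) (box_events (group_coords S j)))"
proof (rule borel_measurableI_le)
  fix t :: real
  have "{z \<in> space limit_law. z i \<in> {..t}} \<in> box_events (group_coords S j)"
    by (rule box_events_singleton) (use assms in auto)
  then show "{z \<in> space (sigma (space limit_law) (box_events (group_coords S j))). z i \<le> t}
      \<in> sets (sigma (space limit_law) (box_events (group_coords S j)))"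
    by (simp add: space_measure_of[OF box_events_Pow] sets_measure_of[OF box_events_Pow] sigma_sets.Basic)
qed

lemma vimage_group_events:
  assumes g: "g \<in> measurable (pair_space E (oriented E)) N"
    and gc: "(\<lambda>z. g (config_pair z)) \<in> measurable (sigma (space limit_law) (box_events (group_coords S j))) N"
    and A: "A \<in> sets (vimage_algebra (space coupling_law) g N)"
  shows "config_pair -` A \<inter> space limit_law \<in> group_events S j"
proof -
  have "g \<in> space coupling_law \<rightarrow> space N" using measurable_space[OF g] by auto
  then obtain B where B: "B \<in> sets N" "A = g -` B \<inter> space coupling_law"
    using A by (auto simp: sets_vimage_algebra2)
  have "config_pair -` A \<inter> space limit_law = (\<lambda>z. g (config_pair z)) -` B \<inter> space limit_law"
    unfolding B(2) using measurable_space[OF config_pair_limit] by auto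
  also have "\<dots> \<in> group_events S j"
    using measurable_sets[OF gc B(1)]
    by (simp add: group_events_def space_measure_of[OF box_events_Pow] sets_measure_of[OF box_events_Pow])
  finally show ?thesis .
qed

text \<open>Whether an edge is frozen depends on its label and on the times of its children, all of
  which belong to the same branch. Each family in (iii) thus pulls back into the events of one group
  of coordinates.\<close>

lemma coupling_branch_independence:
  "branch_independence T E coupling_law coupled_label snd"
  unfolding branch_independence_def
proof (intro allI impI)
  fix S assume S: "finite_subtree T E S"
  let ?P = "pair_space E (oriented E)"
  let ?g0 = "\<lambda>\<omega>. \<lambda>e\<in>induced_edges E S. coupled_label e \<omega>"
  let ?N0 = "\<Pi>\<^sub>M e\<in>induced_edges E S. (borel :: real measure)"
  let ?g1 = "\<lambda>a \<omega>. (\<lambda>e\<in>branch_edges a. coupled_label e \<omega>, snd \<omega> \<inter> descendants E a)"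
  let ?N1 = "\<lambda>a. pair_space (branch_edges a) (descendants E a)"
  let ?W = "\<lambda>j. sigma (space limit_law) (box_events (group_coords S j))"
  have sub: "induced_edges E S \<subseteq> E" by (auto simp: induced_edges_def)
  have g0: "?g0 \<in> measurable ?P ?N0"
    using coupled_label_measurable sub by (intro measurable_restrict) blast
  have g1: "?g1 a \<in> measurable ?P (?N1 a)" for a
  proof (rule measurable_pair_space)
    show "coupled_label e \<in> borel_measurable ?P" if "e \<in> branch_edges a" for e
      using coupled_label_measurable branch_edges_E that by blast
    show "(\<lambda>\<omega>. snd \<omega> \<inter> descendants E a) \<in> measurable ?P (subset_space (descendants E a))"
      by (rule measurable_subset_space) (use subset_space_member[OF pair_space_snd] in simp_all)
  qed
  have w0: "(\<lambda>z. ?g0 (config_pair z)) \<in> measurable (?W None) ?N0"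
  proof (rule measurable_restrict)
    fix e assume e: "e \<in> induced_edges E S"
    then have eE: "e \<in> E" using sub by blast
    have "(\<lambda>z. z (Inl e)) \<in> borel_measurable (?W None)"
      by (rule group_measurable) (simp add: group_coords_def e)
    from measurable_compose[OF this clip_measurable]
    show "(\<lambda>z. coupled_label e (config_pair z)) \<in> borel_measurable (?W None)"
      unfolding coupled_label_config[OF eE] .
  qed
  have w1: "(\<lambda>z. ?g1 a (config_pair z)) \<in> measurable (?W (Some a)) (?N1 a)" if a: "a \<in> boundary T E S" for a
  proof (rule measurable_pair_space)
    have aO: "a \<in> oriented E" using a by (simp add: boundary_iff)
    have c: "(\<lambda>z. z (Inl (edge b))) \<in> borel_measurable (?W (Some a))"
      "(\<lambda>z. z (Inr b)) \<in> borel_measurable (?W (Some a))" if "b \<in> descendants E a" for b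
      by (rule group_measurable, simp add: group_coords_def branch_coords_label[OF that])+
    show "(\<lambda>z. coupled_label e (config_pair z)) \<in> borel_measurable (?W (Some a))" if e: "e \<in> branch_edges a" for e
    proof -
      have eE: "e \<in> E" using e branch_edges_E by blast
      obtain b where "b \<in> descendants E a" "e = edge b" using e unfolding branch_edges_iff by blast
      then have "(\<lambda>z. z (Inl e)) \<in> borel_measurable (?W (Some a))" using c by blast
      from measurable_compose[OF this clip_measurable] show ?thesis unfolding coupled_label_config[OF eE] .
    qed
    show "(\<lambda>z. snd (config_pair z) \<inter> descendants E a) \<in> measurable (?W (Some a)) (subset_space (descendants E a))"
    proof (rule measurable_subset_space)
      fix b assume b: "b \<in> descendants E a"
      have bO: "b \<in> oriented E" using b descendants_oriented[of a] by blast
      have "{z \<in> space (?W (Some a)). b \<in> frozen_config z} \<in> sets (?W (Some a))"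
        by (rule frozen_edges_member[where U = "\<lambda>e z. z (Inl e)" and X = "\<lambda>c z. z (Inr c)", OF bO c(1)[OF b] c(2)]) (use descendants_child[OF aO b] in blast)
      then show "{z \<in> space (?W (Some a)). b \<in> snd (config_pair z) \<inter> descendants E a} \<in> sets (?W (Some a))"
        using b by (simp add: config_pair_def)
    qed simp
  qed
  show "prob_space.indep_sets coupling_law
      (\<lambda>i. case i of None \<Rightarrow> sets (vimage_algebra (space coupling_law) ?g0 ?N0)
        | Some a \<Rightarrow> sets (vimage_algebra (space coupling_law) (?g1 a) (?N1 a)))
      (insert None (Some ` boundary T E S))" (is "prob_space.indep_sets _ ?G ?I")
  proof (subst coupling_law_def, rule indep_sets_distr[OF prob_space_limit_law config_pair_limit _ group_events_indep[OF S]])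
    fix j assume j: "j \<in> ?I"
    have sp: "sets (vimage_algebra (space coupling_law) g N) \<subseteq> sets ?P" if "g \<in> measurable ?P N" for g and N :: "'x measure"
      using that unfolding measurable_iff_sets by simp
    show "?G j \<subseteq> sets ?P" using sp[OF g0] sp[OF g1] by (cases j) auto
    fix A assume A: "A \<in> ?G j"
    from j show "config_pair -` A \<inter> space limit_law \<in> group_events S j"
    proof (elim insertE imageE)
      assume "j = None"
      then show ?thesis using A unfolding \<open>j = None\<close> option.case by (intro vimage_group_events[OF g0 w0])
    next
      fix a assume "j = Some a" "a \<in> boundary T E S"
      then show ?thesis using A unfolding \<open>j = Some a\<close> option.case by (intro vimage_group_events[OF g1 w1])
    qed
  qed
qed

section \<open>Invariance of the coupling\<close>

lemma aut_coords:
  assumes \<phi>: "\<phi> \<in> automorphisms T E" and S: "finite_subtree T E S"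
  defines "g \<equiv> map_sum ((`) \<phi>) (map_prod \<phi> \<phi>)"
  shows "coords (\<phi> ` S) = g ` coords S" "inj_on g (coords S)" "coord_law (g i) = coord_law i"
proof -
  have ST: "S \<subseteq> T" using S by (simp add: finite_subtree_iff)
  show "coords (\<phi> ` S) = g ` coords S"
    unfolding coords_def aut_induced[OF \<phi> ST] g_def by (auto simp: image_Un image_image)
  show "inj_on g (coords S)"
  proof (rule inj_onI)
    fix i j assume ij: "i \<in> coords S" "j \<in> coords S" "g i = g j"
    show "i = j"
    proof (cases i)
      case (Inl e)
      with ij obtain f where "j = Inl f" by (cases j) (auto simp: g_def)
      then show ?thesis using Inl ij inj_onD[OF aut_inj_edges[OF \<phi>], of e f] by (simp add: g_def induced_edges_def)
    next
      case (Inr a)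
      with ij obtain b where "j = Inr b" by (cases j) (auto simp: g_def)
      then show ?thesis using Inr ij inj_onD[OF aut_inj_oriented[OF \<phi>], of a b] by (simp add: g_def boundary_iff)
    qed
  qed
  show "coord_law (g i) = coord_law i" by (cases i) (simp_all add: g_def)
qed

lemma frozen_edges_aut:
  assumes \<phi>: "\<phi> \<in> automorphisms T E"
  shows "{d \<in> oriented E. map_prod \<phi> \<phi> d \<in> frozen_edges u x} =
    frozen_edges (\<lambda>e. u (\<phi> ` e)) (\<lambda>b. x (map_prod \<phi> \<phi> b))"
proof -
  have "map_prod \<phi> \<phi> d \<in> frozen_edges u x \<longleftrightarrow> d \<in> frozen_edges (\<lambda>e. u (\<phi> ` e)) (\<lambda>b. x (map_prod \<phi> \<phi> b))"
    if d: "d \<in> oriented E" for d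
    using d aut_oriented[OF \<phi> d] unfolding frozen_edges_def aut_children[OF \<phi> d] aut_image_edge[OF \<phi>, symmetric]
    by (simp add: image_image aut_children[OF \<phi> d] aut_image_edge[OF \<phi>])
  then show ?thesis using frozen_edges_subset by blast
qed

text \<open>Coordinates permuted by an automorphism still solve the recursion and are still
  independent with the same marginals, so they have the same law.\<close>

lemma coupling_aut_law:
  assumes \<phi>: "\<phi> \<in> automorphisms T E"
  shows "joint_law E (oriented E) coupling_law (\<lambda>e. coupled_label (\<phi> ` e))
     (\<lambda>\<omega>. {d \<in> oriented E. map_prod \<phi> \<phi> d \<in> snd \<omega>}) = coupling_law"
proof -
  let ?P = "pair_space E (oriented E)"
  define g where "g = map_sum ((`) \<phi>) (map_prod \<phi> \<phi>)"
  have m: "(\<lambda>x. (\<lambda>e\<in>E. coupled_label (\<phi> ` e) x, {d \<in> oriented E. map_prod \<phi> \<phi> d \<in> snd x})) \<in> measurable ?P ?P"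
  proof (rule measurable_pair_space)
    show "coupled_label (\<phi> ` e) \<in> borel_measurable ?P" if "e \<in> E" for e
      by (rule coupled_label_measurable[OF aut_E[OF \<phi> that]])
    show "(\<lambda>x. {d \<in> oriented E. map_prod \<phi> \<phi> d \<in> snd x}) \<in> measurable ?P (subset_space (oriented E))"
      by (rule measurable_subset_space) (use subset_space_member[OF pair_space_snd] in auto)
  qed
  have gi: "g i \<in> all_coords" if "i \<in> all_coords" for i
    using that aut_E[OF \<phi>] aut_oriented[OF \<phi>] by (cases i) (auto simp: g_def simp del: map_prod_simp)
  have "joint_law E (oriented E) coupling_law (\<lambda>e. coupled_label (\<phi> ` e))
     (\<lambda>\<omega>. {d \<in> oriented E. map_prod \<phi> \<phi> d \<in> snd \<omega>}) =
    joint_law E (oriented E) limit_law (\<lambda>e z. coupled_label (\<phi> ` e) (config_pair z))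
     (\<lambda>z. {d \<in> oriented E. map_prod \<phi> \<phi> d \<in> snd (config_pair z)})"
    unfolding coupling_law_def by (rule joint_law_distr[OF config_pair_limit m])
  also have "\<dots> = coupling_law"
  proof (rule joint_law_coupling[OF prob_space_limit_law, where Z = "\<lambda>i z. z (g i)"])
    show "(\<lambda>z. z (g i)) \<in> borel_measurable limit_law" if "i \<in> all_coords" for i
      by (rule limit_law_measurable[OF gi[OF that]])
    show "AE z in limit_law. recursion_at (\<lambda>e. z (g (Inl e))) (\<lambda>b. z (g (Inr b))) b" if b: "b \<in> oriented E" for b
      using limit_law_recursion[OF aut_oriented[OF \<phi> b]]
    proof eventually_elim
      case (elim z)
      then show ?case
        unfolding recursion_at_def aut_children[OF \<phi> b]
        by (simp add: g_def image_image)
    qed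
    show "independent_coords limit_law (\<lambda>i z. z (g i)) (coords S)" if S: "finite_subtree T E S" for S
    proof (rule independent_coords_reindex[where Z = "\<lambda>i z. z i"])
      show "independent_coords limit_law (\<lambda>i z. z i) (g ` coords S)"
        using limit_law_independent[OF aut_subtree[OF \<phi> S]] aut_coords(1)[OF \<phi> S] by (simp add: g_def)
    qed (use aut_coords(2,3)[OF \<phi> S] finite_coords[OF S] coords_nonempty[OF S] in \<open>simp_all add: g_def\<close>)
    show "(\<lambda>z. coupled_label (\<phi> ` e) (config_pair z)) \<in> borel_measurable limit_law" if "e \<in> E" for e
      by (rule measurable_compose[OF config_pair_limit coupled_label_measurable[OF aut_E[OF \<phi> that]]])
    have "(\<lambda>x. {d \<in> oriented E. map_prod \<phi> \<phi> d \<in> snd x}) \<in> measurable ?P (subset_space (oriented E))"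
      by (rule measurable_subset_space) (use subset_space_member[OF pair_space_snd] in auto)
    from measurable_compose[OF config_pair_limit this]
    show "(\<lambda>z. {d \<in> oriented E. map_prod \<phi> \<phi> d \<in> snd (config_pair z)}) \<in> measurable limit_law (subset_space (oriented E))" .
    show "AE z in limit_law. \<forall>e\<in>E. coupled_label (\<phi> ` e) (config_pair z) = z (g (Inl e))"
      using clip_coord_AE
      by eventually_elim (simp add: coupled_label_config aut_E[OF \<phi>] g_def)
    show "AE z in limit_law. {d \<in> oriented E. map_prod \<phi> \<phi> d \<in> snd (config_pair z)} =
        frozen_edges (\<lambda>e. z (g (Inl e))) (\<lambda>b. z (g (Inr b)))"
      by (intro AE_I2) (simp add: config_pair_def g_def frozen_edges_aut[OF \<phi>])
  qed
  finally show ?thesis .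
qed

lemma id_automorphism: "id \<in> automorphisms T E"
  by (simp add: automorphisms_def)

theorem coupling_exists: "frozen_coupling T E coupling_law coupled_label snd"
  unfolding frozen_coupling_def
proof (intro conjI)
  let ?P = "pair_space E (oriented E)"
  show "prob_space coupling_law"
    unfolding coupling_law_def by (rule prob_space.prob_space_distr[OF prob_space_limit_law config_pair_limit])
  show "iid_uniform E coupling_law coupled_label" by (rule coupling_iid)
  show "snd \<in> measurable coupling_law (subset_space (oriented E))"
    using pair_space_snd by (subst measurable_cong_sets[OF coupling_sets refl])
  show "branch_independence T E coupling_law coupled_label snd" by (rule coupling_branch_independence)
  have Q: "{x \<in> space ?P. ray_condition E (\<lambda>e. coupled_label e x) (snd x)} \<in> sets ?P"
    by (rule ray_condition_measurable[OF coupled_label_measurable pair_space_snd])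
  have "AE z in limit_law. ray_condition E (\<lambda>e. coupled_label e (config_pair z)) (snd (config_pair z))"
    using limit_ray_condition clip_coord_AE
  proof eventually_elim
    case (elim z)
    have "ray_condition E (\<lambda>e. coupled_label e (config_pair z)) (frozen_config z)"
      by (subst ray_condition_cong[where u' = "\<lambda>e. z (Inl e)"]) (use elim in \<open>simp_all add: coupled_label_config\<close>)
    then show ?case by (simp add: config_pair_def)
  qed
  then show "AE \<omega> in coupling_law. ray_condition E (\<lambda>e. coupled_label e \<omega>) (snd \<omega>)"
    unfolding coupling_law_def by (subst AE_distr_iff[OF config_pair_limit Q])
  \<comment> \<open>Not immediate, since the labels are clipped; it is the case of the identity
    automorphism.\<close>
  have id: "joint_law E (oriented E) coupling_law coupled_label snd = coupling_law"
  proof -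
    have "joint_law E (oriented E) coupling_law coupled_label snd =
      joint_law E (oriented E) coupling_law (\<lambda>e. coupled_label (id ` e)) (\<lambda>\<omega>. {d \<in> oriented E. map_prod id id d \<in> snd \<omega>})"
      unfolding joint_law_def by (rule distr_cong) (auto simp: space_pair_space)
    then show ?thesis using coupling_aut_law[OF id_automorphism] by simp
  qed
  show "invariant_law T E (oriented E) (\<lambda>\<phi>. map_prod \<phi> \<phi>) coupling_law coupled_label snd"
    unfolding invariant_law_def id using coupling_aut_law by blast
qed

section \<open>Uniqueness of the coupling\<close>

lemma reach_cong:
  assumes "\<And>b. b \<in> oriented E \<Longrightarrow> G b = G' b" "a \<in> oriented E"
  shows "reach (\<lambda>_. True) G n a \<longleftrightarrow> reach (\<lambda>_. True) G' n a"
  using assms(2)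
proof (induction n arbitrary: a)
  case (Suc n)
  then have "(\<exists>c\<in>children a. reach (\<lambda>_. True) G n c) \<longleftrightarrow> (\<exists>c\<in>children a. reach (\<lambda>_. True) G' n c)"
    by (intro bex_cong refl Suc.IH childrenD(1))
  then show ?case using assms(1)[OF Suc.prems] by simp
qed simp

lemma percolates_cong:
  assumes "\<And>e. e \<in> E \<Longrightarrow> u e = u' e" "a \<in> oriented E"
  shows "percolates u F t a \<longleftrightarrow> percolates u' F t a"
  unfolding percolates_def
  by (intro all_cong1 reach_cong assms(2)) (simp add: oriented_iff assms(1))

lemma percolates_aut:
  assumes \<phi>: "\<phi> \<in> automorphisms T E" and a: "a \<in> oriented E"
  shows "percolates (\<lambda>e. u (\<phi> ` e)) {d \<in> oriented E. map_prod \<phi> \<phi> d \<in> F} t a \<longleftrightarrow>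
    percolates u F t (map_prod \<phi> \<phi> a)"
proof -
  have "reach (\<lambda>_. True) (\<lambda>b. u (\<phi> ` edge b) \<le> t \<and> b \<notin> {d \<in> oriented E. map_prod \<phi> \<phi> d \<in> F}) n a \<longleftrightarrow>
    reach (\<lambda>_. True) (\<lambda>b. u (edge b) \<le> t \<and> b \<notin> F) n (map_prod \<phi> \<phi> a)" for n
    using a
  proof (induction n arbitrary: a)
    case (Suc n)
    have "(\<exists>c\<in>children a. reach (\<lambda>_. True) (\<lambda>b. u (\<phi> ` edge b) \<le> t \<and> b \<notin> {d \<in> oriented E. map_prod \<phi> \<phi> d \<in> F}) n c) \<longleftrightarrow>
      (\<exists>c\<in>children a. reach (\<lambda>_. True) (\<lambda>b. u (edge b) \<le> t \<and> b \<notin> F) n (map_prod \<phi> \<phi> c))"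
      by (intro bex_cong refl Suc.IH childrenD(1))
    then show ?case
      using Suc.prems unfolding reach.simps aut_children[OF \<phi> Suc.prems] aut_image_edge[OF \<phi>] by auto
  qed simp
  then show ?thesis unfolding percolates_def by simp
qed

text \<open>Expresses a percolation probability through the joint law, so that invariance of the
  latter can be applied to it.\<close>

lemma joint_law_percolates:
  assumes U: "\<And>e. e \<in> E \<Longrightarrow> U e \<in> borel_measurable M" and F: "F \<in> measurable M (subset_space (oriented E))"
    and a: "a \<in> oriented E"
  shows "measure (joint_law E (oriented E) M U F)
      {x \<in> space (pair_space E (oriented E)). percolates (fst x) (snd x) t a} =
    measure M {\<omega> \<in> space M. percolates (\<lambda>e. U e \<omega>) (F \<omega>) t a}"
proof -
  let ?P = "pair_space E (oriented E)"
  let ?f = "\<lambda>\<omega>. (\<lambda>e\<in>E. U e \<omega>, F \<omega>)"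
  have f: "?f \<in> measurable M ?P" by (rule measurable_pair_space[OF U F])
  have Q: "{x \<in> space ?P. percolates (fst x) (snd x) t a} \<in> sets ?P"
  proof (rule percolates_measurable[where D = "oriented E" and U = "\<lambda>e x. fst x e" and F = snd and t = "\<lambda>_. t"])
    show "(\<lambda>x. fst x (edge b)) \<in> borel_measurable ?P" if "b \<in> oriented E" for b
      using pair_space_label that by (simp add: oriented_iff)
    show "{x \<in> space ?P. b \<in> snd x} \<in> sets ?P" for b by (rule subset_space_member[OF pair_space_snd])
    show "children b \<subseteq> oriented E" for b using childrenD(1) by blast
  qed (use a in auto)
  have "measure (joint_law E (oriented E) M U F) {x \<in> space ?P. percolates (fst x) (snd x) t a} =
      measure M (?f -` {x \<in> space ?P. percolates (fst x) (snd x) t a} \<inter> space M)"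
    unfolding joint_law_def by (rule measure_distr[OF f Q])
  also have "?f -` {x \<in> space ?P. percolates (fst x) (snd x) t a} \<inter> space M =
      {\<omega> \<in> space M. percolates (\<lambda>e. U e \<omega>) (F \<omega>) t a}"
  proof -
    have "percolates (\<lambda>e\<in>E. U e \<omega>) (F \<omega>) t a \<longleftrightarrow> percolates (\<lambda>e. U e \<omega>) (F \<omega>) t a" for \<omega>
      by (rule percolates_cong[OF _ a]) simp
    then show ?thesis using measurable_space[OF f] by auto
  qed
  finally show ?thesis .
qed

definition undirected :: "('v \<times> 'v) set \<Rightarrow> 'v set set" where
  "undirected X = edge ` {b \<in> oriented E. b \<in> X}"

lemma undirected_iff:
  assumes "a \<in> oriented E" shows "edge a \<in> undirected X \<longleftrightarrow> a \<in> X \<or> prod.swap a \<in> X"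
proof
  assume "edge a \<in> undirected X"
  then obtain b where "b \<in> X" "edge a = edge b" by (auto simp: undirected_def)
  then have "b = a \<or> b = prod.swap a" by (auto simp: doubleton_eq_iff prod_eq_iff)
  then show "a \<in> X \<or> prod.swap a \<in> X" using \<open>b \<in> X\<close> by blast
next
  note a = assms
  assume X: "a \<in> X \<or> prod.swap a \<in> X"
  have *: "edge b \<in> undirected X" if "b \<in> oriented E" "b \<in> X" for b
    unfolding undirected_def by (rule imageI) (use that in simp)
  have "edge (prod.swap a) = edge a" by auto
  then show "edge a \<in> undirected X"
    using X *[OF a(1)] *[of "prod.swap a"] a(1) oriented_swap[of a] by (elim disjE) simp_all
qed

lemma undirected_measurable:
  assumes "G \<in> measurable N (subset_space (oriented E))"
  shows "(\<lambda>\<omega>. undirected (G \<omega>)) \<in> measurable N (subset_space E)"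
proof (rule measurable_subset_space)
  show "undirected (G \<omega>) \<subseteq> E" for \<omega> by (auto simp: undirected_def oriented_iff)
  fix e assume "e \<in> E"
  then obtain a where a: "a \<in> oriented E" "e = edge a" by (rule edge_cases)
  have "{\<omega> \<in> space N. a \<in> G \<omega> \<or> prod.swap a \<in> G \<omega>} \<in> sets N"
    by (intro sets.sets_Collect_disj subset_space_member[OF assms])
  then show "{\<omega> \<in> space N. e \<in> undirected (G \<omega>)} \<in> sets N" unfolding a(2) undirected_iff[OF a(1)] .
qed

text \<open>Forgetting orientations is a measurable map of the pair, so equality of laws is
  preserved.\<close>

lemma joint_law_undirected:
  fixes M :: "'m measure"
  assumes U: "\<And>e. e \<in> E \<Longrightarrow> V e \<in> borel_measurable M" and G: "G \<in> measurable M (subset_space (oriented E))"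
  shows "joint_law E E M V (\<lambda>\<omega>. undirected (G \<omega>)) =
    distr (joint_law E (oriented E) M V G) (pair_space E E) (\<lambda>x. (fst x, undirected (snd x)))"
proof -
  have f: "(\<lambda>\<omega>. (\<lambda>e\<in>E. V e \<omega>, G \<omega>)) \<in> measurable M (pair_space E (oriented E))" by (rule measurable_pair_space[OF U G])
  have "(\<lambda>x. (\<lambda>e\<in>E. fst x e, undirected (snd x))) \<in> measurable (pair_space E (oriented E)) (pair_space E E)"
    by (intro measurable_pair_space pair_space_label undirected_measurable pair_space_snd)
  then have g: "(\<lambda>x. (fst x, undirected (snd x))) \<in> measurable (pair_space E (oriented E)) (pair_space E E)"
    by (rule measurable_cong[THEN iffD1, rotated]) (auto simp: space_pair_space PiE_def extensional_restrict)
  show ?thesis unfolding joint_law_def using f g by (subst distr_distr) (auto simp: comp_def)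
qed

lemma undirected_eq: "{{v, w} | v w. {v, w} \<in> E \<and> ((v, w) \<in> X \<or> (w, v) \<in> X)} = undirected X"
proof (intro equalityI subsetI)
  fix e assume "e \<in> {{v, w} | v w. {v, w} \<in> E \<and> ((v, w) \<in> X \<or> (w, v) \<in> X)}"
  then obtain v w where vw: "e = {v, w}" "{v, w} \<in> E" "(v, w) \<in> X \<or> (w, v) \<in> X" by blast
  have "(v, w) \<in> oriented E" using vw by (simp add: oriented_def)
  from undirected_iff[OF this, of X] vw show "e \<in> undirected X" by simp
next
  fix e assume "e \<in> undirected X"
  then obtain b where "b \<in> oriented E" "b \<in> X" "e = edge b" by (auto simp: undirected_def)
  then show "e \<in> {{v, w} | v w. {v, w} \<in> E \<and> ((v, w) \<in> X \<or> (w, v) \<in> X)}"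
    by (intro CollectI exI[of _ "fst b"] exI[of _ "snd b"]) (simp add: oriented_iff)
qed

section \<open>Properties of an arbitrary coupling\<close>

context
  fixes M :: "'m measure" and U F
  assumes coupling: "frozen_coupling T E M U F"
begin

interpretation prob_space M using coupling by (simp add: frozen_coupling_def)

lemma coupled_U_measurable: "e \<in> E \<Longrightarrow> U e \<in> borel_measurable M"
  using coupling unfolding frozen_coupling_def iid_uniform_def indep_vars_def2 by blast

lemma coupled_U_range: "e \<in> E \<Longrightarrow> \<omega> \<in> space M \<Longrightarrow> U e \<omega> \<in> {0..1}"
  using coupling unfolding frozen_coupling_def iid_uniform_def by blast

lemma coupled_U_law: "e \<in> E \<Longrightarrow> distr M borel (U e) = uniform_01"
  using coupling unfolding frozen_coupling_def iid_uniform_def by blast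

lemma coupled_U_indep: "indep_vars (\<lambda>_. borel) U E"
  using coupling unfolding frozen_coupling_def iid_uniform_def by blast

lemma coupled_F_measurable: "F \<in> measurable M (subset_space (oriented E))"
  using coupling unfolding frozen_coupling_def by blast

lemma coupled_ray_condition: "AE \<omega> in M. ray_condition E (\<lambda>e. U e \<omega>) (F \<omega>)"
  using coupling unfolding frozen_coupling_def by blast

lemma coupled_U_prob:
  assumes "e \<in> E" "A \<in> sets borel" shows "prob (U e -` A \<inter> space M) = measure uniform_01 A"
  unfolding coupled_U_law[OF assms(1), symmetric]
  by (rule measure_distr[symmetric, OF coupled_U_measurable[OF assms(1)] assms(2)])

definition time :: "'v \<times> 'v \<Rightarrow> 'm \<Rightarrow> real" where
  "time a \<omega> = percolation_time (\<lambda>e. U e \<omega>) (F \<omega>) a"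

definition branch_map :: "'v \<times> 'v \<Rightarrow> 'm \<Rightarrow> ('v set \<Rightarrow> real) \<times> ('v \<times> 'v) set" where
  "branch_map a \<omega> = (\<lambda>e\<in>branch_edges a. U e \<omega>, F \<omega> \<inter> descendants E a)"

text \<open>Named as a measure so that measurability can be used; its sets form the family that
  \<open>branch_independence\<close> attaches to \<open>a\<close>.\<close>

definition branch_algebra :: "'v \<times> 'v \<Rightarrow> 'm measure" where
  "branch_algebra a = vimage_algebra (space M) (branch_map a) (pair_space (branch_edges a) (descendants E a))"

lemma space_branch_algebra [simp]: "space (branch_algebra a) = space M"
  by (simp add: branch_algebra_def)

lemma branch_map_measurable:
  assumes "\<And>e. e \<in> branch_edges a \<Longrightarrow> U e \<in> borel_measurable N"
    and "\<And>b. b \<in> descendants E a \<Longrightarrow> {\<omega> \<in> space N. b \<in> F \<omega>} \<in> sets N"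
  shows "branch_map a \<in> measurable N (pair_space (branch_edges a) (descendants E a))"
proof -
  have "(\<lambda>\<omega>. (\<lambda>e\<in>branch_edges a. U e \<omega>, F \<omega> \<inter> descendants E a)) \<in> measurable N (pair_space (branch_edges a) (descendants E a))"
    by (intro measurable_pair_space assms(1) measurable_subset_space) (use assms(2) in auto)
  then show ?thesis unfolding branch_map_def .
qed

lemma branch_map_M: "branch_map a \<in> measurable M (pair_space (branch_edges a) (descendants E a))"
  by (rule branch_map_measurable)
    (use coupled_U_measurable branch_edges_E subset_space_member[OF coupled_F_measurable] in blast)+

lemma branch_algebra_events: "sets (branch_algebra a) \<subseteq> events"
  using branch_map_M unfolding branch_algebra_def measurable_iff_sets by blast

lemma branch_algebra_label:
  assumes "e \<in> branch_edges a" shows "U e \<in> borel_measurable (branch_algebra a)"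
proof -
  have h: "branch_map a \<in> measurable (branch_algebra a) (pair_space (branch_edges a) (descendants E a))"
    unfolding branch_algebra_def
    by (rule measurable_vimage_algebra1) (use measurable_space[OF branch_map_M] in blast)
  from measurable_compose[OF h pair_space_label[OF assms]] show ?thesis
    using assms by (simp add: branch_map_def)
qed

lemma branch_algebra_F:
  assumes "b \<in> descendants E a" shows "{\<omega> \<in> space M. b \<in> F \<omega>} \<in> sets (branch_algebra a)"
proof -
  have h: "branch_map a \<in> measurable (branch_algebra a) (pair_space (branch_edges a) (descendants E a))"
    unfolding branch_algebra_def
    by (rule measurable_vimage_algebra1) (use measurable_space[OF branch_map_M] in blast)
  from subset_space_member[OF measurable_compose[OF h pair_space_snd], of b] show ?thesis
    using assms by (simp add: branch_map_def)
qed

lemma branch_algebra_child: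
  assumes "a \<in> oriented E" "c \<in> children a" shows "sets (branch_algebra c) \<subseteq> sets (branch_algebra a)"
proof -
  have d: "descendants E c \<subseteq> descendants E a" using descendants_unfold[OF assms(1)] assms(2) by blast
  then have e: "branch_edges c \<subseteq> branch_edges a" unfolding branch_edges_iff by (rule image_mono)
  have "branch_map c \<in> measurable (branch_algebra a) (pair_space (branch_edges c) (descendants E c))"
    using branch_algebra_label[OF subsetD[OF e]] branch_algebra_F[OF subsetD[OF d]]
    by (intro branch_map_measurable) simp_all
  then show ?thesis unfolding branch_algebra_def[of c] measurable_iff_sets by simp
qed

lemma edge_in_branch: "b \<in> descendants E a \<Longrightarrow> edge b \<in> branch_edges a"
  unfolding branch_edges_iff by (rule imageI)

lemma time_range: "a \<in> oriented E \<Longrightarrow> \<omega> \<in> space M \<Longrightarrow> time a \<omega> \<in> {0..1} \<union> {2}"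
  unfolding time_def by (rule percolation_time_range) (use coupled_U_range in \<open>auto simp: oriented_iff\<close>)

text \<open>Percolation from \<open>a\<close> inspects descendants of \<open>a\<close> only, so the
  time belongs to the branch and takes part in the independence of (iii).\<close>

lemma time_measurable:
  assumes a: "a \<in> oriented E" shows "time a \<in> borel_measurable (branch_algebra a)"
proof (rule borel_measurableI_le)
  fix t :: real
  have P: "{\<omega> \<in> space M. percolates (\<lambda>e. U e \<omega>) (F \<omega>) s a} \<in> sets (branch_algebra a)" for s
    using percolates_measurable[of "descendants E a" U "branch_algebra a" "\<lambda>_. s" F a]
      branch_algebra_label[OF edge_in_branch] branch_algebra_F descendants_child[OF a] descendants_self[OF a] by simp
  have le: "{\<omega> \<in> space M. time a \<omega> \<le> s} = {\<omega> \<in> space M. percolates (\<lambda>e. U e \<omega>) (F \<omega>) s a}" if "s \<le> 1" for s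
    unfolding time_def percolation_time_le_iff[OF that] ..
  \<comment> \<open>No time lies strictly between 1 and 2, and all are at most 2.\<close>
  consider "t \<le> 1" | "1 < t" "t < 2" | "2 \<le> t" by linarith
  then have "{\<omega> \<in> space M. time a \<omega> \<le> t} \<in> sets (branch_algebra a)"
  proof cases
    case 1 then show ?thesis using le P by simp
  next
    case 2
    then have "{\<omega> \<in> space M. time a \<omega> \<le> t} = {\<omega> \<in> space M. time a \<omega> \<le> 1}" using time_range[OF a] by force
    then show ?thesis using le[of 1] P by simp
  next
    case 3
    then have "{\<omega> \<in> space M. time a \<omega> \<le> t} = space (branch_algebra a)" using time_range[OF a] by force
    then show ?thesis by (simp only: sets.top)
  qed
  then show "{\<omega> \<in> space (branch_algebra a). time a \<omega> \<le> t} \<in> sets (branch_algebra a)" by simp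
qed

lemma time_measurable_M: "a \<in> oriented E \<Longrightarrow> time a \<in> borel_measurable M"
  using time_measurable branch_algebra_events unfolding measurable_def by fastforce

lemma coupled_indep:
  assumes "finite_subtree T E S"
  shows "indep_sets (\<lambda>i. case i of
      None \<Rightarrow> sets (vimage_algebra (space M) (\<lambda>\<omega>. \<lambda>e\<in>induced_edges E S. U e \<omega>) (\<Pi>\<^sub>M e\<in>induced_edges E S. borel))
    | Some a \<Rightarrow> sets (branch_algebra a)) (insert None (Some ` boundary T E S))"
  using coupling assms
  unfolding frozen_coupling_def branch_independence_def branch_algebra_def branch_map_def by blast

lemma inner_label_event:
  assumes "J \<subseteq> induced_edges E S" "finite J" "\<And>e. e \<in> J \<Longrightarrow> A e \<in> sets borel"
  shows "{\<omega> \<in> space M. \<forall>e\<in>J. U e \<omega> \<in> A e} \<in>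
    sets (vimage_algebra (space M) (\<lambda>\<omega>. \<lambda>e\<in>induced_edges E S. U e \<omega>) (\<Pi>\<^sub>M e\<in>induced_edges E S. borel))" (is "_ \<in> sets ?V")
proof -
  have h: "(\<lambda>\<omega>. \<lambda>e\<in>induced_edges E S. U e \<omega>) \<in> measurable ?V (\<Pi>\<^sub>M e\<in>induced_edges E S. borel)"
    by (rule measurable_vimage_algebra1) (auto simp: space_PiM)
  have "{\<omega> \<in> space ?V. U e \<omega> \<in> A e} \<in> sets ?V" if e: "e \<in> J" for e
  proof -
    have eS: "e \<in> induced_edges E S" using assms(1) e by blast
    from measurable_compose[OF h measurable_component_singleton[OF eS]]
    have "U e \<in> borel_measurable ?V" using eS by simp
    from measurable_sets[OF this assms(3)[OF e]] show ?thesis by (simp add: vimage_def Int_def conj_commute)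
  qed
  then have "{\<omega> \<in> space ?V. \<forall>e\<in>J. U e \<omega> \<in> A e} \<in> sets ?V"
    using assms(2) by (intro sets.sets_Collect_finite_All) auto
  then show ?thesis by simp
qed

text \<open>Invariance in law together with transitivity on oriented edges gives all times a common
  tail, the unknown \<open>S\<close> of the branching process.\<close>

lemma time_tail_transitive:
  assumes a: "a \<in> oriented E" "b \<in> oriented E" and t: "t \<le> 1"
  shows "prob {\<omega> \<in> space M. t < time a \<omega>} = prob {\<omega> \<in> space M. t < time b \<omega>}"
proof -
  obtain \<phi> where \<phi>: "\<phi> \<in> automorphisms T E" "map_prod \<phi> \<phi> a = b" using automorphism_transitive[OF a] .
  let ?F = "\<lambda>\<omega>. {d \<in> oriented E. map_prod \<phi> \<phi> d \<in> F \<omega>}"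
  have inv: "joint_law E (oriented E) M (\<lambda>e. U (\<phi> ` e)) ?F = joint_law E (oriented E) M U F"
    using coupling \<phi>(1) unfolding frozen_coupling_def invariant_law_def by blast
  have F': "?F \<in> measurable M (subset_space (oriented E))"
    by (rule measurable_subset_space) (use subset_space_member[OF coupled_F_measurable] in auto)
  have "prob {\<omega> \<in> space M. percolates (\<lambda>e. U (\<phi> ` e) \<omega>) (?F \<omega>) t a} =
      prob {\<omega> \<in> space M. percolates (\<lambda>e. U e \<omega>) (F \<omega>) t a}"
    using joint_law_percolates[where U = "\<lambda>e. U (\<phi> ` e)" and t = t, OF coupled_U_measurable[OF aut_E[OF \<phi>(1)]] F' a(1)]
      joint_law_percolates[where t = t, OF coupled_U_measurable coupled_F_measurable a(1)] inv by simp
  moreover have "percolates (\<lambda>e. U (\<phi> ` e) \<omega>) (?F \<omega>) t a \<longleftrightarrow> percolates (\<lambda>e. U e \<omega>) (F \<omega>) t b" for \<omega>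
    using percolates_aut[OF \<phi>(1) a(1), of "\<lambda>e. U e \<omega>" "F \<omega>" t] \<phi>(2) by simp
  ultimately have eq: "prob {\<omega> \<in> space M. time b \<omega> \<le> t} = prob {\<omega> \<in> space M. time a \<omega> \<le> t}"
    unfolding time_def percolation_time_le_iff[OF t] by simp
  have "prob {\<omega> \<in> space M. t < time c \<omega>} = 1 - prob {\<omega> \<in> space M. time c \<omega> \<le> t}" if "c \<in> oriented E" for c
  proof -
    note [measurable] = time_measurable_M[OF that]
    have "{\<omega> \<in> space M. t < time c \<omega>} = space M - {\<omega> \<in> space M. time c \<omega> \<le> t}" by auto
    then show ?thesis by (simp add: prob_compl)
  qed
  then show ?thesis using a eq by simp
qed

lemma coupled_recursion: "AE \<omega> in M. \<forall>a\<in>oriented E.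
    recursion_at (\<lambda>e. U e \<omega>) (\<lambda>b. time b \<omega>) a \<and> (a \<in> F \<omega> \<longleftrightarrow> Min ((\<lambda>b. time b \<omega>) ` children a) \<le> U (edge a) \<omega>)"
  using coupled_ray_condition AE_space
proof eventually_elim
  case (elim \<omega>)
  then show ?case
    using ray_condition_recursion[of "\<lambda>e. U e \<omega>" "F \<omega>"] coupled_U_range unfolding time_def by blast
qed

lemma coupled_frozen: "AE \<omega> in M. F \<omega> = frozen_edges (\<lambda>e. U e \<omega>) (\<lambda>b. time b \<omega>)"
  using coupled_recursion AE_space
proof eventually_elim
  case (elim \<omega>)
  have "F \<omega> \<subseteq> oriented E" using measurable_space[OF coupled_F_measurable elim(2)] by simp
  with elim(1) show ?case unfolding frozen_edges_def by blast
qed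

text \<open>Here (ii) and (iii) supply the branching process, and (i) makes the times true
  percolation times, so that \<open>S_eq_tail\<close> applies.\<close>

lemma coupled_tail:
  assumes a: "a \<in> oriented E" and t: "0 \<le> t" "t \<le> 1" shows "prob {\<omega> \<in> space M. t < time a \<omega>} = tail t"
proof -
  define S where "S t = prob {\<omega> \<in> space M. t < time a \<omega>}" for t
  interpret B: branch_process T E M U "time" "\<lambda>a. sets (branch_algebra a)" S
  proof (intro branch_process.intro branch_process_axioms.intro)
    show "cubic_tree T E" by (rule cubic_tree_axioms)
    show "prob_space M" by (rule prob_space_axioms)
    fix b assume b: "b \<in> oriented E"
    show "sigma_algebra (space M) (sets (branch_algebra b))"
      using sets.sigma_algebra_axioms[of "branch_algebra b"] by simp
    show "sets (branch_algebra b) \<subseteq> events" by (rule branch_algebra_events)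
    show "sets (branch_algebra c) \<subseteq> sets (branch_algebra b)" if "c \<in> children b" for c
      by (rule branch_algebra_child[OF b that])
    show "{\<omega> \<in> space M. t < time b \<omega>} \<in> sets (branch_algebra b)" for t
      using borel_measurable_less[OF _ time_measurable[OF b], of "\<lambda>_. t"] by simp
    show "{\<omega> \<in> space M. U (edge b) \<omega> \<le> t} \<in> sets (branch_algebra b)" for t
      using borel_measurable_le[OF branch_algebra_label[OF edge_in_branch[OF descendants_self[OF b]]], of "\<lambda>_. t"] by simp
    show "AE \<omega> in M. recursion_at (\<lambda>e. U e \<omega>) (\<lambda>b. time b \<omega>) b"
      using coupled_recursion by eventually_elim (use b in blast)
    show "prob {\<omega> \<in> space M. t < time b \<omega>} = S t" if "0 \<le> t" "t \<le> 1" for t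
      unfolding S_def by (rule time_tail_transitive[OF b a that(2)])
    show "prob ({\<omega> \<in> space M. U (edge b) \<omega> \<le> t} \<inter> C \<inter> D) = t * prob C * prob D"
      if cd: "children b = {c, d}" "c \<noteq> d" and CD: "C \<in> sets (branch_algebra c)" "D \<in> sets (branch_algebra d)"
        and t: "0 \<le> t" "t \<le> 1" for c d C D t
    proof -
      note S = subtree_edge[OF b]
      let ?A = "{\<omega> \<in> space M. U (edge b) \<omega> \<le> t}"
      let ?X = "\<lambda>j. case j of None \<Rightarrow> ?A | Some x \<Rightarrow> if x = c then C else D"
      have "prob (\<Inter>j\<in>{None, Some c, Some d}. ?X j) = (\<Prod>j\<in>{None, Some c, Some d}. prob (?X j))"
      proof (rule indep_setsD[OF coupled_indep[OF S(1)]])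
        show "{None, Some c, Some d} \<subseteq> insert None (Some ` boundary T E (edge b))"
          unfolding S(3) using cd(1) by blast
        show "\<forall>j\<in>{None, Some c, Some d}. ?X j \<in> (case j of
            None \<Rightarrow> sets (vimage_algebra (space M) (\<lambda>\<omega>. \<lambda>e\<in>induced_edges E (edge b). U e \<omega>) (\<Pi>\<^sub>M e\<in>induced_edges E (edge b). borel))
          | Some a \<Rightarrow> sets (branch_algebra a))"
          using CD cd(2) inner_label_event[of "{edge b}" "edge b" "\<lambda>_. {..t}"] S(2) by simp
      qed auto
      moreover have "(\<Inter>j\<in>{None, Some c, Some d}. ?X j) = ?A \<inter> C \<inter> D" using cd(2) by auto
      moreover have "prob ?A = t"
      proof -
        have "U (edge b) -` {..t} \<inter> space M = ?A" by auto
        then show ?thesis using coupled_U_prob[of "edge b" "{..t}"] b uniform_01_atMost[OF t] by (simp add: oriented_iff)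
      qed
      ultimately show ?thesis using cd(2) by simp
    qed
  qed
  \<comment> \<open>By definition of the time, percolation at level \<open>s\<close> excludes a time
    later than \<open>s\<close>.\<close>
  have "AE \<omega> in M. s < time a \<omega> \<longrightarrow> \<not> percolates (\<lambda>e. U e \<omega>) (B.frozen \<omega>) s a" if "0 \<le> s" "s \<le> 1" for s
    using coupled_frozen
  proof eventually_elim
    case (elim \<omega>)
    have "time a \<omega> \<le> s \<longleftrightarrow> percolates (\<lambda>e. U e \<omega>) (F \<omega>) s a"
      unfolding time_def by (rule percolation_time_le_iff[OF that(2)])
    then show ?case unfolding elim[symmetric] by auto
  qed
  then show ?thesis using B.S_eq_tail[OF a _ t] unfolding S_def by blast
qed

lemma time_distribution:
  assumes a: "a \<in> oriented E" shows "distr M borel (time a) = time_law"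
proof (rule real_law_eqI)
  note m [measurable] = time_measurable_M[OF a]
  show "prob_space (distr M borel (time a))" by (rule prob_space_distr[OF m])
  show "AE x in distr M borel (time a). x \<in> {0..1} \<union> {2}"
    by (subst AE_distr_iff) (use time_range[OF a] in auto)
  fix t :: real assume t: "0 \<le> t" "t \<le> 1"
  have "measure (distr M borel (time a)) {t<..} = prob (time a -` {t<..} \<inter> space M)"
    by (rule measure_distr[OF m]) simp
  also have "time a -` {t<..} \<inter> space M = {\<omega> \<in> space M. t < time a \<omega>}" by auto
  finally show "measure (distr M borel (time a)) {t<..} = measure time_law {t<..}"
    using coupled_tail[OF a t] time_law_tail[OF t] by simp
qed (use prob_space_time_law AE_time_law in auto)

text \<open>Branch independence separates the boundary times from the block of inner labels, which
  splits further because the labels are i.i.d.\<close>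

lemma coupled_coords:
  assumes S: "finite_subtree T E S" shows "independent_coords M (case_sum U time) (coords S)"
proof (rule independent_coords_boxI[OF prob_space_axioms finite_coords[OF S] coords_nonempty[OF S]])
  have fS: "finite S" using S by (rule finite_subtree_finite)
  have sub: "induced_edges E S \<subseteq> E" by (auto simp: induced_edges_def)
  have bO: "a \<in> oriented E" if "a \<in> boundary T E S" for a using that by (simp add: boundary_iff)
  show "case_sum U time i \<in> borel_measurable M" if "i \<in> coords S" for i
    using that sub bO coupled_U_measurable time_measurable_M by (cases i) auto
  fix A assume A: "\<And>i. i \<in> coords S \<Longrightarrow> A i \<in> sets (borel :: real measure)"
  define X where "X j = (case j of None \<Rightarrow> {\<omega> \<in> space M. \<forall>e\<in>induced_edges E S. U e \<omega> \<in> A (Inl e)}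
    | Some a \<Rightarrow> time a -` A (Inr a) \<inter> space M)" for j
  let ?I = "insert None (Some ` boundary T E S)"
  have AI: "A (Inl e) \<in> sets borel" if "e \<in> induced_edges E S" for e using A that by simp
  have AB: "A (Inr a) \<in> sets borel" if "a \<in> boundary T E S" for a using A that by simp
  have "prob (\<Inter>j\<in>?I. X j) = (\<Prod>j\<in>?I. prob (X j))"
  proof (rule indep_setsD[OF coupled_indep[OF S]])
    have "X None \<in> sets (vimage_algebra (space M) (\<lambda>\<omega>. \<lambda>e\<in>induced_edges E S. U e \<omega>) (\<Pi>\<^sub>M e\<in>induced_edges E S. borel))"
      unfolding X_def option.case
      by (rule inner_label_event) (use finite_induced_edges[OF fS] AI in auto)
    moreover have "X (Some a) \<in> sets (branch_algebra a)" if a: "a \<in> boundary T E S" for a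
      using measurable_sets[OF time_measurable[OF bO[OF a]] AB[OF a]] by (simp add: X_def)
    ultimately show "\<forall>j\<in>?I. X j \<in> (case j of
        None \<Rightarrow> sets (vimage_algebra (space M) (\<lambda>\<omega>. \<lambda>e\<in>induced_edges E S. U e \<omega>) (\<Pi>\<^sub>M e\<in>induced_edges E S. borel))
      | Some a \<Rightarrow> sets (branch_algebra a))" by (simp add: option.case)
  qed (use finite_boundary[OF fS] in auto)
  also have "\<dots> = prob (X None) * (\<Prod>a\<in>boundary T E S. prob (X (Some a)))"
    using finite_boundary[OF fS] by (subst prod.insert) (auto simp: prod.reindex)
  also have "prob (X None) = (\<Prod>e\<in>induced_edges E S. measure (coord_law (Inl e)) (A (Inl e)))"
  proof -
    have "prob (X None) = (\<Prod>e\<in>induced_edges E S. prob (U e -` A (Inl e) \<inter> space M))"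
      unfolding X_def option.case
      by (rule indep_vars_prob_Ball[OF prob_space_axioms coupled_U_indep finite_induced_edges[OF fS] sub AI])
    also have "\<dots> = (\<Prod>e\<in>induced_edges E S. measure (coord_law (Inl e)) (A (Inl e)))"
      by (rule prod.cong[OF refl]) (use coupled_U_prob AI sub in auto)
    finally show ?thesis .
  qed
  also have "(\<Prod>a\<in>boundary T E S. prob (X (Some a))) = (\<Prod>a\<in>boundary T E S. measure (coord_law (Inr a)) (A (Inr a)))"
  proof (rule prod.cong[OF refl])
    fix a assume a: "a \<in> boundary T E S"
    have "prob (time a -` A (Inr a) \<inter> space M) = measure (distr M borel (time a)) (A (Inr a))"
      by (rule measure_distr[symmetric, OF time_measurable_M[OF bO[OF a]] AB[OF a]])
    then show "prob (X (Some a)) = measure (coord_law (Inr a)) (A (Inr a))"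
      unfolding time_distribution[OF bO[OF a]] by (simp add: X_def)
  qed
  also have "(\<Prod>e\<in>induced_edges E S. measure (coord_law (Inl e)) (A (Inl e))) *
      (\<Prod>a\<in>boundary T E S. measure (coord_law (Inr a)) (A (Inr a))) = (\<Prod>i\<in>coords S. measure (coord_law i) (A i))"
    unfolding coords_def using finite_boundary[OF fS] finite_induced_edges[OF fS]
    by (subst prod.union_disjoint) (auto simp: prod.reindex)
  also have "(\<Inter>j\<in>?I. X j) = (\<Inter>i\<in>coords S. case_sum U time i -` A i \<inter> space M)"
    using boundary_nonempty[OF S] by (auto simp: X_def coords_def ball_Un)
  finally show "prob (\<Inter>i\<in>coords S. case_sum U time i -` A i \<inter> space M) = (\<Prod>i\<in>coords S. measure (coord_law i) (A i))" .
qed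

theorem coupled_law: "joint_law E (oriented E) M U F = coupling_law"
proof (rule joint_law_coupling[OF prob_space_axioms _ _ coupled_coords coupled_U_measurable coupled_F_measurable])
  show "case_sum U time i \<in> borel_measurable M" if "i \<in> all_coords" for i
    using that coupled_U_measurable time_measurable_M by (cases i) auto
  show "AE \<omega> in M. recursion_at (\<lambda>e. case_sum U time (Inl e) \<omega>) (\<lambda>b. case_sum U time (Inr b) \<omega>) b"
    if "b \<in> oriented E" for b
    using coupled_recursion by eventually_elim (use that in simp)
  show "AE \<omega> in M. F \<omega> = frozen_edges (\<lambda>e. case_sum U time (Inl e) \<omega>) (\<lambda>b. case_sum U time (Inr b) \<omega>)"
    using coupled_frozen by simp
qed simp_all

text \<open>The diagonal of the unit square is covered by \<open>m\<close> squares of side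
  \<open>1 / m\<close>, of total probability \<open>1 / m\<close>.\<close>

lemma coupled_labels_ne:
  assumes "e \<in> E" "f \<in> E" "e \<noteq> f" shows "AE \<omega> in M. U e \<omega> \<noteq> U f \<omega>"
proof -
  note [measurable] = coupled_U_measurable[OF assms(1)] coupled_U_measurable[OF assms(2)]
  have "prob {\<omega> \<in> space M. U e \<omega> = U f \<omega>} \<le> 1 / real (Suc n)" for n
  proof -
    define m where "m = Suc n"
    define I where "I k = {real k / m..(real k + 1) / m}" for k
    let ?D = "\<lambda>k. {\<omega> \<in> space M. U e \<omega> \<in> I k \<and> U f \<omega> \<in> I k}"
    have pI: "prob (U g -` I k \<inter> space M) = 1 / m" if "g \<in> E" "k < m" for g k
    proof -
      have "{0..1} \<inter> I k = I k" using that(2) by (auto simp: I_def divide_le_eq intro: order_trans)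
      then have "measure uniform_01 (I k) = 1 / m"
        by (simp add: measure_uniform_01 I_def diff_divide_distrib[symmetric] divide_right_mono)
      then show ?thesis using coupled_U_prob[OF that(1), of "I k"] by (simp add: I_def)
    qed
    have pD: "prob (?D k) = (1 / m)\<^sup>2" if "k < m" for k
    proof -
      have "prob {\<omega> \<in> space M. \<forall>i\<in>{e, f}. U i \<omega> \<in> I k} = (\<Prod>i\<in>{e, f}. prob (U i -` I k \<inter> space M))"
        by (rule indep_vars_prob_Ball[OF prob_space_axioms coupled_U_indep]) (use assms in \<open>auto simp: I_def\<close>)
      then show ?thesis using assms pI[OF _ that] by (simp add: power2_eq_square)
    qed
    have "{\<omega> \<in> space M. U e \<omega> = U f \<omega>} \<subseteq> (\<Union>k\<in>{..<m}. ?D k)"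
    proof
      fix \<omega> assume \<omega>: "\<omega> \<in> {\<omega> \<in> space M. U e \<omega> = U f \<omega>}"
      then have r: "U e \<omega> \<in> {0..1}" by (intro coupled_U_range[OF assms(1)]) simp
      have "\<exists>k<m. U e \<omega> \<in> I k"
      proof (cases "U e \<omega> = 1")
        \<comment> \<open>The label 1 belongs to the last interval, \<open>k = n\<close>; the floor
          used below would give \<open>m\<close>.\<close>
        case True
        then show ?thesis by (intro exI[of _ n]) (auto simp: I_def m_def field_simps)
      next
        case False
        define k where "k = nat \<lfloor>m * U e \<omega>\<rfloor>"
        have "0 \<le> m * U e \<omega>" "m * U e \<omega> < m" using r False by (auto simp: m_def)
        then have "real k \<le> m * U e \<omega>" "m * U e \<omega> < real k + 1" "k < m"
          unfolding k_def by linarith+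
        then show ?thesis by (intro exI[of _ k]) (auto simp: I_def m_def field_simps)
      qed
      then show "\<omega> \<in> (\<Union>k\<in>{..<m}. ?D k)" using \<omega> by auto
    qed
    then have "prob {\<omega> \<in> space M. U e \<omega> = U f \<omega>} \<le> prob (\<Union>k\<in>{..<m}. ?D k)"
      by (rule finite_measure_mono) (auto simp: I_def)
    also have "\<dots> \<le> (\<Sum>k<m. prob (?D k))"
      by (rule finite_measure_subadditive_finite) (auto simp: I_def)
    also have "\<dots> = 1 / m" using pD by (simp add: power2_eq_square m_def)
    finally show ?thesis by (simp add: m_def)
  qed
  moreover have "(\<lambda>n. 1 / real (Suc n)) \<longlonglongrightarrow> 0" by (rule LIMSEQ_Suc[OF lim_1_over_n])
  ultimately have "prob {\<omega> \<in> space M. U e \<omega> = U f \<omega>} \<le> 0" using LIMSEQ_le_const by blast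
  then have "prob {\<omega> \<in> space M. U e \<omega> = U f \<omega>} = 0" by (simp only: measure_le_0_iff)
  then show ?thesis by (subst (asm) prob_Collect_eq_0) auto
qed

lemma coupled_labels_inj: "AE \<omega> in M. inj_on (\<lambda>e. U e \<omega>) E"
proof -
  have "AE \<omega> in M. \<forall>p\<in>E \<times> E. fst p \<noteq> snd p \<longrightarrow> U (fst p) \<omega> \<noteq> U (snd p) \<omega>"
  proof (subst AE_ball_countable[OF countable_SIGMA[OF countable_edges countable_edges]], intro ballI)
    fix p assume "p \<in> E \<times> E"
    then show "AE \<omega> in M. fst p \<noteq> snd p \<longrightarrow> U (fst p) \<omega> \<noteq> U (snd p) \<omega>"
      using coupled_labels_ne[of "fst p" "snd p"] by (cases "fst p = snd p") auto
  qed
  then show ?thesis by eventually_elim (auto simp: inj_on_def)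
qed

lemma coupled_freezing: "AE \<omega> in M. freezing_rule T E (\<lambda>e. U e \<omega>) (undirected (F \<omega>))"
  using coupled_ray_condition coupled_labels_inj AE_space
proof eventually_elim
  case (elim \<omega>)
  show ?case unfolding undirected_def
    by (rule ray_condition_freezing_rule) (use elim coupled_U_range in auto)
qed

text \<open>Forgetting orientations commutes with automorphisms, so invariance passes from the
  oriented pair to its image.\<close>

lemma coupled_undirected_invariant: "invariant_law T E E (`) M U (\<lambda>\<omega>. undirected (F \<omega>))"
  unfolding invariant_law_def
proof
  fix \<phi> assume \<phi>: "\<phi> \<in> automorphisms T E"
  let ?F = "\<lambda>\<omega>. {d \<in> oriented E. map_prod \<phi> \<phi> d \<in> F \<omega>}"
  have F': "?F \<in> measurable M (subset_space (oriented E))"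
    by (rule measurable_subset_space) (use subset_space_member[OF coupled_F_measurable] in auto)
  have eq: "{d \<in> E. \<phi> ` d \<in> undirected (F \<omega>)} = undirected (?F \<omega>)" for \<omega>
  proof -
    have "\<phi> ` d \<in> undirected (F \<omega>) \<longleftrightarrow> d \<in> undirected (?F \<omega>)" if d: "d \<in> E" for d
    proof -
      obtain a where a: "a \<in> oriented E" "d = edge a" using d by (rule edge_cases)
      have sw: "prod.swap (map_prod \<phi> \<phi> a) = map_prod \<phi> \<phi> (prod.swap a)" by (cases a) simp
      show ?thesis
        unfolding a(2) aut_image_edge[OF \<phi>] undirected_iff[OF a(1)] undirected_iff[OF aut_oriented[OF \<phi> a(1)]] sw
        using a(1) oriented_swap[of a] by simp
    qed
    moreover have "undirected (?F \<omega>) \<subseteq> E" by (auto simp: undirected_def oriented_iff)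
    ultimately show ?thesis by blast
  qed
  have inv: "joint_law E (oriented E) M (\<lambda>e. U (\<phi> ` e)) ?F = joint_law E (oriented E) M U F"
    using coupling \<phi> unfolding frozen_coupling_def invariant_law_def by blast
  show "joint_law E E M (\<lambda>e. U (\<phi> ` e)) (\<lambda>\<omega>. {d \<in> E. \<phi> ` d \<in> undirected (F \<omega>)}) =
      joint_law E E M U (\<lambda>\<omega>. undirected (F \<omega>))"
    unfolding eq
    using joint_law_undirected[OF coupled_U_measurable[OF aut_E[OF \<phi>]] F'] inv
      joint_law_undirected[OF coupled_U_measurable coupled_F_measurable] by simp
qed

end

end

theorem theorem2:
  fixes T :: "'v set" and E :: "'v set set"
  assumes "infinite T" and "is_tree T E" and "\<forall>v\<in>T. vertex_degree E v = 3"
  shows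
    "(\<exists>(M :: (('v set \<Rightarrow> real) \<times> ('v \<times> 'v) set) measure) U F. frozen_coupling T E M U F) \<and>
     (\<forall>(M :: 'm measure) U F (M' :: 'n measure) U' F'.
        frozen_coupling T E M U F \<and> frozen_coupling T E M' U' F' \<longrightarrow>
        joint_law E (oriented E) M U F = joint_law E (oriented E) M' U' F') \<and>
     (\<forall>(M :: 'm measure) U F.
        frozen_coupling T E M U F \<longrightarrow>
        (let F' = (\<lambda>\<omega>. {{v, w} | v w. {v, w} \<in> E \<and> ((v, w) \<in> F \<omega> \<or> (w, v) \<in> F \<omega>)})
         in F' \<in> M \<rightarrow>\<^sub>M subset_space E \<and>
            (AE \<omega> in M. freezing_rule T E (\<lambda>e. U e \<omega>) (F' \<omega>)) \<and>
            invariant_law T E E (`) M U F'))"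
proof -
  interpret cubic_tree T E using assms by unfold_locales auto
  show ?thesis
  proof (intro conjI allI impI)
    show "\<exists>(M :: (('v set \<Rightarrow> real) \<times> ('v \<times> 'v) set) measure) U F. frozen_coupling T E M U F"
      using coupling_exists by blast
    fix M :: "'m measure" and U F and M' :: "'n measure" and U' F'
    assume "frozen_coupling T E M U F \<and> frozen_coupling T E M' U' F'"
    then show "joint_law E (oriented E) M U F = joint_law E (oriented E) M' U' F'"
      using coupled_law[of M U F] coupled_law[of M' U' F'] by simp
  next
    fix M :: "'m measure" and U F
    assume c: "frozen_coupling T E M U F"
    show "let F' = (\<lambda>\<omega>. {{v, w} | v w. {v, w} \<in> E \<and> ((v, w) \<in> F \<omega> \<or> (w, v) \<in> F \<omega>)})
         in F' \<in> M \<rightarrow>\<^sub>M subset_space E \<and>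
            (AE \<omega> in M. freezing_rule T E (\<lambda>e. U e \<omega>) (F' \<omega>)) \<and>
            invariant_law T E E (`) M U F'"
      unfolding Let_def undirected_eq
      using undirected_measurable[OF coupled_F_measurable[OF c]] coupled_freezing[OF c]
        coupled_undirected_invariant[OF c] by blast
  qed
qed

end
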